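(* Let $A$ be an associative, not necessarily unital ring and $R$ a unital ring containing $A$ as a two-sided ideal. Let $M$ be any left $R$-module. Then there exist an h-unitary module $M_H$ and a morphism $\varphi:M_H\to M$ such that: (1) for every morphism $\psi:N_H\to M$ with $N_H\in\mathfrak{M}(A)$ there exists a morphism $f:N_H\to M_H$ such that $\varphi\circ f=\psi$; (2) every morphism $g:M_H\to M_H$ such that $\varphi\circ g=\varphi$ is an automorphism. Such a $\varphi:M_H\to M$ is necessarily unique up to isomorphism (it is called the $\mathfrak{M}(A)$-cover of $M$).
   Context: $A$ is an associative ring, not necessarily unital, and $R$ is a unital associative ring containing $A$ as a two-sided ideal (for instance $\tilde A=\mathbb{Z}\ltimes A$, obtained by adjoining an identity to $A$). A left $R$-module $M$ is h-unitary if the map $\mu:A\otimes_R M\to M$, $a\otimes m\mapsto am$, is an isomorphism and $\mathrm{Tor}_i^R(A,M)=0$ for all $i\ge 1$ (for $R=\tilde A$: equivalently $\mathrm{Tor}_n^{\tilde A}(\mathbb{Z},M)=0$ for all $n\ge 0$). $\mathfrak{M}(A)$ is the full subcategory of $R$-Mod of h-unitary modules. *)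

theory Defs
  imports "HOL-Algebra.Module" "HOL-Algebra.Ideal" "HOL-Algebra.Elementary_Groups"
    "HOL-Algebra.Free_Abelian_Groups"
begin

section \<open>Modules over a noncommutative ring\<close>

text \<open>
  The locale \<open>module\<close> of HOL-Algebra requires a commutative ring, so only its record type is
  reused.  The fields \<open>mult\<close> and \<open>one\<close> of a module record are never looked at.
\<close>

locale left_module = R?: ring R + M?: abelian_group M
  for R :: "'r ring" (structure) and M :: "('r, 'm) module" (structure) +
  assumes smult_closed: "\<lbrakk>r \<in> carrier R; x \<in> carrier M\<rbrakk> \<Longrightarrow> r \<odot>\<^bsub>M\<^esub> x \<in> carrier M"
    and smult_l_distr: "\<lbrakk>r \<in> carrier R; s \<in> carrier R; x \<in> carrier M\<rbrakk> \<Longrightarrow>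
      (r \<oplus>\<^bsub>R\<^esub> s) \<odot>\<^bsub>M\<^esub> x = r \<odot>\<^bsub>M\<^esub> x \<oplus>\<^bsub>M\<^esub> s \<odot>\<^bsub>M\<^esub> x"
    and smult_r_distr: "\<lbrakk>r \<in> carrier R; x \<in> carrier M; y \<in> carrier M\<rbrakk> \<Longrightarrow>
      r \<odot>\<^bsub>M\<^esub> (x \<oplus>\<^bsub>M\<^esub> y) = r \<odot>\<^bsub>M\<^esub> x \<oplus>\<^bsub>M\<^esub> r \<odot>\<^bsub>M\<^esub> y"
    and smult_assoc: "\<lbrakk>r \<in> carrier R; s \<in> carrier R; x \<in> carrier M\<rbrakk> \<Longrightarrow>
      (r \<otimes>\<^bsub>R\<^esub> s) \<odot>\<^bsub>M\<^esub> x = r \<odot>\<^bsub>M\<^esub> (s \<odot>\<^bsub>M\<^esub> x)"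
    and smult_one: "x \<in> carrier M \<Longrightarrow> \<one>\<^bsub>R\<^esub> \<odot>\<^bsub>M\<^esub> x = x"

text \<open>In a right module \<open>P\<close>, the term \<open>r \<odot>\<^bsub>P\<^esub> p\<close> stands for the product \<open>p r\<close>.\<close>

locale right_module = R?: ring R + P?: abelian_group P
  for R :: "'r ring" (structure) and P :: "('r, 'p) module" (structure) +
  assumes smult_closed: "\<lbrakk>r \<in> carrier R; x \<in> carrier P\<rbrakk> \<Longrightarrow> r \<odot>\<^bsub>P\<^esub> x \<in> carrier P"
    and smult_l_distr: "\<lbrakk>r \<in> carrier R; s \<in> carrier R; x \<in> carrier P\<rbrakk> \<Longrightarrow>
      (r \<oplus>\<^bsub>R\<^esub> s) \<odot>\<^bsub>P\<^esub> x = r \<odot>\<^bsub>P\<^esub> x \<oplus>\<^bsub>P\<^esub> s \<odot>\<^bsub>P\<^esub> x"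
    and smult_r_distr: "\<lbrakk>r \<in> carrier R; x \<in> carrier P; y \<in> carrier P\<rbrakk> \<Longrightarrow>
      r \<odot>\<^bsub>P\<^esub> (x \<oplus>\<^bsub>P\<^esub> y) = r \<odot>\<^bsub>P\<^esub> x \<oplus>\<^bsub>P\<^esub> r \<odot>\<^bsub>P\<^esub> y"
    and smult_assoc: "\<lbrakk>r \<in> carrier R; s \<in> carrier R; x \<in> carrier P\<rbrakk> \<Longrightarrow>
      (r \<otimes>\<^bsub>R\<^esub> s) \<odot>\<^bsub>P\<^esub> x = s \<odot>\<^bsub>P\<^esub> (r \<odot>\<^bsub>P\<^esub> x)"
    and smult_one: "x \<in> carrier P \<Longrightarrow> \<one>\<^bsub>R\<^esub> \<odot>\<^bsub>P\<^esub> x = x"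

text \<open>
  Homomorphisms are functions on the whole type of which only the values on the carrier matter;
  all equations between them are therefore stated on carriers.
\<close>

definition mod_hom ::
    "'r ring \<Rightarrow> ('r, 'm) module \<Rightarrow> ('r, 'n) module \<Rightarrow> ('m \<Rightarrow> 'n) set" where
  "mod_hom R M N = {h \<in> hom (add_monoid M) (add_monoid N).
     \<forall>r\<in>carrier R. \<forall>x\<in>carrier M. h (r \<odot>\<^bsub>M\<^esub> x) = r \<odot>\<^bsub>N\<^esub> h x}"

definition mod_iso ::
    "'r ring \<Rightarrow> ('r, 'm) module \<Rightarrow> ('r, 'n) module \<Rightarrow> ('m \<Rightarrow> 'n) set" where
  "mod_iso R M N = {h \<in> mod_hom R M N. bij_betw h (carrier M) (carrier N)}"

definition ideal_right_module :: "'r ring \<Rightarrow> 'r set \<Rightarrow> ('r, 'r) module" where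
  "ideal_right_module R A =
     \<lparr>carrier = A, monoid.mult = (\<otimes>\<^bsub>R\<^esub>), one = \<one>\<^bsub>R\<^esub>, ring.zero = \<zero>\<^bsub>R\<^esub>, ring.add = (\<oplus>\<^bsub>R\<^esub>),
      smult = (\<lambda>r a. a \<otimes>\<^bsub>R\<^esub> r)\<rparr>"

text \<open>The free right module on \<open>B\<close>: finitely supported functions from \<open>B\<close> to \<open>R\<close>.\<close>

definition free_right_module :: "'r ring \<Rightarrow> 'b set \<Rightarrow> ('r, 'b \<Rightarrow> 'r) module" where
  "free_right_module R B =
     \<lparr>carrier = {f. (\<forall>b. f b \<in> carrier R) \<and> (\<forall>b. b \<notin> B \<longrightarrow> f b = \<zero>\<^bsub>R\<^esub>) \<and> finite {b. f b \<noteq> \<zero>\<^bsub>R\<^esub>}},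
      monoid.mult = undefined, one = undefined,
      ring.zero = (\<lambda>b. \<zero>\<^bsub>R\<^esub>), ring.add = (\<lambda>f g b. f b \<oplus>\<^bsub>R\<^esub> g b),
      smult = (\<lambda>r f b. f b \<otimes>\<^bsub>R\<^esub> r)\<rparr>"


section \<open>Tensor products\<close>

text \<open>
  The tensor product of a right module \<open>P\<close> and a left module \<open>M\<close>, as an abelian group in
  multiplicative notation: the free abelian group on pairs modulo the usual relations.
\<close>

definition tensor_rels ::
    "'r ring \<Rightarrow> ('r, 'p) module \<Rightarrow> ('r, 'm) module \<Rightarrow> ('p \<times> 'm \<Rightarrow>\<^sub>0 int) set" where
  "tensor_rels R P M = generate (free_Abelian_group (carrier P \<times> carrier M))
     ({frag_of (p \<oplus>\<^bsub>P\<^esub> q, m) - frag_of (p, m) - frag_of (q, m) | p q m.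
         p \<in> carrier P \<and> q \<in> carrier P \<and> m \<in> carrier M} \<union>
      {frag_of (p, m \<oplus>\<^bsub>M\<^esub> n) - frag_of (p, m) - frag_of (p, n) | p m n.
         p \<in> carrier P \<and> m \<in> carrier M \<and> n \<in> carrier M} \<union>
      {frag_of (r \<odot>\<^bsub>P\<^esub> p, m) - frag_of (p, r \<odot>\<^bsub>M\<^esub> m) | p r m.
         p \<in> carrier P \<and> r \<in> carrier R \<and> m \<in> carrier M})"

definition tensor ::
    "'r ring \<Rightarrow> ('r, 'p) module \<Rightarrow> ('r, 'm) module \<Rightarrow> ('p \<times> 'm \<Rightarrow>\<^sub>0 int) set monoid" where
  "tensor R P M = free_Abelian_group (carrier P \<times> carrier M) Mod tensor_rels R P M"

text \<open>The map \<open>f \<otimes> id\<close> from \<open>P \<otimes> M\<close> to \<open>Q \<otimes> M\<close>.\<close>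

definition tensor_map ::
    "'r ring \<Rightarrow> ('r, 'q) module \<Rightarrow> ('r, 'm) module \<Rightarrow> ('p \<Rightarrow> 'q) \<Rightarrow>
     ('p \<times> 'm \<Rightarrow>\<^sub>0 int) set \<Rightarrow> ('q \<times> 'm \<Rightarrow>\<^sub>0 int) set" where
  "tensor_map R Q M f X =
     tensor_rels R Q M <#>\<^bsub>free_Abelian_group (carrier Q \<times> carrier M)\<^esub>
       (frag_extend (\<lambda>(p, m). frag_of (f p, m)) ` X)"

text \<open>
  The map \<open>\<mu>\<close> from \<open>A \<otimes> M\<close> to \<open>M\<close> that sends \<open>a \<otimes> m\<close> to \<open>a m\<close>: all representatives \<open>x\<close> of a
  coset \<open>X\<close> have the same image.
\<close>

definition tensor_mult ::
    "('r, 'm) module \<Rightarrow> ('r \<times> 'm \<Rightarrow>\<^sub>0 int) set \<Rightarrow> 'm" where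
  "tensor_mult M X = the_elem
     ((\<lambda>x. \<Oplus>\<^bsub>M\<^esub>p\<in>Poly_Mapping.keys x.
             [Poly_Mapping.lookup x p] \<cdot>\<^bsub>M\<^esub> (fst p \<odot>\<^bsub>M\<^esub> snd p)) ` X)"


section \<open>Tor\<close>

text \<open>
  The type of basis elements is infinite and at least as large as \<open>'r\<close> and \<open>'x\<close>; hence it is
  large enough for every right module with elements in \<open>'x\<close> to have a free resolution.
\<close>

type_synonym ('r, 'x) basis = "('r + 'x + nat) list"

text \<open>The boundary map \<open>d n\<close> goes from degree \<open>n + 1\<close> to degree \<open>n\<close>.\<close>

definition free_resolution ::
    "'r ring \<Rightarrow> ('r, 'x) module \<Rightarrow>
     (nat \<Rightarrow> 'b set) \<Rightarrow> (nat \<Rightarrow> ('b \<Rightarrow> 'r) \<Rightarrow> ('b \<Rightarrow> 'r)) \<Rightarrow> (('b \<Rightarrow> 'r) \<Rightarrow> 'x) \<Rightarrow> bool" where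
  "free_resolution R X B d \<epsilon> \<longleftrightarrow>
     (let F = (\<lambda>n. free_right_module R (B n)) in
       (\<forall>n. d n \<in> mod_hom R (F (Suc n)) (F n)) \<and>
       \<epsilon> \<in> mod_hom R (F 0) X \<and>
       \<epsilon> ` carrier (F 0) = carrier X \<and>
       d 0 ` carrier (F 1) = a_kernel (F 0) X \<epsilon> \<and>
       (\<forall>n. d (Suc n) ` carrier (F (Suc (Suc n))) = a_kernel (F (Suc n)) (F n) (d n)))"

definition chosen_resolution ::
    "'r ring \<Rightarrow> ('r, 'x) module \<Rightarrow>
     (nat \<Rightarrow> ('r, 'x) basis set) \<times>
     (nat \<Rightarrow> (('r, 'x) basis \<Rightarrow> 'r) \<Rightarrow> (('r, 'x) basis \<Rightarrow> 'r)) \<times>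
     ((('r, 'x) basis \<Rightarrow> 'r) \<Rightarrow> 'x)" where
  "chosen_resolution R X = (SOME (B, d, \<epsilon>). free_resolution R X B d \<epsilon>)"

text \<open>
  \<open>Tor R X M n\<close> is the \<open>n\<close>-th left derived functor of \<open>- \<otimes> M\<close> at the right module \<open>X\<close>: the
  homology in degree \<open>n\<close> of the complex \<open>F \<otimes> M\<close> for a free resolution \<open>F\<close> of \<open>X\<close>.
\<close>

definition Tor ::
    "'r ring \<Rightarrow> ('r, 'x) module \<Rightarrow> ('r, 'm) module \<Rightarrow> nat \<Rightarrow>
     ((('r, 'x) basis \<Rightarrow> 'r) \<times> 'm \<Rightarrow>\<^sub>0 int) set set monoid" where
  "Tor R X M n =
     (let (B, d, \<epsilon>) = chosen_resolution R X;
          F = (\<lambda>n. free_right_module R (B n));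
          T = (\<lambda>n. tensor R (F n) M);
          bd = (\<lambda>n. tensor_map R (F n) M (d n));
          cycles = (case n of 0 \<Rightarrow> carrier (T 0) | Suc k \<Rightarrow> kernel (T (Suc k)) (T k) (bd k));
          boundaries = bd n ` carrier (T (Suc n))
      in (T n)\<lparr>carrier := cycles\<rparr> Mod boundaries)"


section \<open>H-unitary modules and covers\<close>

text \<open>
  The map \<open>\<mu>\<close> is linear over \<open>R\<close>, so it is an isomorphism of left modules as soon as it is one of
  abelian groups.
\<close>

definition h_unitary :: "'r ring \<Rightarrow> 'r set \<Rightarrow> ('r, 'm) module \<Rightarrow> bool" where
  "h_unitary R A M \<longleftrightarrow> left_module R M \<and>
     tensor_mult M \<in> iso (tensor R (ideal_right_module R A) M) (add_monoid M) \<and>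
     (\<forall>i\<ge>1. trivial_group (Tor R (ideal_right_module R A) M i))"

text \<open>
  \<open>precover_for TYPE('n) R A M C \<phi>\<close> says that every morphism to \<open>M\<close> from an h-unitary module
  with elements in the type \<open>'n\<close> factors through \<open>\<phi>\<close>.  A formula cannot quantify over all
  modules of all types at once; instead, theorems are to be stated for an arbitrary type \<open>'n\<close>.
\<close>

definition precover_for ::
    "'n itself \<Rightarrow> 'r ring \<Rightarrow> 'r set \<Rightarrow> ('r, 'm) module \<Rightarrow> ('r, 'c) module \<Rightarrow> ('c \<Rightarrow> 'm) \<Rightarrow> bool" where
  "precover_for _ R A M C \<phi> \<longleftrightarrow>
     (\<forall>(N :: ('r, 'n) module) \<psi>. h_unitary R A N \<and> \<psi> \<in> mod_hom R N M \<longrightarrow>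
        (\<exists>f\<in>mod_hom R N C. \<forall>x\<in>carrier N. \<phi> (f x) = \<psi> x))"

definition cover_for ::
    "'n itself \<Rightarrow> 'r ring \<Rightarrow> 'r set \<Rightarrow> ('r, 'm) module \<Rightarrow> ('r, 'c) module \<Rightarrow> ('c \<Rightarrow> 'm) \<Rightarrow> bool" where
  "cover_for T R A M C \<phi> \<longleftrightarrow>
     h_unitary R A C \<and> \<phi> \<in> mod_hom R C M \<and>
     precover_for T R A M C \<phi> \<and>
     (\<forall>g\<in>mod_hom R C C. (\<forall>x\<in>carrier C. \<phi> (g x) = \<phi> x) \<longrightarrow> g \<in> mod_iso R C C)"

text \<open>
  A type of elements that has room for the covers of all modules with elements in \<open>'m\<close> (the cover
  of \<open>M\<close> has at most \<open>max |M| 2 ^ max |R| \<aleph>\<close> elements, where \<open>\<aleph>\<close> is countable infinity).  It does not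
  mention the type \<open>'n\<close> of the test modules, so that a cover with elements in this type can be
  claimed to be a cover uniformly in \<open>'n\<close>.
\<close>

type_synonym ('r, 'm) cover_elem = "('r + 'm + nat) set set"

end

theory Submission
  imports Defs
begin

text \<open>
  For a free resolution \<open>F\<close> of the right module \<open>A\<close>, a module \<open>M\<close> is h-unitary iff the complex
  \<open>\<dots> \<rightarrow> F 1 \<otimes> M \<rightarrow> F 0 \<otimes> M \<rightarrow> M \<rightarrow> 0\<close> is exact. It consists of the finitely supported families in \<open>M\<close>,
  with differentials given by matrices over \<open>R\<close>, so the class of these modules is closed under direct
  sums, directed colimits, quotients by submodules of the class and extensions.

  Bounded size: let \<open>\<psi> : N \<rightarrow> M\<close> with \<open>N\<close> in the class be such that the kernel contains no nonzero submodule
  of the class. Take \<open>N\<^sub>0 \<subseteq> N\<close> of bounded size that realizes all types of small submodules of \<open>N\<close> over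
  small subsets of \<open>N\<^sub>0\<close>. If \<open>x \<notin> N\<^sub>0\<close>, a small \<open>U \<ni> x\<close> in the class has a map \<open>\<alpha> : U \<rightarrow> N\<^sub>0\<close> over \<open>M\<close> that
  fixes \<open>U \<inter> N\<^sub>0\<close>, and the image of \<open>1 - \<alpha>\<close> is isomorphic to \<open>U / (U \<inter> N\<^sub>0)\<close>, hence a nonzero submodule of
  the class inside the kernel. So \<open>N = N\<^sub>0\<close>. As an arbitrary \<open>N\<close> may be divided by a maximal submodule of the
  class inside the kernel, the direct sum of all modules of bounded size over \<open>M\<close> is a precover \<open>P\<close>.

  From precover to cover, after Enochs: if every endomorphism of \<open>P\<close> over \<open>M\<close> could be followed by one that
  enlarges the kernel, a transfinite chain of endomorphisms would grow beyond any bound. So there is \<open>f\<close>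
  such that \<open>g f\<close> and \<open>f\<close> have the same kernel for all \<open>g\<close>, and every endomorphism over \<open>M\<close> of
  \<open>T = colim (P \<rightarrow> P \<rightarrow> \<dots>)\<close> along \<open>f\<close> is injective. By a second transfinite chain they are all surjective.
\<close>

section \<open>Modules\<close>

text \<open>The obstacle is size: test modules live in arbitrary types, and the colimits formed on
  the way to the cover live in larger types than their stages. In both places
  \<open>reduction_exists\<close> brings the module back into a type that depends on
  \<open>R\<close> and \<open>M\<close> only. Dividing by a maximal submodule of the class inside
  the kernel leaves no further one because of extensions: the preimage of a new one would be a
  larger candidate. The number of elements of \<open>N\<^sub>0\<close> is bounded because each is
  the value of a well-founded tree. That \<open>U \<inter> N\<^sub>0\<close> is again in the class
  rests on one fixed choice of preimages under the differentials: closure under a function passes to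
  intersections, mere solvability of equations does not.

  No ordinals occur. A transfinite chain is a linearly ordered system of endomorphisms of one module
  with elements in \<open>'p\<close>, maximal by Zorn's lemma. Its indices are labelled by
  \<open>'p set set\<close> and separated by an invariant in \<open>'p set\<close>, so by Cantor's
  theorem a label remains free and one more strict step enlarges the system.\<close>

lemma left_moduleE:
  assumes "left_module R M"
  shows "ring R" "abelian_group M"
  using assms unfolding left_module_def by auto

context left_module
begin

lemma smult_zero: "r \<in> carrier R \<Longrightarrow> r \<odot>\<^bsub>M\<^esub> \<zero>\<^bsub>M\<^esub> = \<zero>\<^bsub>M\<^esub>"
  by (metis M.add.l_cancel_one' M.zero_closed smult_closed smult_r_distr M.l_zero)

lemma zero_smult: "x \<in> carrier M \<Longrightarrow> \<zero>\<^bsub>R\<^esub> \<odot>\<^bsub>M\<^esub> x = \<zero>\<^bsub>M\<^esub>"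
  by (metis M.add.l_cancel_one' R.zero_closed smult_closed smult_l_distr R.l_zero)

lemma smult_minus_one: "x \<in> carrier M \<Longrightarrow> (\<ominus>\<^bsub>R\<^esub> \<one>\<^bsub>R\<^esub>) \<odot>\<^bsub>M\<^esub> x = \<ominus>\<^bsub>M\<^esub> x"
  by (metis M.minus_equality R.add.inv_closed R.l_neg R.one_closed smult_closed smult_l_distr smult_one zero_smult)

end

definition submodule_of :: "'r ring \<Rightarrow> ('r, 'm) module \<Rightarrow> 'm set \<Rightarrow> bool" where
  "submodule_of R M K \<longleftrightarrow> K \<subseteq> carrier M \<and> \<zero>\<^bsub>M\<^esub> \<in> K \<and> (\<forall>x\<in>K. \<forall>y\<in>K. x \<oplus>\<^bsub>M\<^esub> y \<in> K) \<and>
     (\<forall>r\<in>carrier R. \<forall>x\<in>K. r \<odot>\<^bsub>M\<^esub> x \<in> K)"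

lemma submodule_ofD:
  assumes "submodule_of R M K"
  shows "\<And>x. x \<in> K \<Longrightarrow> x \<in> carrier M" "\<zero>\<^bsub>M\<^esub> \<in> K" "\<And>x y. x \<in> K \<Longrightarrow> y \<in> K \<Longrightarrow> x \<oplus>\<^bsub>M\<^esub> y \<in> K"
    "\<And>r x. r \<in> carrier R \<Longrightarrow> x \<in> K \<Longrightarrow> r \<odot>\<^bsub>M\<^esub> x \<in> K"
  using assms unfolding submodule_of_def by auto

text \<open>Negation is the action of the scalar -1, so closure under scalars already contains
  it.\<close>

lemma submodule_of_a_inv:
  assumes "left_module R M" "submodule_of R M K" "x \<in> K"
  shows "\<ominus>\<^bsub>M\<^esub> x \<in> K"
proof -
  interpret left_module R M by fact
  show ?thesis
    using submodule_ofD[OF assms(2)] assms(3) smult_minus_one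
    by (metis R.add.inv_closed R.one_closed)
qed

lemma left_moduleI:
  assumes "ring R" "abelian_group M"
    "\<And>r x. \<lbrakk>r \<in> carrier R; x \<in> carrier M\<rbrakk> \<Longrightarrow> r \<odot>\<^bsub>M\<^esub> x \<in> carrier M"
    "\<And>r s x. \<lbrakk>r \<in> carrier R; s \<in> carrier R; x \<in> carrier M\<rbrakk> \<Longrightarrow>
      (r \<oplus>\<^bsub>R\<^esub> s) \<odot>\<^bsub>M\<^esub> x = r \<odot>\<^bsub>M\<^esub> x \<oplus>\<^bsub>M\<^esub> s \<odot>\<^bsub>M\<^esub> x"
    "\<And>r x y. \<lbrakk>r \<in> carrier R; x \<in> carrier M; y \<in> carrier M\<rbrakk> \<Longrightarrow>
      r \<odot>\<^bsub>M\<^esub> (x \<oplus>\<^bsub>M\<^esub> y) = r \<odot>\<^bsub>M\<^esub> x \<oplus>\<^bsub>M\<^esub> r \<odot>\<^bsub>M\<^esub> y"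
    "\<And>r s x. \<lbrakk>r \<in> carrier R; s \<in> carrier R; x \<in> carrier M\<rbrakk> \<Longrightarrow>
      (r \<otimes>\<^bsub>R\<^esub> s) \<odot>\<^bsub>M\<^esub> x = r \<odot>\<^bsub>M\<^esub> (s \<odot>\<^bsub>M\<^esub> x)"
    "\<And>x. x \<in> carrier M \<Longrightarrow> \<one>\<^bsub>R\<^esub> \<odot>\<^bsub>M\<^esub> x = x"
  shows "left_module R M"
  using assms by (simp add: left_module_def left_module_axioms_def)

lemma submodule_of_left_module:
  assumes M: "left_module R M" and K: "submodule_of R M K"
  shows "left_module R (M\<lparr>carrier := K\<rparr>)"
proof -
  interpret left_module R M by fact
  note k = submodule_ofD[OF K]
  have "abelian_group (M\<lparr>carrier := K\<rparr>)"
  proof (rule abelian_groupI)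
    fix x assume "x \<in> carrier (M\<lparr>carrier := K\<rparr>)"
    then show "\<exists>y\<in>carrier (M\<lparr>carrier := K\<rparr>). y \<oplus>\<^bsub>M\<lparr>carrier := K\<rparr>\<^esub> x = \<zero>\<^bsub>M\<lparr>carrier := K\<rparr>\<^esub>"
      using k(1) submodule_of_a_inv[OF M K, of x] by (auto intro!: bexI[of _ "\<ominus>\<^bsub>M\<^esub> x"] simp: M.l_neg)
  qed (use k in \<open>auto simp: M.a_ac\<close>)
  then show ?thesis
    by (intro left_moduleI)
      (use k in \<open>auto intro: R.ring_axioms simp: smult_l_distr smult_r_distr smult_assoc smult_one\<close>)
qed

lemma submodule_of_zero: "left_module R M \<Longrightarrow> submodule_of R M {\<zero>\<^bsub>M\<^esub>}"
proof -
  assume "left_module R M"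
  then interpret left_module R M .
  show ?thesis by (auto simp: submodule_of_def smult_zero)
qed

section \<open>Homomorphisms, kernels and images\<close>

lemma mod_homI:
  assumes "\<And>x. x \<in> carrier M \<Longrightarrow> h x \<in> carrier N"
    and "\<And>x y. \<lbrakk>x \<in> carrier M; y \<in> carrier M\<rbrakk> \<Longrightarrow> h (x \<oplus>\<^bsub>M\<^esub> y) = h x \<oplus>\<^bsub>N\<^esub> h y"
    and "\<And>r x. \<lbrakk>r \<in> carrier R; x \<in> carrier M\<rbrakk> \<Longrightarrow> h (r \<odot>\<^bsub>M\<^esub> x) = r \<odot>\<^bsub>N\<^esub> h x"
  shows "h \<in> mod_hom R M N"
  using assms by (auto simp: mod_hom_def hom_def)

lemma mod_homD:
  assumes "h \<in> mod_hom R M N"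
  shows "\<And>x. x \<in> carrier M \<Longrightarrow> h x \<in> carrier N"
    and "\<And>x y. \<lbrakk>x \<in> carrier M; y \<in> carrier M\<rbrakk> \<Longrightarrow> h (x \<oplus>\<^bsub>M\<^esub> y) = h x \<oplus>\<^bsub>N\<^esub> h y"
    and "\<And>r x. \<lbrakk>r \<in> carrier R; x \<in> carrier M\<rbrakk> \<Longrightarrow> h (r \<odot>\<^bsub>M\<^esub> x) = r \<odot>\<^bsub>N\<^esub> h x"
  using assms by (auto simp: mod_hom_def hom_def)

lemma additive_zero:
  assumes "abelian_group M" "abelian_group N" "h \<in> hom (add_monoid M) (add_monoid N)"
  shows "h \<zero>\<^bsub>M\<^esub> = \<zero>\<^bsub>N\<^esub>"
proof -
  interpret M: abelian_group M by fact
  interpret N: abelian_group N by fact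
  show ?thesis
    using group_hom.hom_one[of "add_monoid M" "add_monoid N" h] assms(3) M.a_group N.a_group
    by (simp add: group_hom_def group_hom_axioms_def)
qed

lemma additive_a_inv:
  assumes "abelian_group M" "abelian_group N" "h \<in> hom (add_monoid M) (add_monoid N)" "x \<in> carrier M"
  shows "h (\<ominus>\<^bsub>M\<^esub> x) = \<ominus>\<^bsub>N\<^esub> h x"
proof -
  interpret M: abelian_group M by fact
  interpret N: abelian_group N by fact
  show ?thesis
    using group_hom.hom_inv[of "add_monoid M" "add_monoid N" h x] assms(3,4) M.a_group N.a_group
    by (simp add: group_hom_def group_hom_axioms_def a_inv_def)
qed

lemma additive_minus:
  assumes "abelian_group M" "abelian_group N" "h \<in> hom (add_monoid M) (add_monoid N)"
    "x \<in> carrier M" "y \<in> carrier M"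
  shows "h (x \<ominus>\<^bsub>M\<^esub> y) = h x \<ominus>\<^bsub>N\<^esub> h y"
proof -
  interpret M: abelian_group M by fact
  show ?thesis
    using assms(3-) additive_a_inv[OF assms(1-3)] unfolding a_minus_def by (simp add: hom_def)
qed

lemma mod_hom_hom: "h \<in> mod_hom R M N \<Longrightarrow> h \<in> hom (add_monoid M) (add_monoid N)"
  by (simp add: mod_hom_def)

lemma mod_hom_minus:
  assumes "left_module R M" "left_module R N" "h \<in> mod_hom R M N"
  shows "h \<zero>\<^bsub>M\<^esub> = \<zero>\<^bsub>N\<^esub>" "x \<in> carrier M \<Longrightarrow> h (\<ominus>\<^bsub>M\<^esub> x) = \<ominus>\<^bsub>N\<^esub> h x"
    "x \<in> carrier M \<Longrightarrow> y \<in> carrier M \<Longrightarrow> h (x \<ominus>\<^bsub>M\<^esub> y) = h x \<ominus>\<^bsub>N\<^esub> h y"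
  using left_moduleE[OF assms(1)] left_moduleE[OF assms(2)] mod_hom_hom[OF assms(3)]
  by (auto intro: additive_zero additive_a_inv additive_minus)

lemma mod_hom_comp:
  assumes "h \<in> mod_hom R M N" "k \<in> mod_hom R N P"
  shows "(\<lambda>x. k (h x)) \<in> mod_hom R M P"
  by (rule mod_homI) (simp_all add: mod_homD[OF assms(1)] mod_homD[OF assms(2)])

lemma mod_hom_id: "(\<lambda>x. x) \<in> mod_hom R M M"
  by (rule mod_homI) auto

lemma mod_hom_incl: "K \<subseteq> carrier M \<Longrightarrow> (\<lambda>x. x) \<in> mod_hom R (M\<lparr>carrier := K\<rparr>) M"
  by (rule mod_homI) auto

lemma submodule_of_kernel:
  assumes "left_module R M" "left_module R N" "h \<in> mod_hom R M N"
  shows "submodule_of R M {x \<in> carrier M. h x = \<zero>\<^bsub>N\<^esub>}"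
proof -
  interpret M: left_module R M by fact
  interpret N: left_module R N by fact
  show ?thesis
    unfolding submodule_of_def
    using mod_homD[OF assms(3)] mod_hom_minus(1)[OF assms] by (auto simp: M.smult_closed N.smult_zero)
qed

lemma submodule_of_image:
  assumes "left_module R M" "left_module R N" "h \<in> mod_hom R M N"
  shows "submodule_of R N (h ` carrier M)"
proof -
  interpret M: left_module R M by fact
  interpret N: left_module R N by fact
  note hd = mod_homD[OF assms(3)]
  show ?thesis
    unfolding submodule_of_def
  proof (intro conjI ballI)
    show "\<zero>\<^bsub>N\<^esub> \<in> h ` carrier M" using mod_hom_minus(1)[OF assms] by (metis M.zero_closed imageI)
    show "x \<oplus>\<^bsub>N\<^esub> y \<in> h ` carrier M" if "x \<in> h ` carrier M" "y \<in> h ` carrier M" for x y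
      using that hd(2) by (metis (no_types, opaque_lifting) M.a_closed imageE imageI)
    show "r \<odot>\<^bsub>N\<^esub> x \<in> h ` carrier M" if "r \<in> carrier R" "x \<in> h ` carrier M" for r x
      using that hd(3) by (metis (no_types, opaque_lifting) M.smult_closed imageE imageI)
  qed (use hd in auto)
qed

lemma (in abelian_group) minus_eq_zero_iff:
  "x \<in> carrier G \<Longrightarrow> y \<in> carrier G \<Longrightarrow> x \<ominus> y = \<zero> \<longleftrightarrow> x = y"
  unfolding a_minus_def by (metis add.inv_closed add.inv_equality minus_minus r_neg)

lemma (in abelian_group) minus_add_cancel:
  "x \<in> carrier G \<Longrightarrow> y \<in> carrier G \<Longrightarrow> (x \<ominus> y) \<oplus> y = x"
  unfolding a_minus_def by (simp add: a_assoc l_neg)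

text \<open>Used for addition of cosets and for the additivity of a map of the form identity minus
  homomorphism.\<close>

lemma (in abelian_group) add_minus_add:
  assumes "a \<in> carrier G" "b \<in> carrier G" "c \<in> carrier G" "d \<in> carrier G"
  shows "(a \<oplus> b) \<ominus> (c \<oplus> d) = (a \<ominus> c) \<oplus> (b \<ominus> d)"
  unfolding a_minus_def using assms by (simp add: minus_add a_ac)

lemma (in left_module) smult_minus:
  assumes "r \<in> carrier R" "x \<in> carrier M" "y \<in> carrier M"
  shows "r \<odot>\<^bsub>M\<^esub> (x \<ominus>\<^bsub>M\<^esub> y) = r \<odot>\<^bsub>M\<^esub> x \<ominus>\<^bsub>M\<^esub> r \<odot>\<^bsub>M\<^esub> y"
proof -
  have "r \<odot>\<^bsub>M\<^esub> (\<ominus>\<^bsub>M\<^esub> y) = \<ominus>\<^bsub>M\<^esub> (r \<odot>\<^bsub>M\<^esub> y)"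
    using assms smult_r_distr[of r "\<ominus>\<^bsub>M\<^esub> y" y]
    by (metis M.add.inv_closed M.l_neg M.minus_equality smult_closed smult_zero)
  then show ?thesis
    using assms by (simp add: a_minus_def smult_r_distr)
qed

text \<open>Serves both to form quotients and to move a module to another type.\<close>

definition push_module :: "('r, 'm) module \<Rightarrow> ('m \<Rightarrow> 'n) \<Rightarrow> ('r, 'n) module" where
  "push_module M g =
     \<lparr>carrier = g ` carrier M, monoid.mult = undefined, one = undefined, ring.zero = g \<zero>\<^bsub>M\<^esub>,
      ring.add = (\<lambda>x y. g (inv_into (carrier M) g x \<oplus>\<^bsub>M\<^esub> inv_into (carrier M) g y)),
      smult = (\<lambda>r x. g (r \<odot>\<^bsub>M\<^esub> inv_into (carrier M) g x))\<rparr>"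

text \<open>The values of \<open>g\<close> stand for the cosets of \<open>K\<close>. The operations
  pick representatives with \<open>inv_into\<close>; another representative differs by an element of
  \<open>K\<close>, and sums and scalars preserve this. With \<open>K = {0}\<close> the result is an
  isomorphic copy.\<close>

lemma push_module:
  fixes R :: "'r ring" and M :: "('r, 'm) module" and g :: "'m \<Rightarrow> 'n"
  assumes M: "left_module R M" and K: "submodule_of R M K"
    and g': "\<forall>x\<in>carrier M. \<forall>y\<in>carrier M. g x = g y \<longleftrightarrow> x \<ominus>\<^bsub>M\<^esub> y \<in> K"
  shows "left_module R (push_module M g)" "g \<in> mod_hom R M (push_module M g)"
    "carrier (push_module M g) = g ` carrier M"
    "\<And>x. x \<in> carrier M \<Longrightarrow> g x = \<zero>\<^bsub>push_module M g\<^esub> \<longleftrightarrow> x \<in> K"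
proof -
  interpret left_module R M by fact
  note k = submodule_ofD[OF K]
  have g: "g x = g y \<longleftrightarrow> x \<ominus>\<^bsub>M\<^esub> y \<in> K" if "x \<in> carrier M" "y \<in> carrier M" for x y
    using g' that by blast
  let ?i = "inv_into (carrier M) g"
  let ?Q = "push_module M g"
  have i: "?i (g x) \<in> carrier M" "g (?i (g x)) = g x" if "x \<in> carrier M" for x
    using that by (auto intro: inv_into_into f_inv_into_f)
  have add: "g x \<oplus>\<^bsub>?Q\<^esub> g y = g (x \<oplus>\<^bsub>M\<^esub> y)" if "x \<in> carrier M" "y \<in> carrier M" for x y
  proof -
    have "(?i (g x) \<oplus>\<^bsub>M\<^esub> ?i (g y)) \<ominus>\<^bsub>M\<^esub> (x \<oplus>\<^bsub>M\<^esub> y) = (?i (g x) \<ominus>\<^bsub>M\<^esub> x) \<oplus>\<^bsub>M\<^esub> (?i (g y) \<ominus>\<^bsub>M\<^esub> y)"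
      using i that by (intro M.add_minus_add)
    moreover have "?i (g x) \<ominus>\<^bsub>M\<^esub> x \<in> K" "?i (g y) \<ominus>\<^bsub>M\<^esub> y \<in> K"
      using i that g by auto
    ultimately have "g (?i (g x) \<oplus>\<^bsub>M\<^esub> ?i (g y)) = g (x \<oplus>\<^bsub>M\<^esub> y)"
      using i that g k(3) by auto
    then show ?thesis by (simp add: push_module_def)
  qed
  have sm: "r \<odot>\<^bsub>?Q\<^esub> g x = g (r \<odot>\<^bsub>M\<^esub> x)" if "r \<in> carrier R" "x \<in> carrier M" for r x
  proof -
    have "?i (g x) \<ominus>\<^bsub>M\<^esub> x \<in> K" using i that g by auto
    then have "g (r \<odot>\<^bsub>M\<^esub> ?i (g x)) = g (r \<odot>\<^bsub>M\<^esub> x)"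
      using g[of "r \<odot>\<^bsub>M\<^esub> ?i (g x)" "r \<odot>\<^bsub>M\<^esub> x"] smult_minus[of r "?i (g x)" x]
        k(4)[of r "?i (g x) \<ominus>\<^bsub>M\<^esub> x"] that i(1)[of x]
      by (simp add: smult_closed)
    then show ?thesis by (simp add: push_module_def)
  qed
  show c: "carrier ?Q = g ` carrier M" by (simp add: push_module_def)
  have z: "\<zero>\<^bsub>?Q\<^esub> = g \<zero>\<^bsub>M\<^esub>" by (simp add: push_module_def)
  have "abelian_group ?Q"
  proof (rule abelian_groupI)
    show "x \<oplus>\<^bsub>?Q\<^esub> y \<in> carrier ?Q" if "x \<in> carrier ?Q" "y \<in> carrier ?Q" for x y
      using that by (auto simp: c add)
    show "\<zero>\<^bsub>?Q\<^esub> \<in> carrier ?Q" by (auto simp: c z)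
    show "x \<oplus>\<^bsub>?Q\<^esub> y \<oplus>\<^bsub>?Q\<^esub> w = x \<oplus>\<^bsub>?Q\<^esub> (y \<oplus>\<^bsub>?Q\<^esub> w)"
      if "x \<in> carrier ?Q" "y \<in> carrier ?Q" "w \<in> carrier ?Q" for x y w
      using that by (auto simp: c add M.a_assoc)
    show "x \<oplus>\<^bsub>?Q\<^esub> y = y \<oplus>\<^bsub>?Q\<^esub> x" if "x \<in> carrier ?Q" "y \<in> carrier ?Q" for x y
      using that by (auto simp: c add M.a_comm)
    show "\<zero>\<^bsub>?Q\<^esub> \<oplus>\<^bsub>?Q\<^esub> x = x" if "x \<in> carrier ?Q" for x
      using that by (auto simp: c add z)
    show "\<exists>y\<in>carrier ?Q. y \<oplus>\<^bsub>?Q\<^esub> x = \<zero>\<^bsub>?Q\<^esub>" if x: "x \<in> carrier ?Q" for x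
    proof -
      obtain u where "u \<in> carrier M" "x = g u" using x unfolding c by auto
      then show ?thesis using add[of "\<ominus>\<^bsub>M\<^esub> u" u] M.l_neg[of u] c z by (auto intro!: bexI[of _ "g (\<ominus>\<^bsub>M\<^esub> u)"])
    qed
  qed
  then show "left_module R ?Q"
    by (intro left_moduleI)
      (auto simp: c add sm smult_closed smult_l_distr smult_r_distr smult_assoc smult_one intro: R.ring_axioms)
  show "g \<in> mod_hom R M ?Q"
    by (rule mod_homI) (auto simp: c add sm)
  show "g x = \<zero>\<^bsub>?Q\<^esub> \<longleftrightarrow> x \<in> K" if "x \<in> carrier M" for x
    using that g[of x "\<zero>\<^bsub>M\<^esub>"] M.minus_add_cancel[of x "\<zero>\<^bsub>M\<^esub>"] by (simp add: z)
qed

text \<open>Outside \<open>I\<close> the entries are pinned to the zero field of \<open>N i\<close>,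
  which need not be a module there; this explains the guards in the operations.\<close>

definition pointwise_module :: "'i set \<Rightarrow> ('i \<Rightarrow> ('r, 'n) module) \<Rightarrow> ('r, 'i \<Rightarrow> 'n) module" where
  "pointwise_module I N =
     \<lparr>carrier = {z. (\<forall>i\<in>I. z i \<in> carrier (N i)) \<and> (\<forall>i. i \<notin> I \<longrightarrow> z i = \<zero>\<^bsub>N i\<^esub>)},
      monoid.mult = undefined, one = undefined, ring.zero = (\<lambda>i. \<zero>\<^bsub>N i\<^esub>),
      ring.add = (\<lambda>x y i. if i \<in> I then x i \<oplus>\<^bsub>N i\<^esub> y i else \<zero>\<^bsub>N i\<^esub>),
      smult = (\<lambda>r x i. if i \<in> I then r \<odot>\<^bsub>N i\<^esub> x i else \<zero>\<^bsub>N i\<^esub>)\<rparr>"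

definition fin_supp :: "'i set \<Rightarrow> ('i \<Rightarrow> ('r, 'n) module) \<Rightarrow> ('i \<Rightarrow> 'n) set" where
  "fin_supp I N = {z \<in> carrier (pointwise_module I N). finite {i. z i \<noteq> \<zero>\<^bsub>N i\<^esub>}}"

definition direct_sum :: "'i set \<Rightarrow> ('i \<Rightarrow> ('r, 'n) module) \<Rightarrow> ('r, 'i \<Rightarrow> 'n) module" where
  "direct_sum I N = (pointwise_module I N)\<lparr>carrier := fin_supp I N\<rparr>"

lemma pointwise_module_sel:
  "z \<in> carrier (pointwise_module I N) \<longleftrightarrow> (\<forall>i\<in>I. z i \<in> carrier (N i)) \<and> (\<forall>i. i \<notin> I \<longrightarrow> z i = \<zero>\<^bsub>N i\<^esub>)"
  "\<zero>\<^bsub>pointwise_module I N\<^esub> = (\<lambda>i. \<zero>\<^bsub>N i\<^esub>)"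
  "x \<oplus>\<^bsub>pointwise_module I N\<^esub> y = (\<lambda>i. if i \<in> I then x i \<oplus>\<^bsub>N i\<^esub> y i else \<zero>\<^bsub>N i\<^esub>)"
  "r \<odot>\<^bsub>pointwise_module I N\<^esub> x = (\<lambda>i. if i \<in> I then r \<odot>\<^bsub>N i\<^esub> x i else \<zero>\<^bsub>N i\<^esub>)"
  by (auto simp: pointwise_module_def)

lemma pointwise_module:
  assumes R: "ring R" and N: "\<And>i. i \<in> I \<Longrightarrow> left_module R (N i)"
  shows "left_module R (pointwise_module I N)"
proof -
  let ?Q = "pointwise_module I N"
  note s = pointwise_module_sel
  have ag: "abelian_group (N i)" if "i \<in> I" for i using left_moduleE[OF N[OF that]] by simp
  note a = abelian_groupE[OF ag]
  have "abelian_group ?Q"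
  proof (rule abelian_groupI)
    show "\<exists>y\<in>carrier ?Q. y \<oplus>\<^bsub>?Q\<^esub> x = \<zero>\<^bsub>?Q\<^esub>" if "x \<in> carrier ?Q" for x
      by (rule bexI[of _ "\<lambda>i. if i \<in> I then \<ominus>\<^bsub>N i\<^esub> x i else \<zero>\<^bsub>N i\<^esub>"])
        (use that ag in \<open>auto simp: s fun_eq_iff abelian_group.l_neg abelian_group.a_inv_closed\<close>)
    show "x \<oplus>\<^bsub>?Q\<^esub> y = y \<oplus>\<^bsub>?Q\<^esub> x" if "x \<in> carrier ?Q" "y \<in> carrier ?Q" for x y
      using that by (auto simp: s fun_eq_iff a)
    show "x \<oplus>\<^bsub>?Q\<^esub> y \<oplus>\<^bsub>?Q\<^esub> w = x \<oplus>\<^bsub>?Q\<^esub> (y \<oplus>\<^bsub>?Q\<^esub> w)"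
      if "x \<in> carrier ?Q" "y \<in> carrier ?Q" "w \<in> carrier ?Q" for x y w
      using that by (auto simp: s fun_eq_iff a(3))
  qed (auto simp: s fun_eq_iff a(1,2,5))
  then show ?thesis
    by (intro left_moduleI[OF R])
      (auto simp: s fun_eq_iff left_module.smult_closed[OF N] left_module.smult_l_distr[OF N]
         left_module.smult_r_distr[OF N] left_module.smult_assoc[OF N] left_module.smult_one[OF N])
qed

lemma submodule_of_fin_supp:
  assumes R: "ring R" and N: "\<And>i. i \<in> I \<Longrightarrow> left_module R (N i)"
  shows "submodule_of R (pointwise_module I N) (fin_supp I N)"
proof -
  interpret Q: left_module R "pointwise_module I N" by (rule pointwise_module[OF assms])
  have ag: "abelian_group (N i)" if "i \<in> I" for i using left_moduleE[OF N[OF that]] by simp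
  note s = pointwise_module_sel
  show ?thesis
    unfolding submodule_of_def fin_supp_def
  proof (intro conjI ballI CollectI; clarsimp?)
    fix x y
    assume "finite {i. x i \<noteq> \<zero>\<^bsub>N i\<^esub>}" "finite {i. y i \<noteq> \<zero>\<^bsub>N i\<^esub>}"
    then have "finite ({i. x i \<noteq> \<zero>\<^bsub>N i\<^esub>} \<union> {i. y i \<noteq> \<zero>\<^bsub>N i\<^esub>})" by blast
    then show "finite {i. (x \<oplus>\<^bsub>pointwise_module I N\<^esub> y) i \<noteq> \<zero>\<^bsub>N i\<^esub>}"
      by (rule rev_finite_subset) (auto simp: s abelian_groupE[OF ag])
  next
    fix r x
    assume "finite {i. x i \<noteq> \<zero>\<^bsub>N i\<^esub>}" "r \<in> carrier R"
    then show "finite {i. (r \<odot>\<^bsub>pointwise_module I N\<^esub> x) i \<noteq> \<zero>\<^bsub>N i\<^esub>}"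
      by (elim rev_finite_subset) (auto simp: s left_module.smult_zero[OF N])
  qed (auto simp: s left_module.smult_closed[OF N] abelian_groupE[OF ag])
qed

lemma direct_sum:
  assumes "ring R" and "\<And>i. i \<in> I \<Longrightarrow> left_module R (N i)"
  shows "left_module R (direct_sum I N)"
  unfolding direct_sum_def
  by (rule submodule_of_left_module[OF pointwise_module submodule_of_fin_supp]) (use assms in auto)

lemma direct_sum_sel:
  "carrier (direct_sum I N) = fin_supp I N"
  "\<zero>\<^bsub>direct_sum I N\<^esub> = (\<lambda>i. \<zero>\<^bsub>N i\<^esub>)"
  "x \<oplus>\<^bsub>direct_sum I N\<^esub> y = (\<lambda>i. if i \<in> I then x i \<oplus>\<^bsub>N i\<^esub> y i else \<zero>\<^bsub>N i\<^esub>)"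
  "r \<odot>\<^bsub>direct_sum I N\<^esub> x = (\<lambda>i. if i \<in> I then r \<odot>\<^bsub>N i\<^esub> x i else \<zero>\<^bsub>N i\<^esub>)"
  by (auto simp: direct_sum_def pointwise_module_sel)

lemma fin_supp_iff:
  "z \<in> fin_supp I N \<longleftrightarrow> (\<forall>i\<in>I. z i \<in> carrier (N i)) \<and> (\<forall>i. i \<notin> I \<longrightarrow> z i = \<zero>\<^bsub>N i\<^esub>) \<and> finite {i. z i \<noteq> \<zero>\<^bsub>N i\<^esub>}"
  by (auto simp: fin_supp_def pointwise_module_sel)

section \<open>Finitely supported sums\<close>

text \<open>Summing over the support keeps finite index sets out of the matrix identities;
  \<open>supp_sum_superset\<close> supplies a common finite set where two sums must be
  compared.\<close>

definition supp_sum :: "('a, 'b) ring_scheme \<Rightarrow> ('i \<Rightarrow> 'a) \<Rightarrow> 'a" where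
  "supp_sum G f = finsum G f {i. f i \<noteq> \<zero>\<^bsub>G\<^esub>}"

context abelian_group
begin

lemma supp_sum_superset:
  assumes "finite S" "\<And>i. f i \<in> carrier G" "{i. f i \<noteq> \<zero>} \<subseteq> S"
  shows "supp_sum G f = finsum G f S"
  unfolding supp_sum_def
  by (rule add.finprod_mono_neutral_cong_left) (use assms in auto)

lemma supp_sum_closed:
  assumes "\<And>i. f i \<in> carrier G"
  shows "supp_sum G f \<in> carrier G"
  unfolding supp_sum_def using assms by (intro finsum_closed) auto

lemma supp_sum_zero: "supp_sum G (\<lambda>i. \<zero>) = \<zero>"
  by (simp add: supp_sum_def)

lemma supp_sum_single: "x \<in> carrier G \<Longrightarrow> supp_sum G (\<lambda>i. if i = c then x else \<zero>) = x"
  by (subst supp_sum_superset[of "{c}"]) auto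

lemma supp_sum_add:
  assumes "\<And>i. f i \<in> carrier G" "\<And>i. g i \<in> carrier G" "finite {i. f i \<noteq> \<zero>}" "finite {i. g i \<noteq> \<zero>}"
  shows "supp_sum G (\<lambda>i. f i \<oplus> g i) = supp_sum G f \<oplus> supp_sum G g"
proof -
  let ?S = "{i. f i \<noteq> \<zero>} \<union> {i. g i \<noteq> \<zero>}"
  have "supp_sum G (\<lambda>i. f i \<oplus> g i) = finsum G (\<lambda>i. f i \<oplus> g i) ?S"
    using assms by (intro supp_sum_superset) auto
  also have "\<dots> = finsum G f ?S \<oplus> finsum G g ?S"
    using assms by (intro finsum_addf) auto
  also have "\<dots> = supp_sum G f \<oplus> supp_sum G g"
    using assms by (subst (1 2) supp_sum_superset[of ?S]) auto
  finally show ?thesis .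
qed

lemma finsum_hom:
  assumes "abelian_group H" "h \<in> hom (add_monoid G) (add_monoid H)" "finite S" "\<And>i. i \<in> S \<Longrightarrow> f i \<in> carrier G"
  shows "h (finsum G f S) = finsum H (\<lambda>i. h (f i)) S"
proof -
  interpret H: abelian_group H by fact
  show ?thesis
    using assms(3,4)
  proof (induction S rule: finite_induct)
    case empty
    show ?case using additive_zero[OF abelian_group_axioms assms(1,2)] by simp
  next
    case (insert x S)
    have "h (finsum G f (insert x S)) = h (f x \<oplus> finsum G f S)"
      using insert by (subst finsum_insert) auto
    also have "\<dots> = h (f x) \<oplus>\<^bsub>H\<^esub> h (finsum G f S)"
      using assms(2) insert.prems by (simp add: hom_def)
    also have "\<dots> = finsum H (\<lambda>i. h (f i)) (insert x S)"
      using insert assms(2) by (subst H.finsum_insert) (auto simp: hom_def)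
    finally show ?case .
  qed
qed

lemma supp_sum_hom:
  assumes "abelian_group H" "h \<in> hom (add_monoid G) (add_monoid H)" "\<And>i. f i \<in> carrier G" "finite {i. f i \<noteq> \<zero>}"
  shows "h (supp_sum G f) = supp_sum H (\<lambda>i. h (f i))"
proof -
  interpret H: abelian_group H by fact
  have "h (supp_sum G f) = finsum H (\<lambda>i. h (f i)) {i. f i \<noteq> \<zero>}"
    unfolding supp_sum_def using assms by (intro finsum_hom) auto
  also have "\<dots> = supp_sum H (\<lambda>i. h (f i))"
    using assms additive_zero[OF abelian_group_axioms assms(1,2)]
    by (intro H.supp_sum_superset[symmetric]) (auto simp: hom_def)
  finally show ?thesis .
qed

end

section \<open>Finitely supported families in one module\<close>

abbreviation power_module :: "'i set \<Rightarrow> ('r, 'm) module \<Rightarrow> ('r, 'i \<Rightarrow> 'm) module" where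
  "power_module I M \<equiv> direct_sum I (\<lambda>_. M)"

lemma fin_supp_closed:
  "abelian_group M \<Longrightarrow> z \<in> fin_supp I (\<lambda>_. M) \<Longrightarrow> z i \<in> carrier M"
  by (cases "i \<in> I") (auto simp: fin_supp_iff abelian_groupE)

lemma fin_supp_single:
  "abelian_group M \<Longrightarrow> c \<in> I \<Longrightarrow> x \<in> carrier M \<Longrightarrow> (\<lambda>i. if i = c then x else \<zero>\<^bsub>M\<^esub>) \<in> fin_supp I (\<lambda>_. M)"
  by (auto simp: fin_supp_iff abelian_groupE)

lemma fin_supp_zero: "abelian_group M \<Longrightarrow> (\<lambda>_. \<zero>\<^bsub>M\<^esub>) \<in> fin_supp I (\<lambda>_. M)"
  by (auto simp: fin_supp_iff abelian_groupE)

lemma fin_supp_add: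
  assumes "abelian_group M" "x \<in> fin_supp I (\<lambda>_. M)" "y \<in> fin_supp I (\<lambda>_. M)"
  shows "(\<lambda>i. x i \<oplus>\<^bsub>M\<^esub> y i) \<in> fin_supp I (\<lambda>_. M)"
proof -
  interpret abelian_group M by fact
  have "finite ({i. x i \<noteq> \<zero>\<^bsub>M\<^esub>} \<union> {i. y i \<noteq> \<zero>\<^bsub>M\<^esub>})" using assms by (auto simp: fin_supp_iff)
  then have "finite {i. x i \<oplus>\<^bsub>M\<^esub> y i \<noteq> \<zero>\<^bsub>M\<^esub>}" by (rule rev_finite_subset) auto
  then show ?thesis using assms(2,3) by (auto simp: fin_supp_iff)
qed

lemma fin_supp_hom:
  assumes "z \<in> fin_supp I (\<lambda>_. M)" "\<And>x. x \<in> carrier M \<Longrightarrow> h x \<in> carrier N" "h \<zero>\<^bsub>M\<^esub> = \<zero>\<^bsub>N\<^esub>"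
  shows "(\<lambda>i. h (z i)) \<in> fin_supp I (\<lambda>_. N)"
proof -
  have "finite {i. z i \<noteq> \<zero>\<^bsub>M\<^esub>}" using assms by (auto simp: fin_supp_iff)
  then have "finite {i. h (z i) \<noteq> \<zero>\<^bsub>N\<^esub>}" by (rule rev_finite_subset) (auto simp: assms)
  then show ?thesis using assms by (auto simp: fin_supp_iff)
qed

lemma fin_supp_minus:
  assumes "abelian_group M" "x \<in> fin_supp I (\<lambda>_. M)" "y \<in> fin_supp I (\<lambda>_. M)"
  shows "(\<lambda>i. x i \<ominus>\<^bsub>M\<^esub> y i) \<in> fin_supp I (\<lambda>_. M)"
proof -
  interpret abelian_group M by fact
  have "(\<lambda>i. \<ominus>\<^bsub>M\<^esub> y i) \<in> fin_supp I (\<lambda>_. M)"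
    by (rule fin_supp_hom[OF assms(3)]) auto
  then show ?thesis
    unfolding a_minus_def by (rule fin_supp_add[OF assms(1,2)])
qed

lemma fin_supp_mono:
  "z \<in> fin_supp I (\<lambda>_. M) \<Longrightarrow> (\<And>i. i \<in> I \<Longrightarrow> z i \<in> K) \<Longrightarrow> z \<in> fin_supp I (\<lambda>_. M\<lparr>carrier := K\<rparr>)"
  by (auto simp: fin_supp_iff)

lemma fin_supp_mono':
  "z \<in> fin_supp I (\<lambda>_. M\<lparr>carrier := K\<rparr>) \<Longrightarrow> K \<subseteq> carrier M \<Longrightarrow> z \<in> fin_supp I (\<lambda>_. M)"
  by (auto simp: fin_supp_iff)

text \<open>Splitting one entry off the support reduces additive statements to families with a
  single entry. Matrix identities and coordinates in free modules are treated this way.\<close>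

lemma fin_supp_induct [consumes 2, case_names zero add]:
  assumes M: "abelian_group M" and z: "z \<in> fin_supp I (\<lambda>_. M)"
    and zero: "P (\<lambda>_. \<zero>\<^bsub>M\<^esub>)"
    and add: "\<And>y c m. \<lbrakk>y \<in> fin_supp I (\<lambda>_. M); c \<in> I; m \<in> carrier M; P y\<rbrakk> \<Longrightarrow>
      P (\<lambda>i. y i \<oplus>\<^bsub>M\<^esub> (if i = c then m else \<zero>\<^bsub>M\<^esub>))"
  shows "P z"
proof -
  interpret abelian_group M by fact
  have "P z" if "finite S" "z \<in> fin_supp I (\<lambda>_. M)" "{i. z i \<noteq> \<zero>\<^bsub>M\<^esub>} = S" for S z
    using that
  proof (induction S arbitrary: z rule: finite_induct)
    case empty
    then have "z = (\<lambda>_. \<zero>\<^bsub>M\<^esub>)" by auto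
    then show ?case using zero by simp
  next
    case (insert c S)
    let ?y = "z(c := \<zero>\<^bsub>M\<^esub>)"
    have zc: "z i \<in> carrier M" for i by (rule fin_supp_closed[OF M insert.prems(1)])
    have S: "z i \<noteq> \<zero>\<^bsub>M\<^esub> \<longleftrightarrow> i = c \<or> i \<in> S" for i
    proof -
      have "i \<in> {i. z i \<noteq> \<zero>\<^bsub>M\<^esub>} \<longleftrightarrow> i \<in> insert c S" by (simp only: insert.prems(2))
      then show ?thesis by simp
    qed
    then have yS: "{i. ?y i \<noteq> \<zero>\<^bsub>M\<^esub>} = S" using insert.hyps(2) by (auto split: if_splits)
    then have y: "?y \<in> fin_supp I (\<lambda>_. M)" "{i. ?y i \<noteq> \<zero>\<^bsub>M\<^esub>} = S"
      using insert.hyps(1) insert.prems(1) unfolding fin_supp_iff by auto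
    have "c \<in> I" using insert.prems(1) S unfolding fin_supp_iff by blast
    from add[OF y(1) this zc insert.IH[OF y]]
    have "P (\<lambda>i. ?y i \<oplus>\<^bsub>M\<^esub> (if i = c then z c else \<zero>\<^bsub>M\<^esub>))" .
    moreover have "(\<lambda>i. ?y i \<oplus>\<^bsub>M\<^esub> (if i = c then z c else \<zero>\<^bsub>M\<^esub>)) = z"
      using zc by auto
    ultimately show ?case by simp
  qed
  then show ?thesis using z by (auto simp: fin_supp_iff)
qed


section \<open>Complexes given by matrices\<close>

text \<open>This is the map that a matrix \<open>P\<close> over \<open>R\<close>, seen as a map of
  free right modules, induces after tensoring with \<open>M\<close>.\<close>

definition mat_apply :: "('b \<Rightarrow> 'c \<Rightarrow> 'r) \<Rightarrow> ('r, 'm) module \<Rightarrow> ('c \<Rightarrow> 'm) \<Rightarrow> 'b \<Rightarrow> 'm" where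
  "mat_apply P M z = (\<lambda>b. supp_sum M (\<lambda>c. P b c \<odot>\<^bsub>M\<^esub> z c))"

context left_module
begin

lemma mat_apply_supp:
  assumes "\<And>b c. P b c \<in> carrier R" "z \<in> fin_supp I (\<lambda>_. M)"
  shows "P b c \<odot>\<^bsub>M\<^esub> z c \<in> carrier M" "finite {c. P b c \<odot>\<^bsub>M\<^esub> z c \<noteq> \<zero>\<^bsub>M\<^esub>}"
proof -
  show "P b c \<odot>\<^bsub>M\<^esub> z c \<in> carrier M"
    by (rule smult_closed[OF assms(1) fin_supp_closed[OF M.abelian_group_axioms assms(2)]])
  have "finite {c. z c \<noteq> \<zero>\<^bsub>M\<^esub>}" using assms by (auto simp: fin_supp_iff)
  then show "finite {c. P b c \<odot>\<^bsub>M\<^esub> z c \<noteq> \<zero>\<^bsub>M\<^esub>}"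
    by (rule rev_finite_subset) (auto simp: smult_zero assms)
qed

lemma mat_apply_add:
  assumes "\<And>b c. P b c \<in> carrier R" "y \<in> fin_supp I (\<lambda>_. M)" "z \<in> fin_supp I (\<lambda>_. M)"
  shows "mat_apply P M (\<lambda>c. y c \<oplus>\<^bsub>M\<^esub> z c) = (\<lambda>b. mat_apply P M y b \<oplus>\<^bsub>M\<^esub> mat_apply P M z b)"
proof
  fix b
  note y = mat_apply_supp[where P = P, OF assms(1,2)] and z = mat_apply_supp[where P = P, OF assms(1,3)]
  have "(\<lambda>c. P b c \<odot>\<^bsub>M\<^esub> (y c \<oplus>\<^bsub>M\<^esub> z c)) = (\<lambda>c. P b c \<odot>\<^bsub>M\<^esub> y c \<oplus>\<^bsub>M\<^esub> P b c \<odot>\<^bsub>M\<^esub> z c)"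
    using fin_supp_closed[OF M.abelian_group_axioms] assms by (intro ext smult_r_distr) auto
  then show "mat_apply P M (\<lambda>c. y c \<oplus>\<^bsub>M\<^esub> z c) b = mat_apply P M y b \<oplus>\<^bsub>M\<^esub> mat_apply P M z b"
    unfolding mat_apply_def using M.supp_sum_add[OF y(1) z(1) y(2) z(2)] by simp
qed

lemma mat_apply_minus:
  assumes P: "\<And>b c. P b c \<in> carrier R" and y: "y \<in> fin_supp I (\<lambda>_. M)" and z: "z \<in> fin_supp I (\<lambda>_. M)"
  shows "mat_apply P M (\<lambda>c. y c \<ominus>\<^bsub>M\<^esub> z c) = (\<lambda>b. mat_apply P M y b \<ominus>\<^bsub>M\<^esub> mat_apply P M z b)"
proof
  fix b
  let ?d = "\<lambda>c. y c \<ominus>\<^bsub>M\<^esub> z c"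
  have d: "?d \<in> fin_supp I (\<lambda>_. M)" by (rule fin_supp_minus[OF M.abelian_group_axioms y z])
  have cl: "mat_apply P M u b \<in> carrier M" if "u \<in> fin_supp I (\<lambda>_. M)" for u
    unfolding mat_apply_def by (rule M.supp_sum_closed) (rule mat_apply_supp(1)[OF P that])
  have "(\<lambda>c. ?d c \<oplus>\<^bsub>M\<^esub> z c) = y"
    by (intro ext M.minus_add_cancel fin_supp_closed[OF M.abelian_group_axioms y]
        fin_supp_closed[OF M.abelian_group_axioms z])
  then have "mat_apply P M y = (\<lambda>b. mat_apply P M ?d b \<oplus>\<^bsub>M\<^esub> mat_apply P M z b)"
    using mat_apply_add[where P = P, OF P d z] by simp
  then show "mat_apply P M ?d b = mat_apply P M y b \<ominus>\<^bsub>M\<^esub> mat_apply P M z b"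
    using cl[OF d] cl[OF z] by (simp add: a_minus_def M.a_assoc M.r_neg)
qed

lemma mat_apply_zero:
  assumes "\<And>b c. P b c \<in> carrier R"
  shows "mat_apply P M (\<lambda>c. \<zero>\<^bsub>M\<^esub>) = (\<lambda>b. \<zero>\<^bsub>M\<^esub>)"
  unfolding mat_apply_def by (simp add: smult_zero assms M.supp_sum_zero)

lemma mat_apply_single:
  assumes "\<And>b c. P b c \<in> carrier R" "x \<in> carrier M"
  shows "mat_apply P M (\<lambda>i. if i = c then x else \<zero>\<^bsub>M\<^esub>) = (\<lambda>b. P b c \<odot>\<^bsub>M\<^esub> x)"
proof
  fix b
  have "(\<lambda>i. P b i \<odot>\<^bsub>M\<^esub> (if i = c then x else \<zero>\<^bsub>M\<^esub>)) = (\<lambda>i. if i = c then P b c \<odot>\<^bsub>M\<^esub> x else \<zero>\<^bsub>M\<^esub>)"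
    by (auto simp: smult_zero assms)
  then show "mat_apply P M (\<lambda>i. if i = c then x else \<zero>\<^bsub>M\<^esub>) b = P b c \<odot>\<^bsub>M\<^esub> x"
    unfolding mat_apply_def using M.supp_sum_single[of "P b c \<odot>\<^bsub>M\<^esub> x" c] assms smult_closed by simp
qed

text \<open>Every column of \<open>P\<close> has finite support, so a single entry yields a finitely
  supported family, and finite sums of such families remain finitely supported.\<close>

lemma mat_apply_closed:
  assumes "\<And>b c. P b c \<in> carrier R" "z \<in> fin_supp J (\<lambda>_. M)"
    and "\<And>b c. b \<notin> I \<Longrightarrow> P b c = \<zero>\<^bsub>R\<^esub>" "\<And>c. finite {b. P b c \<noteq> \<zero>\<^bsub>R\<^esub>}"
  shows "mat_apply P M z \<in> fin_supp I (\<lambda>_. M)"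
  using M.abelian_group_axioms assms(2)
proof (induction rule: fin_supp_induct)
  case zero
  show ?case
    by (simp add: mat_apply_zero[OF assms(1)] fin_supp_zero M.abelian_group_axioms)
next
  case (add y c m)
  have "(\<lambda>b. P b c \<odot>\<^bsub>M\<^esub> m) \<in> fin_supp I (\<lambda>_. M)"
    unfolding fin_supp_iff
  proof (intro conjI ballI allI impI)
    have "{b. P b c \<odot>\<^bsub>M\<^esub> m \<noteq> \<zero>\<^bsub>M\<^esub>} \<subseteq> {b. P b c \<noteq> \<zero>\<^bsub>R\<^esub>}"
      using add.hyps by (auto simp: zero_smult)
    then show "finite {b. P b c \<odot>\<^bsub>M\<^esub> m \<noteq> \<zero>\<^bsub>M\<^esub>}"
      by (rule finite_subset) (rule assms(4))
  qed (use assms add.hyps in \<open>auto simp: smult_closed zero_smult\<close>)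
  moreover have "mat_apply P M (\<lambda>i. y i \<oplus>\<^bsub>M\<^esub> (if i = c then m else \<zero>\<^bsub>M\<^esub>)) = (\<lambda>b. mat_apply P M y b \<oplus>\<^bsub>M\<^esub> P b c \<odot>\<^bsub>M\<^esub> m)"
    using add by (subst mat_apply_add[OF assms(1)])
      (auto intro!: fin_supp_single M.abelian_group_axioms simp: mat_apply_single[OF assms(1)])
  ultimately show ?case using fin_supp_add[OF M.abelian_group_axioms add.IH] by simp
qed

end

text \<open>A homomorphism commutes with scalars and finite sums, hence with every matrix. This is
  the functoriality in \<open>M\<close> of the complexes below.\<close>

lemma mat_apply_natural:
  assumes "left_module R M" "left_module R N" "h \<in> mod_hom R M N"
    and "\<And>b c. P b c \<in> carrier R" "z \<in> fin_supp J (\<lambda>_. M)"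
  shows "(\<lambda>b. h (mat_apply P M z b)) = mat_apply P N (\<lambda>c. h (z c))"
proof
  fix b
  interpret M: left_module R M by fact
  interpret N: left_module R N by fact
  show "h (mat_apply P M z b) = mat_apply P N (\<lambda>c. h (z c)) b"
    unfolding mat_apply_def
    using M.mat_apply_supp[OF assms(4,5)] fin_supp_closed[OF M.abelian_group_axioms assms(5)]
    by (subst M.supp_sum_hom[OF N.abelian_group_axioms mod_hom_hom[OF assms(3)]])
      (auto simp: mod_homD(3)[OF assms(3)] assms(4))
qed

text \<open>With \<open>B 0 = {}\<close>, exactness can be asked uniformly in all degrees \<open>Suc n\<close>: in degree 1 it
  says that the last map of the complex is onto.\<close>

locale mat_complex = ring R for R :: "'r ring" (structure) +
  fixes B :: "nat \<Rightarrow> 'b set" and P :: "nat \<Rightarrow> 'b \<Rightarrow> 'b \<Rightarrow> 'r"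
  assumes B0: "B 0 = {}"
    and P_closed: "P n b c \<in> carrier R"
    and P_zero: "b \<notin> B n \<Longrightarrow> P n b c = \<zero>"
    and P_fin: "finite {b. P n b c \<noteq> \<zero>}"
    and P_P: "c \<in> B (Suc (Suc n)) \<Longrightarrow> supp_sum R (\<lambda>b. P n a b \<otimes> P (Suc n) b c) = \<zero>"
begin

definition chains :: "nat \<Rightarrow> ('r, 'm) module \<Rightarrow> ('b \<Rightarrow> 'm) set" where
  "chains n M = fin_supp (B n) (\<lambda>_. M)"

text \<open>The index is that of the target: \<open>bdry n\<close> starts in degree
  \<open>Suc n\<close>.\<close>

definition bdry :: "nat \<Rightarrow> ('r, 'm) module \<Rightarrow> ('b \<Rightarrow> 'm) \<Rightarrow> 'b \<Rightarrow> 'm" where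
  "bdry n M z = mat_apply (P n) M z"

text \<open>For the augmented resolution of the ideal this becomes h-unitarity, see
  \<open>h_unitary_iff_exact\<close>; up to that point only the matrix form of the complex
  matters.\<close>

definition exact_module :: "('r, 'm) module \<Rightarrow> bool" where
  "exact_module M \<longleftrightarrow> left_module R M \<and>
     (\<forall>n. \<forall>z\<in>chains (Suc n) M. bdry n M z = (\<lambda>_. \<zero>\<^bsub>M\<^esub>) \<longrightarrow>
        (\<exists>w\<in>chains (Suc (Suc n)) M. bdry (Suc n) M w = z))"

lemma exact_moduleD: "exact_module M \<Longrightarrow> left_module R M"
  by (simp add: exact_module_def)

lemma exact_module_lift:
  "\<lbrakk>exact_module M; z \<in> chains (Suc n) M; bdry n M z = (\<lambda>_. \<zero>\<^bsub>M\<^esub>)\<rbrakk> \<Longrightarrow>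
    \<exists>w\<in>chains (Suc (Suc n)) M. bdry (Suc n) M w = z"
  by (simp add: exact_module_def)

lemma bdry_closed: "left_module R M \<Longrightarrow> z \<in> chains (Suc n) M \<Longrightarrow> bdry n M z \<in> chains n M"
  unfolding chains_def bdry_def by (rule left_module.mat_apply_closed) (auto simp: P_closed P_zero P_fin)

lemma bdry_add:
  "left_module R M \<Longrightarrow> y \<in> chains (Suc n) M \<Longrightarrow> z \<in> chains (Suc n) M \<Longrightarrow>
    bdry n M (\<lambda>c. y c \<oplus>\<^bsub>M\<^esub> z c) = (\<lambda>b. bdry n M y b \<oplus>\<^bsub>M\<^esub> bdry n M z b)"
  unfolding chains_def bdry_def by (rule left_module.mat_apply_add) (auto simp: P_closed)

lemma bdry_zero: "left_module R M \<Longrightarrow> bdry n M (\<lambda>_. \<zero>\<^bsub>M\<^esub>) = (\<lambda>_. \<zero>\<^bsub>M\<^esub>)"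
  unfolding bdry_def by (rule left_module.mat_apply_zero) (auto simp: P_closed)

lemma bdry_natural:
  "\<lbrakk>left_module R M; left_module R N; h \<in> mod_hom R M N; z \<in> chains (Suc n) M\<rbrakk> \<Longrightarrow>
    (\<lambda>b. h (bdry n M z b)) = bdry n N (\<lambda>c. h (z c))"
  unfolding chains_def bdry_def by (rule mat_apply_natural) (auto simp: P_closed)

lemma chains_closed: "left_module R M \<Longrightarrow> z \<in> chains n M \<Longrightarrow> z b \<in> carrier M"
  unfolding chains_def by (rule fin_supp_closed[OF left_moduleE(2)])

lemma chains_minus:
  "left_module R M \<Longrightarrow> y \<in> chains n M \<Longrightarrow> z \<in> chains n M \<Longrightarrow> (\<lambda>b. y b \<ominus>\<^bsub>M\<^esub> z b) \<in> chains n M"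
  unfolding chains_def by (rule fin_supp_minus[OF left_moduleE(2)])

lemma chains_add:
  "left_module R M \<Longrightarrow> y \<in> chains n M \<Longrightarrow> z \<in> chains n M \<Longrightarrow> (\<lambda>b. y b \<oplus>\<^bsub>M\<^esub> z b) \<in> chains n M"
  unfolding chains_def by (rule fin_supp_add[OF left_moduleE(2)])

lemma bdry_minus:
  "left_module R M \<Longrightarrow> y \<in> chains (Suc n) M \<Longrightarrow> z \<in> chains (Suc n) M \<Longrightarrow>
    bdry n M (\<lambda>c. y c \<ominus>\<^bsub>M\<^esub> z c) = (\<lambda>b. bdry n M y b \<ominus>\<^bsub>M\<^esub> bdry n M z b)"
  unfolding chains_def bdry_def by (rule left_module.mat_apply_minus) (auto simp: P_closed)

text \<open>By additivity a chain with one entry \<open>m\<close> suffices. There the composite is a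
  column of the product matrix applied to \<open>m\<close>, and evaluation at \<open>m\<close> is
  additive in the scalar, so \<open>P_P\<close> applies.\<close>

lemma bdry_bdry:
  assumes M: "left_module R M" and z: "z \<in> chains (Suc (Suc n)) M"
  shows "bdry n M (bdry (Suc n) M z) = (\<lambda>_. \<zero>\<^bsub>M\<^esub>)"
proof -
  interpret M: left_module R M by fact
  have ag: "abelian_group M" using M.abelian_group_axioms .
  show ?thesis
    using ag z[unfolded chains_def]
  proof (induction rule: fin_supp_induct)
    case zero
    show ?case by (simp add: bdry_zero[OF M])
  next
    case (add y c m)
    let ?s = "\<lambda>i. if i = c then m else \<zero>\<^bsub>M\<^esub>"
    have s: "?s \<in> chains (Suc (Suc n)) M" using add by (auto simp: chains_def intro!: fin_supp_single ag)
    have y: "y \<in> chains (Suc (Suc n)) M" using add by (simp add: chains_def)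
    have "bdry n M (bdry (Suc n) M ?s) = (\<lambda>_. \<zero>\<^bsub>M\<^esub>)"
    proof
      fix a
      have "bdry n M (bdry (Suc n) M ?s) a = supp_sum M (\<lambda>b. P n a b \<odot>\<^bsub>M\<^esub> (P (Suc n) b c \<odot>\<^bsub>M\<^esub> m))"
        unfolding bdry_def using add by (subst M.mat_apply_single) (auto simp: P_closed mat_apply_def)
      also have "\<dots> = supp_sum M (\<lambda>b. (P n a b \<otimes> P (Suc n) b c) \<odot>\<^bsub>M\<^esub> m)"
        using add by (simp add: M.smult_assoc P_closed)
      also have "\<dots> = supp_sum R (\<lambda>b. P n a b \<otimes> P (Suc n) b c) \<odot>\<^bsub>M\<^esub> m"
      proof (rule supp_sum_hom[OF ag, where h = "\<lambda>r. r \<odot>\<^bsub>M\<^esub> m", symmetric])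
        show "(\<lambda>r. r \<odot>\<^bsub>M\<^esub> m) \<in> hom (add_monoid R) (add_monoid M)"
          using add by (auto simp: hom_def M.smult_closed M.smult_l_distr)
        show "finite {b. P n a b \<otimes> P (Suc n) b c \<noteq> \<zero>}"
          by (rule finite_subset[OF _ P_fin[of "Suc n" c]]) (auto simp: P_closed)
      qed (auto simp: P_closed)
      also have "\<dots> = \<zero>\<^bsub>M\<^esub>"
        using add by (simp add: P_P M.zero_smult)
      finally show "bdry n M (bdry (Suc n) M ?s) a = \<zero>\<^bsub>M\<^esub>" .
    qed
    then show ?case
      using add by (simp add: bdry_add[OF M] y s bdry_closed[OF M])
  qed
qed

end

section \<open>Closure properties of exactness\<close>

context mat_complex
begin

abbreviation exact_submodule :: "('r, 'm) module \<Rightarrow> 'm set \<Rightarrow> bool" where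
  "exact_submodule M K \<equiv> submodule_of R M K \<and> exact_module (M\<lparr>carrier := K\<rparr>)"

lemma chains_0: "z \<in> chains 0 M \<Longrightarrow> z = (\<lambda>_. \<zero>\<^bsub>M\<^esub>)"
  by (auto simp: chains_def fin_supp_iff B0)

lemma chains_zero: "left_module R M \<Longrightarrow> (\<lambda>_. \<zero>\<^bsub>M\<^esub>) \<in> chains n M"
  unfolding chains_def by (rule fin_supp_zero[OF left_moduleE(2)])

text \<open>Adds degree 0, where the only chain is zero. The quotient argument needs it, since the
  boundary of a chain of degree 1 lies in degree 0.\<close>

lemma exact_module_lift':
  assumes M: "exact_module M" and z: "z \<in> chains n M"
    and cyc: "\<And>k. n = Suc k \<Longrightarrow> bdry k M z = (\<lambda>_. \<zero>\<^bsub>M\<^esub>)"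
  shows "\<exists>w\<in>chains (Suc n) M. bdry n M w = z"
proof (cases n)
  case 0
  then have "z = (\<lambda>_. \<zero>\<^bsub>M\<^esub>)" using chains_0 z by blast
  then show ?thesis
    using bdry_zero[OF exact_moduleD[OF M]] chains_zero[OF exact_moduleD[OF M]] by metis
next
  case (Suc k)
  then show ?thesis using exact_module_lift[OF M, of z k] z cyc by blast
qed

lemma chains_hom:
  assumes "left_module R M" "left_module R N" "h \<in> mod_hom R M N" "z \<in> chains n M"
  shows "(\<lambda>b. h (z b)) \<in> chains n N"
  using assms(4) unfolding chains_def
  by (rule fin_supp_hom) (auto simp: mod_homD[OF assms(3)] mod_hom_minus(1)[OF assms(1-3)])

lemma chains_restrict: "z \<in> chains n M \<Longrightarrow> (\<And>b. z b \<in> K) \<Longrightarrow> z \<in> chains n (M\<lparr>carrier := K\<rparr>)"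
  unfolding chains_def by (rule fin_supp_mono)

lemma chains_extend: "z \<in> chains n (M\<lparr>carrier := K\<rparr>) \<Longrightarrow> K \<subseteq> carrier M \<Longrightarrow> z \<in> chains n M"
  unfolding chains_def by (rule fin_supp_mono')

text \<open>Naturality for the inclusion. The sums inside \<open>bdry\<close> refer to the carrier,
  so this is not an equality of terms.\<close>

lemma bdry_restrict: "bdry n (M\<lparr>carrier := K\<rparr>) z = bdry n M z"
  if M: "left_module R M" and K: "submodule_of R M K" and z: "z \<in> chains (Suc n) (M\<lparr>carrier := K\<rparr>)"
proof -
  have "K \<subseteq> carrier M" using K by (simp add: submodule_of_def)
  from bdry_natural[OF submodule_of_left_module[OF M K] M mod_hom_incl[OF this] z]
  show ?thesis by simp
qed

lemma chains_lift:
  assumes M: "left_module R M" and Q: "left_module R Q" and q: "q \<in> mod_hom R M Q"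
    and surj: "q ` carrier M = carrier Q" and z: "z \<in> chains n Q"
  shows "\<exists>y\<in>chains n M. (\<lambda>b. q (y b)) = z"
proof
  \<comment> \<open>Zero entries are lifted to zero, not to an arbitrary preimage, so that the
    support stays finite.\<close>
  let ?y = "\<lambda>b. if z b = \<zero>\<^bsub>Q\<^esub> then \<zero>\<^bsub>M\<^esub> else inv_into (carrier M) q (z b)"
  have zc: "z b \<in> q ` carrier M" for b using chains_closed[OF Q z] surj by simp
  have "?y b \<in> carrier M" for b
    using inv_into_into[OF zc] abelian_groupE(2)[OF left_moduleE(2)[OF M]] by simp
  moreover have "finite {b. ?y b \<noteq> \<zero>\<^bsub>M\<^esub>}"
    by (rule finite_subset[of _ "{b. z b \<noteq> \<zero>\<^bsub>Q\<^esub>}"]) (use z in \<open>auto simp: chains_def fin_supp_iff\<close>)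
  ultimately show "?y \<in> chains n M"
    using z by (auto simp: chains_def fin_supp_iff)
  show "(\<lambda>b. q (?y b)) = z"
    using f_inv_into_f[OF zc] mod_hom_minus(1)[OF M Q q] by auto
qed

text \<open>Lift a cycle of \<open>Q\<close> to a chain \<open>y\<close> of \<open>M\<close>. Its
  boundary is a cycle of the kernel, hence the boundary of some \<open>k\<close> in the kernel, and
  \<open>y - k\<close> is a cycle of \<open>M\<close> over the given one.\<close>

lemma exact_quotient:
  assumes M: "exact_module M" and Q: "left_module R Q" and q: "q \<in> mod_hom R M Q"
    and surj: "q ` carrier M = carrier Q"
    and K: "exact_module (M\<lparr>carrier := {x \<in> carrier M. q x = \<zero>\<^bsub>Q\<^esub>}\<rparr>)"
  shows "exact_module Q"
  unfolding exact_module_def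
proof (intro conjI allI ballI impI Q)
  fix n z assume z: "z \<in> chains (Suc n) Q" and cyc: "bdry n Q z = (\<lambda>_. \<zero>\<^bsub>Q\<^esub>)"
  note Ml = exact_moduleD[OF M]
  interpret M: left_module R M by fact
  interpret Q: left_module R Q by fact
  let ?K = "{x \<in> carrier M. q x = \<zero>\<^bsub>Q\<^esub>}"
  let ?MK = "M\<lparr>carrier := ?K\<rparr>"
  note Ks = submodule_of_kernel[OF Ml Q q]
  obtain y where y: "y \<in> chains (Suc n) M" and qy: "(\<lambda>b. q (y b)) = z"
    using chains_lift[OF Ml Q q surj z] by blast
  let ?u = "bdry n M y"
  have u: "?u \<in> chains n M" using bdry_closed[OF Ml y] .
  have "(\<lambda>b. q (?u b)) = (\<lambda>_. \<zero>\<^bsub>Q\<^esub>)"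
    using bdry_natural[OF Ml Q q y] qy cyc by simp
  then have "?u b \<in> ?K" for b using chains_closed[OF Ml u] by (auto dest: fun_cong)
  then have uK: "?u \<in> chains n ?MK" using chains_restrict[OF u] by blast
  have "bdry k ?MK ?u = (\<lambda>_. \<zero>\<^bsub>?MK\<^esub>)" if "n = Suc k" for k
    using bdry_restrict[OF Ml Ks] uK bdry_bdry[OF Ml] y that by simp
  from exact_module_lift'[OF K uK this]
  obtain k where k: "k \<in> chains (Suc n) ?MK" "bdry n ?MK k = ?u" by blast
  have kM: "k \<in> chains (Suc n) M" "bdry n M k = ?u"
    using chains_extend[OF k(1)] bdry_restrict[OF Ml Ks k(1)] k(2) by auto
  let ?v = "\<lambda>b. y b \<ominus>\<^bsub>M\<^esub> k b"
  have "bdry n M ?v = (\<lambda>_. \<zero>\<^bsub>M\<^esub>)"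
    using bdry_minus[OF Ml y kM(1)] kM(2) chains_closed[OF Ml u] by (simp add: a_minus_def M.r_neg)
  from exact_module_lift[OF M chains_minus[OF Ml y kM(1)] this]
  obtain w where w: "w \<in> chains (Suc (Suc n)) M" "bdry (Suc n) M w = ?v" by blast
  have "q (?v b) = z b" for b
  proof -
    have "q (k b) = \<zero>\<^bsub>Q\<^esub>"
      using chains_closed[OF submodule_of_left_module[OF Ml Ks] k(1)] by simp
    moreover have "q (y b) = z b" "z b \<in> carrier Q"
      using qy chains_closed[OF Q z] by auto
    moreover have "k b \<in> carrier M" "y b \<in> carrier M"
      by (rule chains_closed[OF Ml kM(1)], rule chains_closed[OF Ml y])
    ultimately show ?thesis
      using mod_hom_minus(3)[OF Ml Q q, of "y b" "k b"] Q.minus_add_cancel[of "z b" "\<zero>\<^bsub>Q\<^esub>"] by simp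
  qed
  then have "bdry (Suc n) Q (\<lambda>b. q (w b)) = z"
    using bdry_natural[OF Ml Q q w(1)] w(2) by auto
  then show "\<exists>w\<in>chains (Suc (Suc n)) Q. bdry (Suc n) Q w = z"
    using chains_hom[OF Ml Q q w(1)] by blast
qed

text \<open>Solve the equation in \<open>Q\<close> and lift the solution. The remaining error lies
  in the kernel, is a cycle there, and is removed by exactness of the kernel.\<close>

lemma exact_extension:
  assumes M: "left_module R M" and Q: "exact_module Q" and q: "q \<in> mod_hom R M Q"
    and surj: "q ` carrier M = carrier Q"
    and K: "exact_module (M\<lparr>carrier := {x \<in> carrier M. q x = \<zero>\<^bsub>Q\<^esub>}\<rparr>)"
  shows "exact_module M"
  unfolding exact_module_def
proof (intro conjI allI ballI impI M)
  fix n z assume z: "z \<in> chains (Suc n) M" and cyc: "bdry n M z = (\<lambda>_. \<zero>\<^bsub>M\<^esub>)"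
  note Ql = exact_moduleD[OF Q]
  interpret M: left_module R M by fact
  interpret Q: left_module R Q by fact
  let ?K = "{x \<in> carrier M. q x = \<zero>\<^bsub>Q\<^esub>}"
  let ?MK = "M\<lparr>carrier := ?K\<rparr>"
  note Ks = submodule_of_kernel[OF M Ql q]
  have "bdry n Q (\<lambda>b. q (z b)) = (\<lambda>_. \<zero>\<^bsub>Q\<^esub>)"
    using bdry_natural[OF M Ql q z] cyc mod_hom_minus(1)[OF M Ql q] by simp
  from exact_module_lift[OF Q chains_hom[OF M Ql q z] this]
  obtain w' where w': "w' \<in> chains (Suc (Suc n)) Q" "bdry (Suc n) Q w' = (\<lambda>b. q (z b))" by blast
  from chains_lift[OF M Ql q surj w'(1)]
  obtain w where w: "w \<in> chains (Suc (Suc n)) M" and qw: "(\<lambda>b. q (w b)) = w'" by blast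
  have bw: "bdry (Suc n) M w \<in> chains (Suc n) M" by (rule bdry_closed[OF M w])
  let ?v = "\<lambda>b. z b \<ominus>\<^bsub>M\<^esub> bdry (Suc n) M w b"
  have c: "z b \<in> carrier M" "bdry (Suc n) M w b \<in> carrier M" for b
    by (rule chains_closed[OF M z], rule chains_closed[OF M bw])
  have v: "?v \<in> chains (Suc n) M" by (rule chains_minus[OF M z bw])
  have "(\<lambda>b. q (bdry (Suc n) M w b)) = (\<lambda>b. q (z b))"
    using bdry_natural[OF M Ql q w] qw w'(2) by simp
  then have "q (?v b) = \<zero>\<^bsub>Q\<^esub>" for b
    using mod_hom_minus(3)[OF M Ql q c(1) c(2)] mod_homD(1)[OF q c(1)]
    by (auto simp: a_minus_def Q.r_neg dest!: fun_cong[of _ _ b])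
  then have vK: "?v \<in> chains (Suc n) ?MK"
    by (intro chains_restrict[OF v]) (use c in auto)
  have "bdry n M ?v = (\<lambda>_. \<zero>\<^bsub>M\<^esub>)"
    using bdry_minus[OF M z bw] cyc bdry_bdry[OF M w] by (simp add: a_minus_def M.r_neg)
  then have "bdry n ?MK ?v = (\<lambda>_. \<zero>\<^bsub>?MK\<^esub>)"
    using bdry_restrict[OF M Ks vK] by simp
  from exact_module_lift[OF K vK this]
  obtain k where k: "k \<in> chains (Suc (Suc n)) ?MK" "bdry (Suc n) ?MK k = ?v" by blast
  have kM: "k \<in> chains (Suc (Suc n)) M" "bdry (Suc n) M k = ?v"
    using chains_extend[OF k(1)] bdry_restrict[OF M Ks k(1)] k(2) by auto
  have "bdry (Suc n) M (\<lambda>b. k b \<oplus>\<^bsub>M\<^esub> w b) = z"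
    using bdry_add[OF M kM(1) w] kM(2) M.minus_add_cancel c by simp
  then show "\<exists>w\<in>chains (Suc (Suc n)) M. bdry (Suc n) M w = z"
    using chains_add[OF M kM(1) w] by blast
qed

lemma exact_zero_submodule:
  assumes "left_module R M"
  shows "exact_submodule M {\<zero>\<^bsub>M\<^esub>}"
proof -
  let ?Z = "M\<lparr>carrier := {\<zero>\<^bsub>M\<^esub>}\<rparr>"
  have Z: "left_module R ?Z" by (rule submodule_of_left_module[OF assms submodule_of_zero[OF assms]])
  have z: "z = (\<lambda>_. \<zero>\<^bsub>?Z\<^esub>)" if "z \<in> chains n ?Z" for n z
    using chains_closed[OF Z that] by auto
  have "exact_module ?Z"
    unfolding exact_module_def
    using Z z bdry_zero[OF Z] chains_zero[OF Z] by blast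
  then show ?thesis using submodule_of_zero[OF assms] by blast
qed

text \<open>The colimit enters only through its cocone: the maps \<open>j\<close> are jointly onto,
  and what they kill dies at a later stage. A cycle has finitely many nonzero entries, so it lifts
  to one stage; its finitely many boundary entries vanish at a later stage, where exactness gives
  the preimage.\<close>

lemma exact_directed_colimit:
  fixes N :: "'i \<Rightarrow> ('r, 'n) module"
  assumes Q: "left_module R Q" and N: "\<And>i. i \<in> L \<Longrightarrow> exact_module (N i)"
    and j: "\<And>i. i \<in> L \<Longrightarrow> j i \<in> mod_hom R (N i) Q"
    and L: "L \<noteq> {}"
    and dir: "\<And>i k. i \<in> L \<Longrightarrow> k \<in> L \<Longrightarrow> \<exists>l\<in>L. rl i l \<and> rl k l"
    and f: "\<And>i k. i \<in> L \<Longrightarrow> k \<in> L \<Longrightarrow> rl i k \<Longrightarrow> f i k \<in> mod_hom R (N i) (N k)"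
    and jf: "\<And>i k x. i \<in> L \<Longrightarrow> k \<in> L \<Longrightarrow> rl i k \<Longrightarrow> x \<in> carrier (N i) \<Longrightarrow> j k (f i k x) = j i x"
    and rl: "\<And>i k l. i \<in> L \<Longrightarrow> k \<in> L \<Longrightarrow> l \<in> L \<Longrightarrow> rl i k \<Longrightarrow> rl k l \<Longrightarrow> rl i l"
    and ff: "\<And>i k l x. i \<in> L \<Longrightarrow> k \<in> L \<Longrightarrow> l \<in> L \<Longrightarrow> rl i k \<Longrightarrow> rl k l \<Longrightarrow> x \<in> carrier (N i) \<Longrightarrow>
      f k l (f i k x) = f i l x"
    and surj: "\<And>x. x \<in> carrier Q \<Longrightarrow> \<exists>i\<in>L. \<exists>y\<in>carrier (N i). j i y = x"
    and kill: "\<And>i x. i \<in> L \<Longrightarrow> x \<in> carrier (N i) \<Longrightarrow> j i x = \<zero>\<^bsub>Q\<^esub> \<Longrightarrow> \<exists>k\<in>L. rl i k \<and> f i k x = \<zero>\<^bsub>N k\<^esub>"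
  shows "exact_module Q"
  unfolding exact_module_def
proof (intro conjI allI ballI impI Q)
  fix n z assume z: "z \<in> chains (Suc n) Q" and cyc: "bdry n Q z = (\<lambda>_. \<zero>\<^bsub>Q\<^esub>)"
  interpret Q: left_module R Q by fact
  note Nl = exact_moduleD[OF N]
  have "\<exists>i\<in>L. \<forall>b\<in>S. \<exists>y\<in>carrier (N i). j i y = z b" if "finite S" for S
    using that
  proof (induction S rule: finite_induct)
    case empty
    then show ?case using L by auto
  next
    case (insert c S)
    then obtain i where i: "i \<in> L" "\<forall>b\<in>S. \<exists>y\<in>carrier (N i). j i y = z b" by blast
    obtain k y where k: "k \<in> L" "y \<in> carrier (N k)" "j k y = z c"
      using surj[OF chains_closed[OF Q z, of c]] by blast
    obtain l where l: "l \<in> L" "rl i l" "rl k l" using dir[OF i(1) k(1)] by blast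
    have "\<exists>y\<in>carrier (N l). j l y = z b" if b: "b \<in> insert c S" for b
    proof (cases "b = c")
      case True
      then show ?thesis
        using mod_homD(1)[OF f[OF k(1) l(1,3)] k(2)] jf[OF k(1) l(1,3) k(2)] k(3) by auto
    next
      case False
      then obtain x where "x \<in> carrier (N i)" "j i x = z b" using i(2) b by blast
      then show ?thesis
        by (intro bexI[of _ "f i l x"]) (auto simp: mod_homD(1)[OF f[OF i(1) l(1,2)]] jf[OF i(1) l(1,2)])
    qed
    then show ?case using l(1) by blast
  qed
  moreover have "finite {b. z b \<noteq> \<zero>\<^bsub>Q\<^esub>}" using z by (auto simp: chains_def fin_supp_iff)
  ultimately obtain i where i: "i \<in> L" "\<forall>b\<in>{b. z b \<noteq> \<zero>\<^bsub>Q\<^esub>}. \<exists>y\<in>carrier (N i). j i y = z b" by blast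
  interpret Ni: left_module R "N i" by (rule Nl[OF i(1)])
  obtain y0 where y0: "\<And>b. z b \<noteq> \<zero>\<^bsub>Q\<^esub> \<Longrightarrow> y0 b \<in> carrier (N i) \<and> j i (y0 b) = z b"
    using i(2) by (metis (mono_tags) mem_Collect_eq)
  define y where "y b = (if z b = \<zero>\<^bsub>Q\<^esub> then \<zero>\<^bsub>N i\<^esub> else y0 b)" for b
  have "finite {b. y b \<noteq> \<zero>\<^bsub>N i\<^esub>}"
    by (rule finite_subset[of _ "{b. z b \<noteq> \<zero>\<^bsub>Q\<^esub>}"]) (use z in \<open>auto simp: y_def chains_def fin_supp_iff\<close>)
  then have y: "y \<in> chains (Suc n) (N i)"
    using z y0 by (auto simp: chains_def fin_supp_iff y_def)
  have jy: "(\<lambda>b. j i (y b)) = z"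
    using y0 mod_hom_minus(1)[OF Nl[OF i(1)] Q j[OF i(1)]] by (auto simp: y_def)
  let ?u = "bdry n (N i) y"
  have u: "?u \<in> chains n (N i)" by (rule bdry_closed[OF Nl[OF i(1)] y])
  have ju: "j i (?u b) = \<zero>\<^bsub>Q\<^esub>" for b
    using fun_cong[OF bdry_natural[OF Nl[OF i(1)] Q j[OF i(1)] y], of b] cyc jy by simp
  have "\<exists>k\<in>L. rl i k \<and> (\<forall>b\<in>S. f i k (?u b) = \<zero>\<^bsub>N k\<^esub>)" if "finite S" for S
    using that
  proof (induction S rule: finite_induct)
    case empty
    then show ?case using dir[OF i(1) i(1)] by auto
  next
    case (insert c S)
    then obtain k where k: "k \<in> L" "rl i k" "\<forall>b\<in>S. f i k (?u b) = \<zero>\<^bsub>N k\<^esub>" by blast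
    have uc: "?u b \<in> carrier (N i)" for b by (rule chains_closed[OF Nl[OF i(1)] u])
    obtain m where m: "m \<in> L" "rl i m" "f i m (?u c) = \<zero>\<^bsub>N m\<^esub>" using kill[OF i(1) uc ju] by blast
    obtain l where l: "l \<in> L" "rl k l" "rl m l" using dir[OF k(1) m(1)] by blast
    have "f i l (?u b) = \<zero>\<^bsub>N l\<^esub>" if "b \<in> insert c S" for b
    proof (cases "b = c")
      case True
      then show ?thesis
        using ff[OF i(1) m(1) l(1) m(2) l(3) uc] m(3)
          mod_hom_minus(1)[OF Nl[OF m(1)] Nl[OF l(1)] f[OF m(1) l(1,3)]] by metis
    next
      case False
      then have "f i k (?u b) = \<zero>\<^bsub>N k\<^esub>" using k(3) that by blast
      then show ?thesis
        using ff[OF i(1) k(1) l(1) k(2) l(2) uc]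
          mod_hom_minus(1)[OF Nl[OF k(1)] Nl[OF l(1)] f[OF k(1) l(1,2)]] by metis
    qed
    then show ?case using l(1) rl[OF i(1) k(1) l(1) k(2) l(2)] by blast
  qed
  moreover have "finite {b. ?u b \<noteq> \<zero>\<^bsub>N i\<^esub>}" using u by (auto simp: chains_def fin_supp_iff)
  ultimately obtain k where k: "k \<in> L" "rl i k" "\<forall>b\<in>{b. ?u b \<noteq> \<zero>\<^bsub>N i\<^esub>}. f i k (?u b) = \<zero>\<^bsub>N k\<^esub>" by blast
  note fk = f[OF i(1) k(1,2)]
  have "f i k (?u b) = \<zero>\<^bsub>N k\<^esub>" for b
    using k(3) mod_hom_minus(1)[OF Nl[OF i(1)] Nl[OF k(1)] fk] by (cases "?u b = \<zero>\<^bsub>N i\<^esub>") auto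
  then have "bdry n (N k) (\<lambda>b. f i k (y b)) = (\<lambda>_. \<zero>\<^bsub>N k\<^esub>)"
    using bdry_natural[OF Nl[OF i(1)] Nl[OF k(1)] fk y] by simp
  from exact_module_lift[OF N[OF k(1)] chains_hom[OF Nl[OF i(1)] Nl[OF k(1)] fk y] this]
  obtain w where w: "w \<in> chains (Suc (Suc n)) (N k)" "bdry (Suc n) (N k) w = (\<lambda>b. f i k (y b))" by blast
  have "bdry (Suc n) Q (\<lambda>b. j k (w b)) = (\<lambda>b. j k (f i k (y b)))"
    using bdry_natural[OF Nl[OF k(1)] Q j[OF k(1)] w(1)] w(2) by simp
  also have "\<dots> = z"
    using jf[OF i(1) k(1,2) chains_closed[OF Nl[OF i(1)] y]] jy by simp
  finally show "\<exists>w\<in>chains (Suc (Suc n)) Q. bdry (Suc n) Q w = z"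
    using chains_hom[OF Nl[OF k(1)] Q j[OF k(1)] w(1)] by blast
qed

text \<open>The union of a chain is the directed colimit along inclusions, where only zero is ever
  killed.\<close>

lemma exact_Union:
  assumes M: "left_module R M" and C: "C \<noteq> {}" "\<And>K. K \<in> C \<Longrightarrow> exact_submodule M K"
    and chain: "\<And>K L. K \<in> C \<Longrightarrow> L \<in> C \<Longrightarrow> K \<subseteq> L \<or> L \<subseteq> K"
  shows "exact_submodule M (\<Union>C)"
proof
  have C': "submodule_of R M K" if "K \<in> C" for K using C(2)[OF that] by blast
  have "x \<oplus>\<^bsub>M\<^esub> y \<in> \<Union>C" if xy: "x \<in> \<Union>C" "y \<in> \<Union>C" for x y
  proof -
    obtain K L where "K \<in> C" "L \<in> C" "x \<in> K" "y \<in> L" using xy by blast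
    then obtain J where "J \<in> C" "x \<in> J" "y \<in> J" using chain[of K L] by blast
    then show ?thesis using submodule_ofD(3)[OF C'] by blast
  qed
  then show S: "submodule_of R M (\<Union>C)"
    using C(1) C' unfolding submodule_of_def by blast
  have incl: "(\<lambda>x. x) \<in> mod_hom R (M\<lparr>carrier := K\<rparr>) (M\<lparr>carrier := L\<rparr>)" if "K \<subseteq> L" for K L
    by (rule mod_homI) (use that in auto)
  show "exact_module (M\<lparr>carrier := \<Union>C\<rparr>)"
  proof (rule exact_directed_colimit[where N = "\<lambda>K. M\<lparr>carrier := K\<rparr>" and L = C and rl = "(\<subseteq>)"
      and j = "\<lambda>_ x. x" and f = "\<lambda>_ _ x. x"])
    show "left_module R (M\<lparr>carrier := \<Union>C\<rparr>)" by (rule submodule_of_left_module[OF M S])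
    show "exact_module (M\<lparr>carrier := K\<rparr>)" if "K \<in> C" for K using C(2)[OF that] by blast
    show "(\<lambda>x. x) \<in> mod_hom R (M\<lparr>carrier := K\<rparr>) (M\<lparr>carrier := \<Union>C\<rparr>)" if "K \<in> C" for K
      using that by (intro incl) blast
    show "(\<lambda>x. x) \<in> mod_hom R (M\<lparr>carrier := K\<rparr>) (M\<lparr>carrier := L\<rparr>)" if "K \<subseteq> L" for K L
      using that by (rule incl)
    show "\<exists>l\<in>C. K \<subseteq> l \<and> L \<subseteq> l" if "K \<in> C" "L \<in> C" for K L
      using chain[OF that] that by blast
    show "\<exists>i\<in>C. \<exists>y\<in>carrier (M\<lparr>carrier := i\<rparr>). y = x" if "x \<in> carrier (M\<lparr>carrier := \<Union>C\<rparr>)" for x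
      using that by auto
    show "\<exists>k\<in>C. i \<subseteq> k \<and> x = \<zero>\<^bsub>M\<lparr>carrier := k\<rparr>\<^esub>"
      if "i \<in> C" "x = \<zero>\<^bsub>M\<lparr>carrier := \<Union>C\<rparr>\<^esub>" for i x
      using that by auto
  qed (use C(1) in auto)
qed

lemma direct_sum_proj:
  "i \<in> I \<Longrightarrow> (\<lambda>x. x i) \<in> mod_hom R (direct_sum I N) (N i)"
  by (rule mod_homI) (auto simp: direct_sum_sel fin_supp_iff)

text \<open>The equation is solved in each summand separately. A cycle involves only the finite set
  \<open>J\<close> of summands, and taking zero elsewhere assembles the solutions into one
  chain.\<close>

lemma exact_direct_sum:
  assumes N: "\<And>i. i \<in> I \<Longrightarrow> exact_module (N i)"
  shows "exact_module (direct_sum I N)"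
  unfolding exact_module_def
proof (intro conjI allI ballI impI)
  let ?D = "direct_sum I N"
  note Nl = exact_moduleD[OF N]
  show D: "left_module R ?D" by (rule direct_sum[OF ring_axioms Nl])
  fix n z assume z: "z \<in> chains (Suc n) ?D" and cyc: "bdry n ?D z = (\<lambda>_. \<zero>\<^bsub>?D\<^esub>)"
  have zc: "z b \<in> fin_supp I N" for b using chains_closed[OF D z] by (simp add: direct_sum_sel)
  define J where "J = (\<Union>b\<in>{b. z b \<noteq> \<zero>\<^bsub>?D\<^esub>}. {i. z b i \<noteq> \<zero>\<^bsub>N i\<^esub>})"
  have "finite {b. z b \<noteq> \<zero>\<^bsub>?D\<^esub>}" using z by (auto simp: chains_def fin_supp_iff)
  then have finJ: "finite J" using zc by (auto simp: J_def fin_supp_iff)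
  have zJ: "z b i = \<zero>\<^bsub>N i\<^esub>" if "i \<notin> J" for b i
    using that by (cases "z b = \<zero>\<^bsub>?D\<^esub>") (auto simp: J_def direct_sum_sel)
  have JI: "J \<subseteq> I" using zc by (auto simp: J_def fin_supp_iff)
  have "\<exists>w\<in>chains (Suc (Suc n)) (N i). bdry (Suc n) (N i) w = (\<lambda>b. z b i)" if "i \<in> J" for i
  proof (rule exact_module_lift[OF N])
    show "i \<in> I" using that JI by blast
    note pr = direct_sum_proj[OF this, of N]
    show "(\<lambda>b. z b i) \<in> chains (Suc n) (N i)" by (rule chains_hom[OF D Nl pr z]) fact
    show "bdry n (N i) (\<lambda>b. z b i) = (\<lambda>_. \<zero>\<^bsub>N i\<^esub>)"
      using bdry_natural[OF D Nl pr z] \<open>i \<in> I\<close> cyc by (simp add: direct_sum_sel)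
  qed
  then obtain w0 where w0: "\<And>i. i \<in> J \<Longrightarrow> w0 i \<in> chains (Suc (Suc n)) (N i)"
    "\<And>i. i \<in> J \<Longrightarrow> bdry (Suc n) (N i) (w0 i) = (\<lambda>b. z b i)" by metis
  define w where "w c i = (if i \<in> J then w0 i c else \<zero>\<^bsub>N i\<^esub>)" for c i
  have Nz: "\<zero>\<^bsub>N i\<^esub> \<in> carrier (N i)" if "i \<in> I" for i
    using abelian_groupE(2)[OF left_moduleE(2)[OF Nl[OF that]]] .
  have wI: "w c i \<in> carrier (N i)" if "i \<in> I" for c i
    using chains_closed[OF Nl w0(1)] that JI Nz by (auto simp: w_def)
  have wfs: "w c \<in> fin_supp I N" for c
    unfolding fin_supp_iff
  proof (intro conjI ballI allI impI)
    show "finite {i. w c i \<noteq> \<zero>\<^bsub>N i\<^esub>}" by (rule finite_subset[OF _ finJ]) (auto simp: w_def)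
  qed (use wI JI in \<open>auto simp: w_def\<close>)
  have "finite {c. w c \<noteq> \<zero>\<^bsub>?D\<^esub>}"
  proof (rule finite_subset)
    show "{c. w c \<noteq> \<zero>\<^bsub>?D\<^esub>} \<subseteq> (\<Union>i\<in>J. {c. w0 i c \<noteq> \<zero>\<^bsub>N i\<^esub>})"
      by (auto simp: w_def direct_sum_sel fun_eq_iff)
    show "finite (\<Union>i\<in>J. {c. w0 i c \<noteq> \<zero>\<^bsub>N i\<^esub>})"
      using finJ w0(1) by (auto simp: chains_def fin_supp_iff)
  qed
  moreover have "w c = \<zero>\<^bsub>?D\<^esub>" if "c \<notin> B (Suc (Suc n))" for c
    using w0(1) that by (auto simp: w_def direct_sum_sel chains_def fin_supp_iff)
  ultimately have w: "w \<in> chains (Suc (Suc n)) ?D"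
    using wfs unfolding chains_def fin_supp_iff[of w] by (simp add: direct_sum_sel(1))
  have bw: "bdry (Suc n) ?D w b \<in> fin_supp I N" for b
    using chains_closed[OF D bdry_closed[OF D w]] by (simp add: direct_sum_sel)
  have "bdry (Suc n) ?D w b i = z b i" for b i
  proof (cases "i \<in> I")
    case True
    note pr = direct_sum_proj[OF this, of N]
    have "bdry (Suc n) ?D w b i = bdry (Suc n) (N i) (\<lambda>c. w c i) b"
      using fun_cong[OF bdry_natural[OF D Nl[OF True] pr w], of b] by simp
    also have "\<dots> = z b i"
    proof (cases "i \<in> J")
      case True
      then have "(\<lambda>c. w c i) = w0 i" by (auto simp: w_def)
      then show ?thesis using w0(2)[OF True] by simp
    next
      case False
      then have "(\<lambda>c. w c i) = (\<lambda>_. \<zero>\<^bsub>N i\<^esub>)" by (auto simp: w_def)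
      then show ?thesis using zJ[OF False] bdry_zero[OF Nl[OF True]] by simp
    qed
    finally show ?thesis .
  next
    case False
    then show ?thesis using bw[of b] zc[of b] by (simp add: fin_supp_iff)
  qed
  then show "\<exists>w\<in>chains (Suc (Suc n)) ?D. bdry (Suc n) ?D w = z"
    using w by (intro bexI[of _ w]) auto
qed

end

section \<open>Cutting a module over \<open>M\<close> down to bounded size\<close>

text \<open>Universal property of the quotient, stated for any surjection so that it covers both
  uses of \<open>push_module\<close>.\<close>

lemma mod_hom_factor:
  assumes N: "left_module R N" and Q: "left_module R Q" and M: "left_module R M"
    and q: "q \<in> mod_hom R N Q" and surj: "q ` carrier N = carrier Q"
    and \<psi>: "\<psi> \<in> mod_hom R N M"
    and ker: "\<And>x. x \<in> carrier N \<Longrightarrow> q x = \<zero>\<^bsub>Q\<^esub> \<Longrightarrow> \<psi> x = \<zero>\<^bsub>M\<^esub>"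
  shows "\<exists>\<psi>'\<in>mod_hom R Q M. \<forall>x\<in>carrier N. \<psi>' (q x) = \<psi> x"
proof -
  interpret N: left_module R N by fact
  interpret Q: left_module R Q by fact
  interpret M: left_module R M by fact
  have eq: "\<psi> x = \<psi> y" if "x \<in> carrier N" "y \<in> carrier N" "q x = q y" for x y
  proof -
    have "q (x \<ominus>\<^bsub>N\<^esub> y) = \<zero>\<^bsub>Q\<^esub>"
      using that mod_hom_minus(3)[OF N Q q] mod_homD(1)[OF q] by (simp add: Q.minus_eq_zero_iff)
    then have "\<psi> x \<ominus>\<^bsub>M\<^esub> \<psi> y = \<zero>\<^bsub>M\<^esub>"
      using ker[of "x \<ominus>\<^bsub>N\<^esub> y"] that mod_hom_minus(3)[OF N M \<psi>] by simp
    then show ?thesis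
      using that mod_homD(1)[OF \<psi>] by (simp add: M.minus_eq_zero_iff)
  qed
  define p where "p y = \<psi> (inv_into (carrier N) q y)" for y
  have pq: "p (q x) = \<psi> x" if "x \<in> carrier N" for x
    unfolding p_def by (rule eq) (use that in \<open>auto intro: inv_into_into f_inv_into_f\<close>)
  have "p \<in> mod_hom R Q M"
  proof (rule mod_homI)
    show "p x \<in> carrier M" if "x \<in> carrier Q" for x
      using that pq mod_homD(1)[OF \<psi>] unfolding surj[symmetric] by auto
    show "p (x \<oplus>\<^bsub>Q\<^esub> y) = p x \<oplus>\<^bsub>M\<^esub> p y" if xy: "x \<in> carrier Q" "y \<in> carrier Q" for x y
    proof -
      obtain a b where "a \<in> carrier N" "b \<in> carrier N" "x = q a" "y = q b"
        using xy unfolding surj[symmetric] by auto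
      then show ?thesis
        using pq mod_homD(2)[OF \<psi>] by (simp flip: mod_homD(2)[OF q])
    qed
    show "p (r \<odot>\<^bsub>Q\<^esub> x) = r \<odot>\<^bsub>M\<^esub> p x" if rx: "r \<in> carrier R" "x \<in> carrier Q" for r x
    proof -
      obtain a where "a \<in> carrier N" "x = q a" using rx unfolding surj[symmetric] by auto
      then show ?thesis
        using pq mod_homD(3)[OF \<psi>] rx by (simp add: N.smult_closed flip: mod_homD(3)[OF q])
    qed
  qed
  then show ?thesis using pq by blast
qed

text \<open>Each coset is represented by one of its own elements, so a quotient keeps the element
  type of \<open>N\<close>.\<close>

lemma quotient_map_exists:
  fixes N :: "('r, 'n) module"
  assumes N: "left_module R N" and K: "submodule_of R N K"
  obtains g :: "'n \<Rightarrow> 'n" where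
    "\<forall>x\<in>carrier N. \<forall>y\<in>carrier N. g x = g y \<longleftrightarrow> x \<ominus>\<^bsub>N\<^esub> y \<in> K"
proof (intro that ballI)
  interpret N: left_module R N by fact
  note k = submodule_ofD[OF K]
  define g where "g x = (SOME y. y \<in> carrier N \<and> x \<ominus>\<^bsub>N\<^esub> y \<in> K)" for x
  fix x y assume x: "x \<in> carrier N" and y: "y \<in> carrier N"
  have g: "g x \<in> carrier N \<and> x \<ominus>\<^bsub>N\<^esub> g x \<in> K" if "x \<in> carrier N" for x
    unfolding g_def by (rule someI[of _ x]) (use that k(2) in \<open>simp add: a_minus_def N.r_neg\<close>)
  have tr: "a \<ominus>\<^bsub>N\<^esub> c \<in> K" if "a \<ominus>\<^bsub>N\<^esub> b \<in> K" "b \<ominus>\<^bsub>N\<^esub> c \<in> K" "a \<in> carrier N" "b \<in> carrier N" "c \<in> carrier N" for a b c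
  proof -
    have "\<ominus>\<^bsub>N\<^esub> b \<oplus>\<^bsub>N\<^esub> (b \<oplus>\<^bsub>N\<^esub> \<ominus>\<^bsub>N\<^esub> c) = \<ominus>\<^bsub>N\<^esub> c"
      using that by (simp add: N.a_assoc[symmetric] N.l_neg)
    then have "a \<ominus>\<^bsub>N\<^esub> c = (a \<ominus>\<^bsub>N\<^esub> b) \<oplus>\<^bsub>N\<^esub> (b \<ominus>\<^bsub>N\<^esub> c)"
      using that by (simp add: a_minus_def N.a_assoc)
    then show ?thesis using that k(3) by simp
  qed
  have sy: "b \<ominus>\<^bsub>N\<^esub> a \<in> K" if "a \<ominus>\<^bsub>N\<^esub> b \<in> K" "a \<in> carrier N" "b \<in> carrier N" for a b
  proof -
    have "b \<ominus>\<^bsub>N\<^esub> a = \<ominus>\<^bsub>N\<^esub> (a \<ominus>\<^bsub>N\<^esub> b)"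
      using that by (simp add: a_minus_def N.minus_add N.a_comm)
    then show ?thesis using submodule_of_a_inv[OF N K] that by simp
  qed
  show "g x = g y \<longleftrightarrow> x \<ominus>\<^bsub>N\<^esub> y \<in> K"
  proof
    assume "g x = g y"
    then show "x \<ominus>\<^bsub>N\<^esub> y \<in> K" using tr[of x "g x" y] sy[of y "g y"] g x y by metis
  next
    assume xy: "x \<ominus>\<^bsub>N\<^esub> y \<in> K"
    then have "x \<ominus>\<^bsub>N\<^esub> z \<in> K \<longleftrightarrow> y \<ominus>\<^bsub>N\<^esub> z \<in> K" if "z \<in> carrier N" for z
      using tr[of x y z] tr[of y x z] sy[of x y] x y that by blast
    \<comment> \<open>Equal cosets give the same choice predicate, hence the same chosen
      element.\<close>
    then show "g x = g y" unfolding g_def by (metis (no_types, lifting))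
  qed
qed

text \<open>Infinitely branching well-founded trees serve as names for the elements of a generated
  substructure: the labels along all paths determine a tree, which bounds their number.\<close>

datatype ('o, 'l) wtree = Leaf | Node 'o "'l \<Rightarrow> ('o, 'l) wtree"

primrec label_at :: "('o, 'l) wtree \<Rightarrow> 'l list \<Rightarrow> 'o option" where
  "label_at Leaf = (\<lambda>p. None)"
| "label_at (Node a f) = (\<lambda>p. case p of [] \<Rightarrow> Some a | l # q \<Rightarrow> label_at (f l) q)"

lemma inj_label_at: "inj label_at"
proof (rule injI)
  show "s = t" if "label_at s = label_at t" for s t :: "('o, 'l) wtree"
    using that
  proof (induction s arbitrary: t)
    case Leaf
    then show ?case by (cases t) (auto dest: fun_cong[of _ _ "[]"])
  next
    case (Node a f)
    then obtain b g where t: "t = Node b g" by (cases t) (auto dest: fun_cong[of _ _ "[]"])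
    have "a = b" using fun_cong[OF Node.prems, of "[]"] by (simp add: t)
    moreover have "f l = g l" for l
    proof (rule Node.IH)
      show "label_at (f l) = label_at (g l)"
        using fun_cong[OF Node.prems, of "l # q" for q] by (auto simp: t)
    qed simp
    ultimately show ?case by (auto simp: t)
  qed
qed

text \<open>A subset closed under these operations is an exact submodule: module operations, and the
  coordinate at a basis element of a chosen preimage of a cycle.\<close>

datatype ('r, 'b) closure_op = Zero_op | Add_op | Smult_op 'r | Witness_op nat 'b

text \<open>Branches in \<open>'b\<close> carry the entries of a chain, the two in
  \<open>bool\<close> the operands of a sum; \<open>Leaf\<close> will stand for a generator.\<close>

type_synonym ('r, 'b) small_tree = "(('r, 'b) closure_op, 'b + bool) wtree"
text \<open>The second kind of label asks for the element named \<open>p\<close> in a submodule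
  generated by one element whose type is \<open>(E, \<theta>)\<close> and whose elements with names
  in \<open>F\<close> are given. Those given values come from the branches, which is why big trees
  branch over small trees.\<close>

type_synonym ('r, 'b, 'm) big_op =
  "('r, 'b) closure_op + (('r, 'b) small_tree \<times> ('r, 'b) small_tree) set \<times> (('r, 'b) small_tree \<Rightarrow> 'm) \<times>
     ('r, 'b) small_tree set \<times> ('r, 'b) small_tree"
type_synonym ('r, 'b, 'm) big_tree = "(('r, 'b, 'm) big_op, ('r, 'b) small_tree) wtree"

text \<open>Places the arguments of a closure operation among the branches of a big tree. All that
  counts is that it is injective.\<close>

fun branch_tree :: "'b + bool \<Rightarrow> ('r, 'b) small_tree" where
  "branch_tree (Inl b) = Node (Witness_op 0 b) (\<lambda>_. Leaf)"
| "branch_tree (Inr True) = Leaf"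
| "branch_tree (Inr False) = Node Zero_op (\<lambda>_. Leaf)"

lemma inj_branch_tree: "inj (branch_tree :: 'b + bool \<Rightarrow> ('r, 'b) small_tree)"
proof (rule injI)
  show "x = y" if "(branch_tree x :: ('r, 'b) small_tree) = branch_tree y" for x y :: "'b + bool"
    using that by (cases x rule: branch_tree.cases; cases y rule: branch_tree.cases) auto
qed

section \<open>Exact submodules whose elements have names\<close>

context mat_complex
begin

text \<open>One preimage is fixed for every cycle, so that closure under it survives intersections.
  Away from cycles the zero chain is a value that stays in every submodule.\<close>

definition witness :: "('r, 'n) module \<Rightarrow> nat \<Rightarrow> ('b \<Rightarrow> 'n) \<Rightarrow> 'b \<Rightarrow> 'n" where
  "witness N n z = (if z \<in> chains (Suc n) N \<and> bdry n N z = (\<lambda>_. \<zero>\<^bsub>N\<^esub>)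
     then SOME w. w \<in> chains (Suc (Suc n)) N \<and> bdry (Suc n) N w = z else (\<lambda>_. \<zero>\<^bsub>N\<^esub>))"

lemma witness:
  assumes "exact_module N"
  shows "witness N n z \<in> chains (Suc (Suc n)) N"
    and "z \<in> chains (Suc n) N \<Longrightarrow> bdry n N z = (\<lambda>_. \<zero>\<^bsub>N\<^esub>) \<Longrightarrow> bdry (Suc n) N (witness N n z) = z"
proof -
  have *: "witness N n z \<in> chains (Suc (Suc n)) N \<and> bdry (Suc n) N (witness N n z) = z"
    if z: "z \<in> chains (Suc n) N" "bdry n N z = (\<lambda>_. \<zero>\<^bsub>N\<^esub>)"
  proof -
    from exact_module_lift[OF assms z]
    have "\<exists>w. w \<in> chains (Suc (Suc n)) N \<and> bdry (Suc n) N w = z" by blast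
    from someI_ex[OF this] show ?thesis using z by (simp add: witness_def)
  qed
  then show "z \<in> chains (Suc n) N \<Longrightarrow> bdry n N z = (\<lambda>_. \<zero>\<^bsub>N\<^esub>) \<Longrightarrow> bdry (Suc n) N (witness N n z) = z"
    by blast
  show "witness N n z \<in> chains (Suc (Suc n)) N"
    using * chains_zero[OF exact_moduleD[OF assms]] by (auto simp: witness_def)
qed

text \<open>A scalar outside \<open>carrier R\<close> gives zero, since the labels range over the
  whole type and every tree must have a value in the carrier.\<close>

fun apply_op :: "('r, 'n) module \<Rightarrow> ('r, 'b) closure_op \<Rightarrow> ('b + bool \<Rightarrow> 'n) \<Rightarrow> 'n" where
  "apply_op N Zero_op z = \<zero>\<^bsub>N\<^esub>"
| "apply_op N Add_op z = z (Inr True) \<oplus>\<^bsub>N\<^esub> z (Inr False)"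
| "apply_op N (Smult_op r) z = (if r \<in> carrier R then r \<odot>\<^bsub>N\<^esub> z (Inr True) else \<zero>\<^bsub>N\<^esub>)"
| "apply_op N (Witness_op n c) z = witness N n (\<lambda>b. z (Inl b)) c"

definition op_closed :: "('r, 'n) module \<Rightarrow> 'n set \<Rightarrow> bool" where
  "op_closed N C \<longleftrightarrow> C \<subseteq> carrier N \<and> \<zero>\<^bsub>N\<^esub> \<in> C \<and> (\<forall>a z. range z \<subseteq> C \<longrightarrow> apply_op N a z \<in> C)"

lemma op_closedD: "op_closed N C \<Longrightarrow> (\<And>l. z l \<in> C) \<Longrightarrow> apply_op N a z \<in> C"
  unfolding op_closed_def by blast

lemma op_closed_carrier:
  assumes "exact_module N"
  shows "op_closed N (carrier N)"
proof -
  interpret N: left_module R N by (rule exact_moduleD[OF assms])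
  have "apply_op N a z \<in> carrier N" if "range z \<subseteq> carrier N" for a z
    using that chains_closed[OF exact_moduleD[OF assms] witness(1)[OF assms]]
    by (cases a) (auto simp: image_subset_iff intro!: N.smult_closed)
  then show ?thesis by (auto simp: op_closed_def)
qed

lemma op_closed_Int: "op_closed N C \<Longrightarrow> op_closed N D \<Longrightarrow> op_closed N (C \<inter> D)"
  unfolding op_closed_def by blast

text \<open>A cycle with entries in \<open>C\<close> is a cycle of \<open>N\<close>, and the entries
  of its chosen preimage lie in \<open>C\<close> by closure.\<close>

lemma op_closed_exact:
  assumes N: "exact_module N" and C: "op_closed N C"
  shows "exact_submodule N C"
proof
  note Nl = exact_moduleD[OF N]
  have CN: "C \<subseteq> carrier N" using C by (simp add: op_closed_def)
  have "x \<oplus>\<^bsub>N\<^esub> y \<in> C" if "x \<in> C" "y \<in> C" for x y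
    using op_closedD[OF C, of "case_sum (\<lambda>_. x) (\<lambda>t. if t then x else y)" Add_op] that
    by (auto split: sum.splits)
  moreover have "r \<odot>\<^bsub>N\<^esub> x \<in> C" if "r \<in> carrier R" "x \<in> C" for r x
    using op_closedD[OF C, of "\<lambda>_. x" "Smult_op r"] that by auto
  ultimately show S: "submodule_of R N C"
    using C by (auto simp: submodule_of_def op_closed_def)
  let ?C = "N\<lparr>carrier := C\<rparr>"
  note Cl = submodule_of_left_module[OF Nl S]
  show "exact_module ?C"
    unfolding exact_module_def
  proof (intro conjI Cl allI ballI impI)
    fix n z assume z: "z \<in> chains (Suc n) ?C" and cyc: "bdry n ?C z = (\<lambda>_. \<zero>\<^bsub>?C\<^esub>)"
    note zN = chains_extend[OF z CN]
    have "bdry n N z = (\<lambda>_. \<zero>\<^bsub>N\<^esub>)" using cyc bdry_restrict[OF Nl S z] by simp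
    note w = witness(1)[OF N, of n z] witness(2)[OF N zN this]
    have zC: "z b \<in> C" for b using chains_closed[OF Cl z] by simp
    have "witness N n z c \<in> C" for c
      using op_closedD[OF C, of "case_sum z (\<lambda>_. z undefined)" "Witness_op n c"] zC
      by (auto split: sum.splits)
    then have "witness N n z \<in> chains (Suc (Suc n)) ?C" by (rule chains_restrict[OF w(1)])
    then show "\<exists>w\<in>chains (Suc (Suc n)) ?C. bdry (Suc n) ?C w = z"
      using w(2) bdry_restrict[OF Nl S] by (intro bexI[of _ "witness N n z"]) auto
  qed
qed

text \<open>The range is the small submodule generated by \<open>x\<close>; the same tree evaluated
  at another element is how elements of two such submodules are compared.\<close>

primrec small_eval :: "('r, 'n) module \<Rightarrow> 'n \<Rightarrow> ('r, 'b) small_tree \<Rightarrow> 'n" where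
  "small_eval N x Leaf = x"
| "small_eval N x (Node a f) = apply_op N a (\<lambda>l. small_eval N x (f l))"

lemma small_eval_closed:
  assumes C: "op_closed N C" and "x \<in> C"
  shows "small_eval N x p \<in> C"
proof (induction p)
  case (Node a f)
  then show ?case using op_closedD[OF C, of "\<lambda>l. small_eval N x (f l)" a] by auto
qed (use assms in auto)

lemma op_closed_small_eval:
  assumes N: "exact_module N" and x: "x \<in> carrier N"
  shows "op_closed N (range (small_eval N x))"
  unfolding op_closed_def
proof (intro conjI allI impI)
  show "range (small_eval N x) \<subseteq> carrier N"
    using small_eval_closed[OF op_closed_carrier[OF N] x] by blast
  show "\<zero>\<^bsub>N\<^esub> \<in> range (small_eval N x)"
    by (rule range_eqI[of _ _ "Node Zero_op (\<lambda>_. Leaf)"]) simp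
  fix a and z :: "'b + bool \<Rightarrow> _" assume "range z \<subseteq> range (small_eval N x)"
  then have "\<forall>l. \<exists>p. z l = small_eval N x p" by blast
  then obtain f where "\<And>l. z l = small_eval N x (f l)" by metis
  then show "apply_op N a z \<in> range (small_eval N x)"
    by (intro range_eqI[of _ _ "Node a f"]) (simp flip: \<open>\<And>l. z l = small_eval N x (f l)\<close>)
qed

text \<open>\<open>matches\<close> compares the type of \<open>x\<close> (which names coincide, where they are sent in \<open>M\<close>) with
  prescribed data, and prescribes the values \<open>s\<close> of the names in \<open>F\<close>.\<close>

definition matches ::
  "('r, 'n) module \<Rightarrow> ('n \<Rightarrow> 'm) \<Rightarrow> (('r, 'b) small_tree \<times> ('r, 'b) small_tree) set \<Rightarrow>
    (('r, 'b) small_tree \<Rightarrow> 'm) \<Rightarrow> ('r, 'b) small_tree set \<Rightarrow> (('r, 'b) small_tree \<Rightarrow> 'n) \<Rightarrow> 'n \<Rightarrow> bool" where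
  "matches N \<psi> E \<theta> F s x \<longleftrightarrow> x \<in> carrier N \<and> E = {(p, q). small_eval N x p = small_eval N x q} \<and>
     \<theta> = (\<lambda>p. \<psi> (small_eval N x p)) \<and> (\<forall>p\<in>F. small_eval N x p = s p)"

text \<open>The chosen \<open>x\<close> depends on \<open>E\<close>, \<open>\<theta>\<close>,
  \<open>F\<close> and \<open>s\<close> but not on \<open>p\<close>, so varying \<open>p\<close>
  names all elements of one and the same small submodule. Without a match the value zero keeps the
  step total.\<close>

fun big_step ::
  "('r, 'n) module \<Rightarrow> ('n \<Rightarrow> 'm) \<Rightarrow> ('r, 'b, 'm) big_op \<Rightarrow> (('r, 'b) small_tree \<Rightarrow> 'n) \<Rightarrow> 'n" where
  "big_step N \<psi> (Inl a) s = apply_op N a (\<lambda>l. s (branch_tree l))"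
| "big_step N \<psi> (Inr (E, \<theta>, F, p)) s =
     (if \<exists>x. matches N \<psi> E \<theta> F s x then small_eval N (SOME x. matches N \<psi> E \<theta> F s x) p else \<zero>\<^bsub>N\<^esub>)"

primrec big_eval :: "('r, 'n) module \<Rightarrow> ('n \<Rightarrow> 'm) \<Rightarrow> ('r, 'b, 'm) big_tree \<Rightarrow> 'n" where
  "big_eval N \<psi> Leaf = \<zero>\<^bsub>N\<^esub>"
| "big_eval N \<psi> (Node a f) = big_step N \<psi> a (\<lambda>l. big_eval N \<psi> (f l))"

lemma op_closed_big_eval:
  assumes N: "exact_module N"
  shows "op_closed N (range (big_eval N \<psi>))"
  unfolding op_closed_def
proof (intro conjI allI impI)
  note c = op_closed_carrier[OF N]
  have "big_eval N \<psi> t \<in> carrier N" for t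
  proof (induction t)
    case Leaf
    then show ?case using c by (simp add: op_closed_def)
  next
    case (Node a f)
    show ?case
    proof (cases a)
      case (Inl b)
      then show ?thesis using Node op_closedD[OF c] by simp
    next
      case (Inr d)
      obtain E \<theta> F p where d: "d = (E, \<theta>, F, p)" by (cases d)
      let ?m = "matches N \<psi> E \<theta> F (\<lambda>l. big_eval N \<psi> (f l))"
      show ?thesis
      proof (cases "\<exists>x. ?m x")
        case True
        then have "(SOME x. ?m x) \<in> carrier N"
          using someI_ex[of ?m] unfolding matches_def by blast
        then show ?thesis using small_eval_closed[OF c] Inr d True by simp
      next
        case False
        then have "big_eval N \<psi> (Node a f) = \<zero>\<^bsub>N\<^esub>" using Inr d by (auto simp del: not_ex)
        then show ?thesis using c by (simp add: op_closed_def)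
      qed
    qed
  qed
  then show "range (big_eval N \<psi>) \<subseteq> carrier N" by blast
  show "\<zero>\<^bsub>N\<^esub> \<in> range (big_eval N \<psi>)" by (rule range_eqI[of _ _ Leaf]) simp
  fix a and z :: "'b + bool \<Rightarrow> _" assume "range z \<subseteq> range (big_eval N \<psi>)"
  then have "\<forall>l. \<exists>p. z l = big_eval N \<psi> p" by blast
  then obtain f where f: "\<And>l. z l = big_eval N \<psi> (f l)" by metis
  \<comment> \<open>The arguments are indexed by \<open>'b + bool\<close>, the branches by small
    trees, so \<open>f\<close> is read through the inverse of \<open>branch_tree\<close>.\<close>
  have "big_eval N \<psi> (f (inv_into UNIV branch_tree (branch_tree l :: ('r, 'b) small_tree))) = z l" for l
    using f by (simp add: inv_f_f[OF inj_branch_tree])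
  then show "apply_op N a z \<in> range (big_eval N \<psi>)"
    by (intro range_eqI[of _ _ "Node (Inl a) (f \<circ> inv_into UNIV branch_tree)"])
      (simp only: big_eval.simps big_step.simps o_apply)
qed

text \<open>Let \<open>x'\<close> be the element that the trees choose for the type of
  \<open>x\<close>, and let \<open>\<alpha>\<close> send the value of a name at \<open>x\<close> to
  its value at \<open>x'\<close>. Equality of \<open>E\<close> makes \<open>\<alpha>\<close> well
  defined, equality of \<open>\<theta>\<close> makes it a map over \<open>M\<close>, and agreement
  on \<open>F\<close> makes it fix what already lies in \<open>?N0\<close>.\<close>

lemma reduced_carrier_subset:
  assumes N: "exact_module N" and M: "left_module R M" and \<psi>: "\<psi> \<in> mod_hom R N M"
    and red: "\<And>K. exact_submodule N K \<Longrightarrow> (\<forall>x\<in>K. \<psi> x = \<zero>\<^bsub>M\<^esub>) \<Longrightarrow> K \<subseteq> {\<zero>\<^bsub>N\<^esub>}"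
  shows "carrier N \<subseteq> range (big_eval N \<psi>)"
proof (rule ccontr)
  note Nl = exact_moduleD[OF N]
  interpret N: left_module R N by (rule Nl)
  interpret M: left_module R M by (rule M)
  let ?N0 = "range (big_eval N \<psi>)"
  assume "\<not> carrier N \<subseteq> ?N0"
  then obtain x where x: "x \<in> carrier N" and xN0: "x \<notin> ?N0" by blast
  let ?u = "small_eval N x"
  define U where "U = range ?u"
  define S where "S = U \<inter> ?N0"
  define E where "E = {(p, q). ?u p = ?u q}"
  \<comment> \<open>The names whose values have already been reached: on these
    \<open>\<alpha>\<close> has to be the identity.\<close>
  define F where "F = {p. ?u p \<in> ?N0}"
  define \<theta> where "\<theta> = (\<lambda>p. \<psi> (?u p))"
  have clU: "op_closed N U" unfolding U_def by (rule op_closed_small_eval[OF N x])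
  have clS: "op_closed N S" unfolding S_def by (rule op_closed_Int[OF clU op_closed_big_eval[OF N]])
  have "\<exists>t. p \<in> F \<longrightarrow> big_eval N \<psi> t = ?u p" for p unfolding F_def by fastforce
  then obtain f where f: "\<And>p. p \<in> F \<Longrightarrow> big_eval N \<psi> (f p) = ?u p" by metis
  let ?m = "matches N \<psi> E \<theta> F (\<lambda>p. big_eval N \<psi> (f p))"
  have mx: "?m x" by (auto simp: matches_def x E_def \<theta>_def f)
  define x' where "x' = (SOME x. ?m x)"
  have mx': "?m x'" unfolding x'_def by (rule someI[of ?m, OF mx])
  let ?v = "small_eval N x'"
  have x'N: "x' \<in> carrier N" using mx' by (simp add: matches_def)
  \<comment> \<open>All names are evaluated at the same chosen \<open>x'\<close>, by the trees that
    differ only in \<open>p\<close>.\<close>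
  have vN0: "?v p \<in> ?N0" for p
    by (rule range_eqI[of _ _ "Node (Inr (E, \<theta>, F, p)) f"]) (use mx in \<open>auto simp: x'_def\<close>)
  have uv: "?v p = ?v q" if "?u p = ?u q" for p q
    using mx' that unfolding matches_def E_def by blast
  have vF: "?v p = ?u p" if "p \<in> F" for p
    using mx' that f unfolding matches_def by simp
  have v\<psi>: "\<psi> (?v p) = \<psi> (?u p)" for p
    using mx' unfolding matches_def \<theta>_def by metis
  define \<alpha> where "\<alpha> y = ?v (inv_into UNIV ?u y)" for y
  have \<alpha>: "\<alpha> (?u p) = ?v p" for p
    unfolding \<alpha>_def by (rule uv) (simp add: f_inv_into_f)
  let ?NU = "N\<lparr>carrier := U\<rparr>"
  note exU = op_closed_exact[OF N clU] and exS = op_closed_exact[OF N clS]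
  have uc: "?u p \<in> carrier N" and vc: "?v p \<in> carrier N" for p
    using small_eval_closed[OF op_closed_carrier[OF N]] x x'N by blast+
  have "\<alpha> \<in> mod_hom R ?NU N"
  proof (rule mod_homI)
    show "\<alpha> y \<in> carrier N" if "y \<in> carrier ?NU" for y
      unfolding \<alpha>_def by (rule vc)
    show "\<alpha> (y \<oplus>\<^bsub>?NU\<^esub> z) = \<alpha> y \<oplus>\<^bsub>N\<^esub> \<alpha> z" if yz: "y \<in> carrier ?NU" "z \<in> carrier ?NU" for y z
    proof -
      obtain p q where pq: "y = ?u p" "z = ?u q" using yz by (auto simp: U_def)
      \<comment> \<open>A sum of named elements is named by a tree, and both evaluations compute
        that tree in the same way; hence \<open>\<alpha>\<close> is additive.\<close>
      let ?t = "Node Add_op (\<lambda>l. if l = Inr True then p else q)"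
      have "\<alpha> (y \<oplus>\<^bsub>N\<^esub> z) = ?v ?t" using \<alpha>[of ?t] by (simp add: pq)
      then show ?thesis by (simp add: pq \<alpha>)
    qed
    show "\<alpha> (r \<odot>\<^bsub>?NU\<^esub> y) = r \<odot>\<^bsub>N\<^esub> \<alpha> y" if ry: "r \<in> carrier R" "y \<in> carrier ?NU" for r y
    proof -
      obtain p where p: "y = ?u p" using ry by (auto simp: U_def)
      let ?t = "Node (Smult_op r) (\<lambda>l. p)"
      have "\<alpha> (r \<odot>\<^bsub>N\<^esub> y) = ?v ?t" using \<alpha>[of ?t] ry by (simp add: p)
      then show ?thesis using ry by (simp add: p \<alpha>)
    qed
  qed
  note \<alpha>h = mod_homD[OF this]
  have UN: "U \<subseteq> carrier N" using uc by (auto simp: U_def)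
  define \<beta> where "\<beta> y = y \<ominus>\<^bsub>N\<^esub> \<alpha> y" for y
  have \<beta>h: "\<beta> \<in> mod_hom R ?NU N"
  proof (rule mod_homI)
    show "\<beta> y \<in> carrier N" if "y \<in> carrier ?NU" for y
      using that \<alpha>h(1)[OF that] UN by (auto simp: \<beta>_def)
    show "\<beta> (y \<oplus>\<^bsub>?NU\<^esub> z) = \<beta> y \<oplus>\<^bsub>N\<^esub> \<beta> z" if "y \<in> carrier ?NU" "z \<in> carrier ?NU" for y z
      using that \<alpha>h(2)[OF that] N.add_minus_add[of y z "\<alpha> y" "\<alpha> z"] \<alpha>h(1)[of y] \<alpha>h(1)[of z]
        subsetD[OF UN] by (simp add: \<beta>_def)
    show "\<beta> (r \<odot>\<^bsub>?NU\<^esub> y) = r \<odot>\<^bsub>N\<^esub> \<beta> y" if "r \<in> carrier R" "y \<in> carrier ?NU" for r y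
      using that \<alpha>h(3)[OF that] N.smult_minus[of r y "\<alpha> y"] \<alpha>h(1)[of y] subsetD[OF UN] by (simp add: \<beta>_def)
  qed
  have \<beta>u: "\<beta> (?u p) = ?u p \<ominus>\<^bsub>N\<^esub> ?v p" for p by (simp add: \<beta>_def \<alpha>)
  \<comment> \<open>A fixed point of \<open>\<alpha>\<close> is some \<open>?v p\<close> and so lies
    in \<open>?N0\<close>; conversely an element of \<open>?N0\<close> has its names in
    \<open>F\<close>, where the two evaluations agree.\<close>
  have ker: "{y \<in> U. \<beta> y = \<zero>\<^bsub>N\<^esub>} = S"
  proof (intro equalityI subsetI)
    fix y assume "y \<in> {y \<in> U. \<beta> y = \<zero>\<^bsub>N\<^esub>}"
    then obtain p where p: "y = ?u p" "y \<in> U" "?u p \<ominus>\<^bsub>N\<^esub> ?v p = \<zero>\<^bsub>N\<^esub>" by (auto simp: U_def \<beta>u)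
    then have "y = ?v p" using N.minus_eq_zero_iff uc vc by simp
    then show "y \<in> S" using p(2) vN0 by (simp add: S_def)
  next
    fix y assume y: "y \<in> S"
    then obtain p where p: "y = ?u p" by (auto simp: S_def U_def)
    then have "p \<in> F" using y by (simp add: F_def S_def)
    then show "y \<in> {y \<in> U. \<beta> y = \<zero>\<^bsub>N\<^esub>}"
      using y p vF uc by (simp add: S_def \<beta>u N.minus_eq_zero_iff)
  qed
  define I where "I = \<beta> ` U"
  have NUl: "left_module R ?NU" using exU exact_moduleD by blast
  have Is: "submodule_of R N I"
    using submodule_of_image[OF NUl Nl \<beta>h] by (simp add: I_def)
  have "exact_module (N\<lparr>carrier := I\<rparr>)"
  proof (rule exact_quotient[of ?NU _ \<beta>])
    show "exact_module ?NU" using exU by blast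
    show "left_module R (N\<lparr>carrier := I\<rparr>)" by (rule submodule_of_left_module[OF Nl Is])
    show "\<beta> \<in> mod_hom R ?NU (N\<lparr>carrier := I\<rparr>)"
      by (rule mod_homI) (use mod_homD[OF \<beta>h] in \<open>auto simp: I_def\<close>)
    show "\<beta> ` carrier ?NU = carrier (N\<lparr>carrier := I\<rparr>)" by (simp add: I_def)
    show "exact_module (?NU\<lparr>carrier := {x \<in> carrier ?NU. \<beta> x = \<zero>\<^bsub>N\<lparr>carrier := I\<rparr>\<^esub>}\<rparr>)"
      using exS by (simp add: ker)
  qed
  moreover have "\<psi> y = \<zero>\<^bsub>M\<^esub>" if "y \<in> I" for y
    using that mod_hom_minus(3)[OF Nl M \<psi>] uc vc v\<psi> mod_homD(1)[OF \<psi>]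
    by (auto simp: I_def U_def \<beta>u M.minus_eq_zero_iff)
  ultimately have "I \<subseteq> {\<zero>\<^bsub>N\<^esub>}" using red Is by blast
  \<comment> \<open>As \<open>x\<close> itself lies in \<open>U\<close>, the vanishing of
    \<open>I\<close> puts \<open>x\<close> into the kernel \<open>S\<close>, against
    \<open>x \<notin> ?N0\<close>.\<close>
  moreover have "x \<in> U" unfolding U_def by (rule range_eqI[of _ _ Leaf]) simp
  ultimately have "x \<in> {y \<in> U. \<beta> y = \<zero>\<^bsub>N\<^esub>}" unfolding I_def by blast
  then show False using ker xN0 by (auto simp: S_def)
qed

text \<open>After division by a maximal exact submodule of the kernel every element is the value of
  a tree. The type of trees depends on \<open>R\<close>, the basis and \<open>M\<close> but not on
  \<open>N\<close>, so any injection \<open>e\<close> of the trees fixes a type for all quotients at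
  once.\<close>

lemma reduction_exists:
  fixes N :: "('r, 'n) module" and M :: "('r, 'm) module" and e :: "('r, 'b, 'm) big_tree \<Rightarrow> 'u"
  assumes N: "exact_module N" and M: "left_module R M" and \<psi>: "\<psi> \<in> mod_hom R N M" and e: "inj e"
  obtains N' :: "('r, 'u) module" and \<psi>' q where "exact_module N'" "\<psi>' \<in> mod_hom R N' M" "q \<in> mod_hom R N N'"
    "q ` carrier N = carrier N'" "\<And>x. x \<in> carrier N \<Longrightarrow> \<psi>' (q x) = \<psi> x"
proof -
  note Nl = exact_moduleD[OF N]
  interpret N: left_module R N by (rule Nl)
  interpret M: left_module R M by (rule M)
  define \<A> where "\<A> = {K. exact_submodule N K \<and> (\<forall>x\<in>K. \<psi> x = \<zero>\<^bsub>M\<^esub>)}"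
  have "\<exists>K\<in>\<A>. \<forall>X\<in>\<A>. K \<subseteq> X \<longrightarrow> X = K"
  proof (rule subset_Zorn_nonempty)
    show "\<A> \<noteq> {}"
      using exact_zero_submodule[OF Nl] mod_hom_minus(1)[OF Nl M \<psi>] by (auto simp: \<A>_def)
    show "\<Union>\<C> \<in> \<A>" if C: "\<C> \<noteq> {}" "subset.chain \<A> \<C>" for \<C>
    proof -
      have "exact_submodule N (\<Union>\<C>)"
      proof (intro exact_Union[OF Nl C(1)])
        show "exact_submodule N K" if "K \<in> \<C>" for K using C(2) that by (auto simp: subset.chain_def \<A>_def)
        show "K \<subseteq> L \<or> L \<subseteq> K" if "K \<in> \<C>" "L \<in> \<C>" for K L using C(2) that unfolding subset.chain_def by blast
      qed
      then show ?thesis using C(2) by (auto simp: subset.chain_def \<A>_def)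
    qed
  qed
  then obtain K where K: "K \<in> \<A>" and max: "\<And>X. X \<in> \<A> \<Longrightarrow> K \<subseteq> X \<Longrightarrow> X = K" by blast
  have Ks: "submodule_of R N K" and Ke: "exact_module (N\<lparr>carrier := K\<rparr>)" and K\<psi>: "\<And>x. x \<in> K \<Longrightarrow> \<psi> x = \<zero>\<^bsub>M\<^esub>"
    using K by (auto simp: \<A>_def)
  obtain g :: "'n \<Rightarrow> 'n" where g: "\<forall>x\<in>carrier N. \<forall>y\<in>carrier N. g x = g y \<longleftrightarrow> x \<ominus>\<^bsub>N\<^esub> y \<in> K"
    using quotient_map_exists[OF Nl Ks] by blast
  define Q where "Q = push_module N g"
  note Q = push_module[OF Nl Ks g, folded Q_def]
  have KN: "K \<subseteq> carrier N" using Ks by (simp add: submodule_of_def)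
  then have kerg: "{x \<in> carrier N. g x = \<zero>\<^bsub>Q\<^esub>} = K" using Q(4) by auto
  have Qe: "exact_module Q"
    by (rule exact_quotient[OF N Q(1,2) Q(3)[symmetric]]) (subst kerg, rule Ke)
  obtain \<psi>1 where \<psi>1: "\<psi>1 \<in> mod_hom R Q M" "\<And>x. x \<in> carrier N \<Longrightarrow> \<psi>1 (g x) = \<psi> x"
    using mod_hom_factor[OF Nl Q(1) M Q(2) Q(3)[symmetric] \<psi>] Q(4) K\<psi> by metis
  have "carrier Q \<subseteq> range (big_eval Q \<psi>1)"
  proof (rule reduced_carrier_subset[OF Qe M \<psi>1(1)])
    fix L assume L: "exact_submodule Q L" "\<forall>x\<in>L. \<psi>1 x = \<zero>\<^bsub>M\<^esub>"
    note l = submodule_ofD[OF conjunct1[OF L(1)]]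
    \<comment> \<open>The preimage \<open>L'\<close> is an extension of \<open>L\<close> by
      \<open>K\<close> and is still killed by \<open>\<psi>\<close>, so maximality forces
      \<open>L' = K\<close>, that is, \<open>L = 0\<close>.\<close>
    define L' where "L' = {x \<in> carrier N. g x \<in> L}"
    have L's: "submodule_of R N L'"
      using l mod_homD[OF Q(2)] Q(4)[of "\<zero>\<^bsub>N\<^esub>"] submodule_ofD(2)[OF Ks]
      by (auto simp: submodule_of_def L'_def N.smult_closed)
    have KL': "K \<subseteq> L'"
    proof
      fix x assume "x \<in> K"
      then have "x \<in> carrier N" "g x = \<zero>\<^bsub>Q\<^esub>" using kerg by auto
      then show "x \<in> L'" using l(2) by (simp add: L'_def)
    qed
    have L'N: "L' \<subseteq> carrier N" by (auto simp: L'_def)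
    have im: "g ` L' = L" using l(1) Q(3) by (auto simp: L'_def)
    have "exact_module (N\<lparr>carrier := L'\<rparr>)"
    proof (rule exact_extension[of _ "Q\<lparr>carrier := L\<rparr>" g])
      show "left_module R (N\<lparr>carrier := L'\<rparr>)" by (rule submodule_of_left_module[OF Nl L's])
      show "exact_module (Q\<lparr>carrier := L\<rparr>)" using L(1) by blast
      show "g \<in> mod_hom R (N\<lparr>carrier := L'\<rparr>) (Q\<lparr>carrier := L\<rparr>)"
        by (rule mod_homI) (use mod_homD[OF Q(2)] in \<open>auto simp: L'_def\<close>)
      show "g ` carrier (N\<lparr>carrier := L'\<rparr>) = carrier (Q\<lparr>carrier := L\<rparr>)" using im by simp
      have "{x \<in> L'. g x = \<zero>\<^bsub>Q\<^esub>} = K" using kerg KL' L'N by blast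
      then show "exact_module (N\<lparr>carrier := L', carrier := {x \<in> carrier (N\<lparr>carrier := L'\<rparr>). g x = \<zero>\<^bsub>Q\<lparr>carrier := L\<rparr>\<^esub>}\<rparr>)"
        using Ke by simp
    qed
    moreover have "\<psi> x = \<zero>\<^bsub>M\<^esub>" if "x \<in> L'" for x
      using that L(2) \<psi>1(2)[of x] by (auto simp: L'_def)
    ultimately have "L' = K" using max[of L'] KL' L's by (auto simp: \<A>_def)
    then show "L \<subseteq> {\<zero>\<^bsub>Q\<^esub>}" using im kerg by blast
  qed
  then have "\<forall>y\<in>carrier Q. \<exists>t. big_eval Q \<psi>1 t = y" by blast
  then obtain t where t: "\<And>y. y \<in> carrier Q \<Longrightarrow> big_eval Q \<psi>1 (t y) = y" by metis
  interpret Q: left_module R Q by (rule Q(1))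
  \<comment> \<open>Each element of the quotient is replaced by the code of a chosen name.\<close>
  define h where "h y = e (t y)" for y
  have "\<forall>x\<in>carrier Q. \<forall>y\<in>carrier Q. h x = h y \<longleftrightarrow> x \<ominus>\<^bsub>Q\<^esub> y \<in> {\<zero>\<^bsub>Q\<^esub>}"
    using t inj_eq[OF e] Q.minus_eq_zero_iff unfolding h_def by (metis singleton_iff)
  note H = push_module[OF Q(1) submodule_of_zero[OF Q(1)] this]
  define N' where "N' = push_module Q h"
  note H = H[folded N'_def]
  have kerh: "{x \<in> carrier Q. h x = \<zero>\<^bsub>N'\<^esub>} = {\<zero>\<^bsub>Q\<^esub>}" using H(4) by auto
  have N'e: "exact_module N'"
    by (rule exact_quotient[OF Qe H(1,2) H(3)[symmetric]])
      (subst kerh, rule conjunct2[OF exact_zero_submodule[OF Q(1)]])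
  obtain \<psi>' where \<psi>': "\<psi>' \<in> mod_hom R N' M" "\<And>x. x \<in> carrier Q \<Longrightarrow> \<psi>' (h x) = \<psi>1 x"
    using mod_hom_factor[OF Q(1) H(1) M H(2) H(3)[symmetric] \<psi>1(1)] H(4) mod_hom_minus(1)[OF Q(1) M \<psi>1(1)]
    by (metis singletonD)
  show thesis
  proof (rule that[OF N'e \<psi>'(1) mod_hom_comp[OF Q(2) H(2)]])
    show "(\<lambda>x. h (g x)) ` carrier N = carrier N'" using Q(3) H(3) by (simp add: image_image[symmetric])
    show "\<psi>' (h (g x)) = \<psi> x" if "x \<in> carrier N" for x
      using \<psi>'(2)[of "g x"] \<psi>1(2)[OF that] that Q(3) by auto
  qed
qed

end

section \<open>Counting names\<close>

text \<open>Sizes are compared by injections into an infinite type \<open>'k\<close> and its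
  iterated powersets. Products, sums and lists over \<open>'k\<close> are no larger than
  \<open>'k\<close>.\<close>

lemma inj_prod_infinite:
  fixes f :: "'a \<Rightarrow> 'k" and g :: "'b \<Rightarrow> 'k"
  assumes "infinite (UNIV :: 'k set)" "inj f" "inj g"
  shows "\<exists>h :: 'a \<times> 'b \<Rightarrow> 'k. inj h"
proof -
  obtain p :: "'k \<times> 'k \<Rightarrow> 'k" where "bij p"
    using Times_same_infinite_bij_betw_types[OF assms(1)] by blast
  then have "inj (p \<circ> map_prod f g)"
    using assms(2,3) by (intro inj_compose prod.inj_map) (auto simp: bij_def)
  then show ?thesis by blast
qed

lemma inj_sum_infinite:
  fixes f :: "'a \<Rightarrow> 'k" and g :: "'b \<Rightarrow> 'k"
  assumes "infinite (UNIV :: 'k set)" "inj f" "inj g"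
  shows "\<exists>h :: 'a + 'b \<Rightarrow> 'k. inj h"
proof -
  obtain p :: "'k + 'k \<Rightarrow> 'k" where "bij p"
    using Plus_infinite_bij_betw_types[OF assms(1) inj_on_id] by blast
  then have "inj (p \<circ> map_sum f g)"
    using assms(2,3) by (intro inj_compose sum.inj_map) (auto simp: bij_def)
  then show ?thesis by blast
qed

lemma inj_list_infinite:
  fixes f :: "'a \<Rightarrow> 'k"
  assumes "infinite (UNIV :: 'k set)" "inj f"
  shows "\<exists>h :: 'a list \<Rightarrow> 'k. inj h"
proof -
  obtain p :: "'k list \<Rightarrow> 'k" where "bij p"
    using lists_infinite_bij_betw_types[OF assms(1)] by blast
  then have "inj (p \<circ> map f)"
    using assms(2) by (intro inj_compose list.inj_map) (auto simp: bij_def)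
  then show ?thesis by blast
qed

lemma inj_nat_infinite:
  assumes "infinite (UNIV :: 'k set)"
  shows "\<exists>h :: nat \<Rightarrow> 'k. inj h"
  using infinite_countable_subset[OF assms] by blast

lemma inj_bool_infinite:
  assumes "infinite (UNIV :: 'k set)"
  shows "\<exists>h :: bool \<Rightarrow> 'k. inj h"
proof -
  obtain h :: "nat \<Rightarrow> 'k" where "inj h" using inj_nat_infinite[OF assms] by blast
  then have "inj (h \<circ> of_bool)" by (intro inj_compose) (auto simp: inj_def split: if_splits)
  then show ?thesis by blast
qed

lemma inj_set_mono: "\<exists>h :: 'a set \<Rightarrow> 'k set. inj h" if "inj (f :: 'a \<Rightarrow> 'k)"
  by (rule exI[of _ "image f"]) (use that in \<open>auto simp: inj_def inj_image_eq_iff\<close>)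

text \<open>The exponent rule (2^k)^k = 2^k: a function with subsets of \<open>'k\<close> as values
  is coded by the set of pairs of an argument and an element of its value.\<close>

lemma inj_fun_infinite:
  fixes f :: "'a \<Rightarrow> 'k" and g :: "'b \<Rightarrow> 'k set"
  assumes "infinite (UNIV :: 'k set)" "inj f" "inj g"
  shows "\<exists>h :: ('a \<Rightarrow> 'b) \<Rightarrow> 'k set. inj h"
proof -
  obtain p :: "'k \<times> 'k \<Rightarrow> 'k" where p: "bij p"
    using Times_same_infinite_bij_betw_types[OF assms(1)] by blast
  let ?h = "\<lambda>u. p ` {(f a, x) | a x. x \<in> g (u a)}"
  have "inj ?h"
  proof (rule injI)
    fix u v assume "?h u = ?h v"
    then have *: "{(f a, x) | a x. x \<in> g (u a)} = {(f a, x) | a x. x \<in> g (v a)}"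
      using p by (simp add: inj_image_eq_iff bij_def)
    have "x \<in> g (u a) \<longleftrightarrow> x \<in> g (v a)" for x a
    proof -
      have "(f a, x) \<in> {(f a, x) | a x. x \<in> g (u a)} \<longleftrightarrow> (f a, x) \<in> {(f a, x) | a x. x \<in> g (v a)}"
        by (simp only: *)
      then show ?thesis by (simp add: inj_eq[OF assms(2)])
    qed
    then have "g (u a) = g (v a)" for a by blast
    then show "u = v" using assms(3) by (auto simp: inj_eq)
  qed
  then show ?thesis by blast
qed

lemma inj_option_infinite:
  fixes f :: "'a \<Rightarrow> 'k"
  assumes "infinite (UNIV :: 'k set)" "inj f"
  shows "\<exists>h :: 'a option \<Rightarrow> 'k. inj h"
proof -
  obtain h :: "bool + 'a \<Rightarrow> 'k" where h: "inj h"
    using inj_sum_infinite[OF assms(1) _ assms(2)] inj_bool_infinite[OF assms(1)] by blast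
  have "inj (h \<circ> (\<lambda>x. case x of None \<Rightarrow> Inl True | Some a \<Rightarrow> Inr a))"
    by (rule inj_compose[OF h]) (auto simp: inj_def split: option.splits)
  then show ?thesis by blast
qed

text \<open>By \<open>label_at\<close> a tree is a function from words of branches to labels. With k
  branches there are k words, so 2^k labels give at most (2^k)^k = 2^k trees.\<close>

lemma inj_wtree_infinite:
  fixes f :: "'o \<Rightarrow> 'k set" and g :: "'l \<Rightarrow> 'k"
  assumes k: "infinite (UNIV :: 'k set)" and f: "inj f" and g: "inj g"
  shows "\<exists>h :: ('o, 'l) wtree \<Rightarrow> 'k set. inj h"
proof -
  have ks: "infinite (UNIV :: 'k set set)" using k by (simp add: Finite_Set.finite_set)
  obtain f' :: "'o option \<Rightarrow> 'k set" where f': "inj f'" using inj_option_infinite[OF ks f] by blast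
  obtain g' :: "'l list \<Rightarrow> 'k" where g': "inj g'" using inj_list_infinite[OF k g] by blast
  obtain h :: "('l list \<Rightarrow> 'o option) \<Rightarrow> 'k set" where "inj h" using inj_fun_infinite[OF k g' f'] by blast
  then have "inj (h \<circ> label_at)" by (rule inj_compose[OF _ inj_label_at])
  then show ?thesis by blast
qed

lemma inj_closure_op:
  fixes f :: "'r \<Rightarrow> 'k" and g :: "'b \<Rightarrow> 'k"
  assumes k: "infinite (UNIV :: 'k set)" and f: "inj f" and g: "inj g"
  shows "\<exists>h :: ('r, 'b) closure_op \<Rightarrow> 'k. inj h"
proof -
  obtain i where i: "inj (i :: nat \<Rightarrow> 'k)" using inj_nat_infinite[OF k] by blast
  obtain j where j: "inj (j :: bool \<Rightarrow> 'k)" using inj_bool_infinite[OF k] by blast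
  obtain u where u: "inj (u :: nat \<times> 'b \<Rightarrow> 'k)" using inj_prod_infinite[OF k i g] by blast
  obtain v where v: "inj (v :: 'r + nat \<times> 'b \<Rightarrow> 'k)" using inj_sum_infinite[OF k f u] by blast
  obtain w where w: "inj (w :: bool + ('r + nat \<times> 'b) \<Rightarrow> 'k)" using inj_sum_infinite[OF k j v] by blast
  let ?c = "\<lambda>x. case x of Zero_op \<Rightarrow> Inl True | Add_op \<Rightarrow> Inl False | Smult_op r \<Rightarrow> Inr (Inl r)
     | Witness_op n b \<Rightarrow> Inr (Inr (n, b))"
  have "inj ?c" by (auto simp: inj_def split: closure_op.splits)
  then have "inj (w \<circ> ?c)" by (rule inj_compose[OF w])
  then show ?thesis by blast
qed

text \<open>Small trees have at most k labels and k branches, so there are at most 2^k of them. The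
  labels of big trees contain sets of pairs of small trees and functions on small trees, which makes
  2^(2^k), and the tree bound with 2^k branches preserves this number.\<close>

lemma inj_big_tree:
  fixes f :: "'r \<Rightarrow> 'k" and g :: "'b \<Rightarrow> 'k" and m :: "'m \<Rightarrow> 'k"
  assumes k: "infinite (UNIV :: 'k set)" and f: "inj f" and g: "inj g" and m: "inj m"
  shows "\<exists>e :: ('r, 'b, 'm) big_tree \<Rightarrow> 'k set set. inj e"
proof -
  have ks: "infinite (UNIV :: 'k set set)" using k by (simp add: Finite_Set.finite_set)
  then have kss: "infinite (UNIV :: 'k set set set)" by (simp add: Finite_Set.finite_set)
  have sing: "inj (\<lambda>x. {x})" by (simp add: inj_def)
  obtain i where i: "inj (i :: bool \<Rightarrow> 'k)" using inj_bool_infinite[OF k] by blast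
  obtain br where br: "inj (br :: 'b + bool \<Rightarrow> 'k)" using inj_sum_infinite[OF k g i] by blast
  obtain c where c: "inj (c :: ('r, 'b) closure_op \<Rightarrow> 'k)" using inj_closure_op[OF k f g] by blast
  have c2: "inj ((\<lambda>x. {{x}}) \<circ> c)" by (rule inj_compose[OF _ c]) (simp add: inj_def)
  obtain s where s: "inj (s :: ('r, 'b) small_tree \<Rightarrow> 'k set)"
    using inj_wtree_infinite[OF k inj_compose[OF sing c] br] by blast
  obtain E0 where "inj (E0 :: ('r, 'b) small_tree \<times> ('r, 'b) small_tree \<Rightarrow> 'k set)"
    using inj_prod_infinite[OF ks s s] by blast
  from inj_set_mono[OF this]
  obtain E where E: "inj (E :: (('r, 'b) small_tree \<times> ('r, 'b) small_tree) set \<Rightarrow> 'k set set)" by blast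
  have m2: "inj ((\<lambda>x. {{x}}) \<circ> m)" by (rule inj_compose[OF _ m]) (simp add: inj_def)
  obtain T where T: "inj (T :: (('r, 'b) small_tree \<Rightarrow> 'm) \<Rightarrow> 'k set set)"
    using inj_fun_infinite[OF ks s m2] by blast
  obtain F where F: "inj (F :: ('r, 'b) small_tree set \<Rightarrow> 'k set set)" using inj_set_mono[OF s] by blast
  obtain FP where FP: "inj (FP :: ('r, 'b) small_tree set \<times> ('r, 'b) small_tree \<Rightarrow> 'k set set)"
    using inj_prod_infinite[OF kss F inj_compose[OF sing s]] by blast
  obtain TFP where TFP: "inj (TFP :: (('r, 'b) small_tree \<Rightarrow> 'm) \<times> ('r, 'b) small_tree set \<times> ('r, 'b) small_tree \<Rightarrow> 'k set set)"
    using inj_prod_infinite[OF kss T FP] by blast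
  obtain D where D: "inj (D :: (('r, 'b) small_tree \<times> ('r, 'b) small_tree) set \<times> (('r, 'b) small_tree \<Rightarrow> 'm) \<times>
       ('r, 'b) small_tree set \<times> ('r, 'b) small_tree \<Rightarrow> 'k set set)"
    using inj_prod_infinite[OF kss E TFP] by blast
  obtain b where b: "inj (b :: ('r, 'b, 'm) big_op \<Rightarrow> 'k set set)"
    using inj_sum_infinite[OF kss c2 D] by blast
  show ?thesis using inj_wtree_infinite[OF ks b s] .
qed

lemma inj_basis:
  fixes f :: "'r \<Rightarrow> 'k" and x :: "'x \<Rightarrow> 'k"
  assumes k: "infinite (UNIV :: 'k set)" and f: "inj f" and x: "inj x"
  shows "\<exists>e :: ('r, 'x) basis \<Rightarrow> 'k. inj e"
proof -
  obtain n where n: "inj (n :: nat \<Rightarrow> 'k)" using inj_nat_infinite[OF k] by blast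
  obtain u where u: "inj (u :: 'x + nat \<Rightarrow> 'k)" using inj_sum_infinite[OF k x n] by blast
  obtain v where v: "inj (v :: 'r + 'x + nat \<Rightarrow> 'k)" using inj_sum_infinite[OF k f u] by blast
  show ?thesis using inj_list_infinite[OF k v] .
qed

text \<open>The origin of \<open>cover_elem\<close>: the type \<open>'r + 'm + nat\<close> is
  infinite and dominates scalars, basis elements and elements of \<open>M\<close>, and counting
  trees costs two powersets.\<close>

lemma inj_big_tree_cover_elem:
  "\<exists>e :: ('r, ('r, 'r) basis, 'm) big_tree \<Rightarrow> ('r, 'm) cover_elem. inj e"
proof -
  have k: "infinite (UNIV :: ('r + 'm + nat) set)"
    by (simp add: UNIV_Plus_UNIV[symmetric] del: UNIV_Plus_UNIV)
  have r: "inj (Inl :: 'r \<Rightarrow> 'r + 'm + nat)" by simp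
  have m: "inj (Inr \<circ> Inl :: 'm \<Rightarrow> 'r + 'm + nat)" by (intro inj_compose) auto
  obtain b where "inj (b :: ('r, 'r) basis \<Rightarrow> 'r + 'm + nat)" using inj_basis[OF k r r] by blast
  from inj_big_tree[OF k r this m] show ?thesis .
qed

section \<open>A precover\<close>

context mat_complex
begin

text \<open>With the element type fixed, the modules over \<open>M\<close> form a set, so all of
  them together can index one direct sum.\<close>

definition index_over :: "('r, 'm) module \<Rightarrow> (('r, 'u) module \<times> ('u \<Rightarrow> 'm)) set" where
  "index_over M = {(N, \<psi>). exact_module N \<and> \<psi> \<in> mod_hom R N M}"

definition sum_over :: "('r, 'm) module \<Rightarrow> ('r, ('r, 'u) module \<times> ('u \<Rightarrow> 'm) \<Rightarrow> 'u) module" where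
  "sum_over M = direct_sum (index_over M) fst"

definition map_over :: "('r, 'm) module \<Rightarrow> (('r, 'u) module \<times> ('u \<Rightarrow> 'm) \<Rightarrow> 'u) \<Rightarrow> 'm" where
  "map_over M z = supp_sum M (\<lambda>i. if i \<in> index_over M then snd i (z i) else \<zero>\<^bsub>M\<^esub>)"

lemma exact_sum_over: "exact_module (sum_over M)"
  unfolding sum_over_def by (rule exact_direct_sum) (auto simp: index_over_def)

lemma map_over_hom:
  assumes M: "left_module R M"
  shows "map_over M \<in> mod_hom R (sum_over M) M"
proof -
  interpret M: left_module R M by fact
  let ?I = "index_over M"
  let ?t = "\<lambda>z i. if i \<in> ?I then snd i (z i) else \<zero>\<^bsub>M\<^esub>"
  have N: "left_module R (fst i)" "snd i \<in> mod_hom R (fst i) M" if "i \<in> ?I" for i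
    using that exact_moduleD by (auto simp: index_over_def)
  have t: "?t z i \<in> carrier M" "finite {i. ?t z i \<noteq> \<zero>\<^bsub>M\<^esub>}" if z: "z \<in> carrier (sum_over M)" for z i
  proof -
    have z': "z \<in> fin_supp ?I fst" using z by (simp add: sum_over_def direct_sum_sel)
    then show "?t z i \<in> carrier M" by (cases "i \<in> ?I") (simp_all add: fin_supp_iff mod_homD(1)[OF N(2)])
    have "finite {i. z i \<noteq> \<zero>\<^bsub>fst i\<^esub>}" using z' by (simp add: fin_supp_iff)
    then show "finite {i. ?t z i \<noteq> \<zero>\<^bsub>M\<^esub>}"
    proof (rule rev_finite_subset, intro subsetI CollectI notI)
      fix i assume i: "i \<in> {i. ?t z i \<noteq> \<zero>\<^bsub>M\<^esub>}" and "z i = \<zero>\<^bsub>fst i\<^esub>"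
      then show False using mod_hom_minus(1)[OF N(1) M N(2), of i] by (cases "i \<in> ?I") simp_all
    qed
  qed
  have zc: "z i \<in> carrier (fst i)" if "z \<in> carrier (sum_over M)" "i \<in> ?I" for z i
    using that by (auto simp: sum_over_def direct_sum_sel fin_supp_iff)
  show ?thesis
  proof (rule mod_homI)
    show "map_over M z \<in> carrier M" if "z \<in> carrier (sum_over M)" for z
      unfolding map_over_def by (rule M.supp_sum_closed) (rule t(1)[OF that])
    show "map_over M (x \<oplus>\<^bsub>sum_over M\<^esub> y) = map_over M x \<oplus>\<^bsub>M\<^esub> map_over M y"
      if x: "x \<in> carrier (sum_over M)" and y: "y \<in> carrier (sum_over M)" for x y
    proof -
      have "?t (x \<oplus>\<^bsub>sum_over M\<^esub> y) = (\<lambda>i. ?t x i \<oplus>\<^bsub>M\<^esub> ?t y i)"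
      proof
        show "?t (x \<oplus>\<^bsub>sum_over M\<^esub> y) i = ?t x i \<oplus>\<^bsub>M\<^esub> ?t y i" for i
          using zc[OF x, of i] zc[OF y, of i] mod_homD(2)[OF N(2), of i "x i" "y i"]
          by (cases "i \<in> ?I") (simp_all add: sum_over_def direct_sum_sel)
      qed
      then show ?thesis
        unfolding map_over_def using M.supp_sum_add[of "?t x" "?t y"] t[OF x] t[OF y] by simp
    qed
    show "map_over M (r \<odot>\<^bsub>sum_over M\<^esub> x) = r \<odot>\<^bsub>M\<^esub> map_over M x"
      if r: "r \<in> carrier R" and x: "x \<in> carrier (sum_over M)" for r x
    proof -
      have "?t (r \<odot>\<^bsub>sum_over M\<^esub> x) = (\<lambda>i. r \<odot>\<^bsub>M\<^esub> ?t x i)"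
      proof
        show "?t (r \<odot>\<^bsub>sum_over M\<^esub> x) i = r \<odot>\<^bsub>M\<^esub> ?t x i" for i
          using zc[OF x, of i] mod_homD(3)[OF N(2) r, of i "x i"]
          by (cases "i \<in> ?I") (simp_all add: sum_over_def direct_sum_sel M.smult_zero r)
      qed
      moreover have "(\<lambda>m. r \<odot>\<^bsub>M\<^esub> m) \<in> hom (add_monoid M) (add_monoid M)"
        using r by (auto simp: hom_def M.smult_closed M.smult_r_distr)
      ultimately show ?thesis
        unfolding map_over_def using M.supp_sum_hom[OF M.abelian_group_axioms, of _ "?t x"] t[OF x] by simp
    qed
  qed
qed

text \<open>The quotient \<open>N'\<close> supplied by \<open>reduction_exists\<close>, with its map
  to \<open>M\<close>, is itself one of the summands; \<open>N\<close> is sent to it and then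
  included.\<close>

lemma map_over_weakly_terminal:
  fixes N :: "('r, 'n) module" and M :: "('r, 'm) module" and e :: "('r, 'b, 'm) big_tree \<Rightarrow> 'u"
  assumes M: "left_module R M" and e: "inj e" and N: "exact_module N" and \<psi>: "\<psi> \<in> mod_hom R N M"
  shows "\<exists>h\<in>mod_hom R N (sum_over M :: ('r, ('r, 'u) module \<times> ('u \<Rightarrow> 'm) \<Rightarrow> 'u) module).
    \<forall>x\<in>carrier N. map_over M (h x) = \<psi> x"
proof -
  interpret M: left_module R M by fact
  obtain N' :: "('r, 'u) module" and \<psi>' q where N': "exact_module N'" "\<psi>' \<in> mod_hom R N' M"
    and q: "q \<in> mod_hom R N N'" and "q ` carrier N = carrier N'"
    and q\<psi>: "\<And>x. x \<in> carrier N \<Longrightarrow> \<psi>' (q x) = \<psi> x"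
    by (rule reduction_exists[OF N M \<psi> e], rule that)
  let ?i = "(N', \<psi>')"
  have i: "?i \<in> index_over M" using N' by (simp add: index_over_def)
  let ?s = "\<lambda>x k. if k = ?i then x else \<zero>\<^bsub>fst k\<^esub>"
  have ag: "abelian_group (fst k)" "left_module R (fst k)" if "k \<in> index_over M" for k
  proof -
    have "exact_module (fst k)" using that by (auto simp: index_over_def)
    then show "left_module R (fst k)" by (rule exact_moduleD)
    then show "abelian_group (fst k)" by (rule left_moduleE)
  qed
  have "?s \<in> mod_hom R N' (sum_over M)"
  proof (rule mod_homI)
    show "?s x \<in> carrier (sum_over M)" if "x \<in> carrier N'" for x
    proof -
      have "finite {k. ?s x k \<noteq> \<zero>\<^bsub>fst k\<^esub>}" by (rule finite_subset[of _ "{?i}"]) auto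
      then show ?thesis
        using that i abelian_groupE(2)[OF ag(1)] by (auto simp: sum_over_def direct_sum_sel fin_supp_iff)
    qed
    show "?s (x \<oplus>\<^bsub>N'\<^esub> y) = ?s x \<oplus>\<^bsub>sum_over M\<^esub> ?s y" for x y
    proof
      show "?s (x \<oplus>\<^bsub>N'\<^esub> y) k = (?s x \<oplus>\<^bsub>sum_over M\<^esub> ?s y) k" for k
        using i abelian_groupE(2,5)[OF ag(1), of k]
        by (cases "k = ?i"; cases "k \<in> index_over M") (simp_all add: sum_over_def direct_sum_sel)
    qed
    show "?s (r \<odot>\<^bsub>N'\<^esub> x) = r \<odot>\<^bsub>sum_over M\<^esub> ?s x" if "r \<in> carrier R" for r x
    proof
      show "?s (r \<odot>\<^bsub>N'\<^esub> x) k = (r \<odot>\<^bsub>sum_over M\<^esub> ?s x) k" for k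
        using i left_module.smult_zero[OF ag(2) that, of k]
        by (cases "k = ?i"; cases "k \<in> index_over M") (simp_all add: sum_over_def direct_sum_sel)
    qed
  qed
  note hc = mod_hom_comp[OF q this]
  have "map_over M (?s (q x)) = \<psi> x" if x: "x \<in> carrier N" for x
  proof -
    have qx: "q x \<in> carrier N'" using mod_homD(1)[OF q x] .
    have zero: "snd k \<zero>\<^bsub>fst k\<^esub> = \<zero>\<^bsub>M\<^esub>" if "k \<in> index_over M" for k
      using that mod_hom_minus(1)[OF ag(2)[OF that] M] by (auto simp: index_over_def)
    have "(\<lambda>k. if k \<in> index_over M then snd k (?s (q x) k) else \<zero>\<^bsub>M\<^esub>) = (\<lambda>k. if k = ?i then \<psi>' (q x) else \<zero>\<^bsub>M\<^esub>)"
    proof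
      show "(if k \<in> index_over M then snd k (?s (q x) k) else \<zero>\<^bsub>M\<^esub>) = (if k = ?i then \<psi>' (q x) else \<zero>\<^bsub>M\<^esub>)" for k
        using i zero[of k] by (cases "k = ?i"; cases "k \<in> index_over M") simp_all
    qed
    then show ?thesis
      unfolding map_over_def using M.supp_sum_single[OF mod_homD(1)[OF N'(2) qx]] q\<psi>[OF x] by simp
  qed
  then show ?thesis by (intro bexI[OF _ hc] ballI)
qed


section \<open>Directed colimits\<close>

definition end_over :: "('r, 'p) module \<Rightarrow> ('p \<Rightarrow> 'm) \<Rightarrow> ('p \<Rightarrow> 'p) set" where
  "end_over C \<phi> = {g \<in> mod_hom R C C. \<forall>x\<in>carrier C. \<phi> (g x) = \<phi> x}"

text \<open>The colimit consists of the families that are eventually compatible, modulo those that are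
  eventually zero.\<close>

lemma colimit_exists:
  fixes C :: "('r, 'p) module" and M :: "('r, 'm) module" and L :: "'i set"
  assumes C: "exact_module C" and M: "left_module R M" and \<phi>: "\<phi> \<in> mod_hom R C M"
    and L: "L \<noteq> {}"
    and rfl: "\<And>i. i \<in> L \<Longrightarrow> rl i i"
    and trn: "\<And>i k l. i \<in> L \<Longrightarrow> k \<in> L \<Longrightarrow> l \<in> L \<Longrightarrow> rl i k \<Longrightarrow> rl k l \<Longrightarrow> rl i l"
    and dir: "\<And>i k. i \<in> L \<Longrightarrow> k \<in> L \<Longrightarrow> \<exists>l\<in>L. rl i l \<and> rl k l"
    and f: "\<And>i k. i \<in> L \<Longrightarrow> k \<in> L \<Longrightarrow> rl i k \<Longrightarrow> f i k \<in> end_over C \<phi>"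
    and fid: "\<And>i x. i \<in> L \<Longrightarrow> x \<in> carrier C \<Longrightarrow> f i i x = x"
    and ff: "\<And>i k l x. i \<in> L \<Longrightarrow> k \<in> L \<Longrightarrow> l \<in> L \<Longrightarrow> rl i k \<Longrightarrow> rl k l \<Longrightarrow> x \<in> carrier C \<Longrightarrow>
      f k l (f i k x) = f i l x"
  obtains T :: "('r, 'i \<Rightarrow> 'p) module" and \<tau> j where
    "exact_module T" "\<tau> \<in> mod_hom R T M"
    "\<And>i. i \<in> L \<Longrightarrow> j i \<in> mod_hom R C T"
    "\<And>i x. i \<in> L \<Longrightarrow> x \<in> carrier C \<Longrightarrow> \<tau> (j i x) = \<phi> x"
    "\<And>i k x. i \<in> L \<Longrightarrow> k \<in> L \<Longrightarrow> rl i k \<Longrightarrow> x \<in> carrier C \<Longrightarrow> j k (f i k x) = j i x"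
    "\<And>y. y \<in> carrier T \<Longrightarrow> \<exists>i\<in>L. \<exists>x\<in>carrier C. j i x = y"
proof -
  note Pl = exact_moduleD[OF C]
  interpret C: left_module R C by (rule Pl)
  interpret M: left_module R M by (rule M)
  have fh: "f i k \<in> mod_hom R C C" and f\<phi>: "\<And>x. x \<in> carrier C \<Longrightarrow> \<phi> (f i k x) = \<phi> x"
    if "i \<in> L" "k \<in> L" "rl i k" for i k
    using f[OF that] by (auto simp: end_over_def)
  have fc: "f i k x \<in> carrier C" if "i \<in> L" "k \<in> L" "rl i k" "x \<in> carrier C" for i k x
    using mod_homD(1)[OF fh] that by blast
  let ?W = "pointwise_module L (\<lambda>_. C)"
  note Wl = pointwise_module[OF ring_axioms Pl, of L]
  interpret W: left_module R ?W by (rule Wl)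
  note s = pointwise_module_sel
  define co where "co z i \<longleftrightarrow> i \<in> L \<and> (\<forall>k\<in>L. rl i k \<longrightarrow> z k = f i k (z i))" for z :: "'i \<Rightarrow> 'p" and i
  define ze where "ze z i \<longleftrightarrow> i \<in> L \<and> (\<forall>k\<in>L. rl i k \<longrightarrow> z k = \<zero>\<^bsub>C\<^esub>)" for z :: "'i \<Rightarrow> 'p" and i
  define S where "S = {z \<in> carrier ?W. \<exists>i. co z i}"
  define Z where "Z = {z \<in> carrier ?W. \<exists>i. ze z i}"
  have co_mono: "co z k" if "co z i" "k \<in> L" "rl i k" "z \<in> carrier ?W" for z i k
    using that trn[of i k] ff[of i k _ "z i"] by (auto simp: co_def s)
  have co2: "\<exists>i. co y i \<and> co z i" if yz: "y \<in> S" "z \<in> S" for y z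
  proof -
    obtain i k where ik: "co y i" "co z k" using yz by (auto simp: S_def)
    obtain l where l: "l \<in> L" "rl i l" "rl k l" using dir[of i k] ik by (auto simp: co_def)
    have "co y l" using co_mono[OF ik(1) l(1,2)] yz by (simp add: S_def)
    moreover have "co z l" using co_mono[OF ik(2) l(1,3)] yz by (simp add: S_def)
    ultimately show ?thesis by blast
  qed
  have ze2: "\<exists>i. ze y i \<and> ze z i" if "ze y i" "ze z k" for y z i k
  proof -
    obtain l where l: "l \<in> L" "rl i l" "rl k l" using dir[of i k] \<open>ze y i\<close> \<open>ze z k\<close> by (auto simp: ze_def)
    then show ?thesis using that trn[of i l] trn[of k l] by (auto simp: ze_def)
  qed
  have Ss: "submodule_of R ?W S"
    unfolding submodule_of_def
  proof (intro conjI ballI)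
    show "S \<subseteq> carrier ?W" by (auto simp: S_def)
    obtain i where "i \<in> L" using L by blast
    then have "co (\<lambda>_. \<zero>\<^bsub>C\<^esub>) i" using mod_hom_minus(1)[OF Pl Pl fh] by (auto simp: co_def)
    then show "\<zero>\<^bsub>?W\<^esub> \<in> S" by (auto simp: S_def s)
  next
    fix y z assume yz: "y \<in> S" "z \<in> S"
    then obtain i where i: "co y i" "co z i" using co2 by blast
    have "co (y \<oplus>\<^bsub>?W\<^esub> z) i"
      unfolding co_def
    proof (intro conjI ballI impI)
      show "i \<in> L" using i by (simp add: co_def)
      fix k assume k: "k \<in> L" "rl i k"
      have "y i \<in> carrier C" "z i \<in> carrier C" using yz i by (auto simp: S_def s co_def)
      then show "(y \<oplus>\<^bsub>?W\<^esub> z) k = f i k ((y \<oplus>\<^bsub>?W\<^esub> z) i)"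
        using i k mod_homD(2)[OF fh[OF \<open>i \<in> L\<close> k]] by (simp add: s co_def)
    qed
    then show "y \<oplus>\<^bsub>?W\<^esub> z \<in> S" using yz by (auto simp: S_def)
  next
    fix r z assume r: "r \<in> carrier R" and z: "z \<in> S"
    then obtain i where i: "co z i" by (auto simp: S_def)
    have "co (r \<odot>\<^bsub>?W\<^esub> z) i"
      unfolding co_def
    proof (intro conjI ballI impI)
      show "i \<in> L" using i by (simp add: co_def)
      fix k assume k: "k \<in> L" "rl i k"
      have "z i \<in> carrier C" using z i by (auto simp: S_def s co_def)
      then show "(r \<odot>\<^bsub>?W\<^esub> z) k = f i k ((r \<odot>\<^bsub>?W\<^esub> z) i)"
        using r i k mod_homD(3)[OF fh[OF \<open>i \<in> L\<close> k]] by (simp add: s co_def)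
    qed
    then show "r \<odot>\<^bsub>?W\<^esub> z \<in> S" using r z W.smult_closed by (auto simp: S_def)
  qed
  let ?S = "?W\<lparr>carrier := S\<rparr>"
  have Sl: "left_module R ?S" by (rule submodule_of_left_module[OF Wl Ss])
  interpret S: left_module R ?S by (rule Sl)
  have ZS: "Z \<subseteq> S"
  proof
    fix z assume "z \<in> Z"
    then obtain i where i: "ze z i" and zW: "z \<in> carrier ?W" by (auto simp: Z_def)
    then have "co z i"
      using mod_hom_minus(1)[OF Pl Pl fh] rfl by (auto simp: ze_def co_def)
    then show "z \<in> S" using zW by (auto simp: S_def)
  qed
  have Zs: "submodule_of R ?S Z"
    unfolding submodule_of_def
  proof (intro conjI ballI)
    show "Z \<subseteq> carrier ?S" using ZS by simp
    show "\<zero>\<^bsub>?S\<^esub> \<in> Z" using L by (auto simp: Z_def ze_def s)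
    show "y \<oplus>\<^bsub>?S\<^esub> z \<in> Z" if yz: "y \<in> Z" "z \<in> Z" for y z
    proof -
      obtain i where i: "ze y i" "ze z i" using yz ze2 unfolding Z_def by blast
      then have "ze (y \<oplus>\<^bsub>?W\<^esub> z) i" by (auto simp: ze_def s)
      then show ?thesis using yz by (auto simp: Z_def)
    qed
    show "r \<odot>\<^bsub>?S\<^esub> z \<in> Z" if rz: "r \<in> carrier R" "z \<in> Z" for r z
    proof -
      obtain i where i: "ze z i" using rz unfolding Z_def by blast
      then have "ze (r \<odot>\<^bsub>?W\<^esub> z) i" using rz by (auto simp: ze_def s C.smult_zero)
      then show ?thesis using rz W.smult_closed by (auto simp: Z_def)
    qed
  qed
  obtain g :: "('i \<Rightarrow> 'p) \<Rightarrow> 'i \<Rightarrow> 'p" where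
    g: "\<forall>x\<in>carrier ?S. \<forall>y\<in>carrier ?S. g x = g y \<longleftrightarrow> x \<ominus>\<^bsub>?S\<^esub> y \<in> Z"
    using quotient_map_exists[OF Sl Zs] by blast
  define T where "T = push_module ?S g"
  note T = push_module[OF Sl Zs g, folded T_def]
  have proj: "(\<lambda>z. z i) \<in> mod_hom R ?S C" if "i \<in> L" for i
    by (rule mod_homI) (use that in \<open>auto simp: S_def s\<close>)
  have g_eq: "g y = g z" if yz: "y \<in> S" "z \<in> S" "i \<in> L" "\<And>k. k \<in> L \<Longrightarrow> rl i k \<Longrightarrow> y k = z k" for y z i
  proof -
    have "ze (y \<ominus>\<^bsub>?S\<^esub> z) i"
      unfolding ze_def
    proof (intro conjI ballI impI yz(3))
      fix k assume k: "k \<in> L" "rl i k"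
      have "z k \<in> carrier C" using yz k by (auto simp: S_def s)
      then show "(y \<ominus>\<^bsub>?S\<^esub> z) k = \<zero>\<^bsub>C\<^esub>"
        using mod_hom_minus(3)[OF Sl Pl proj[OF k(1)], of y z] yz(1,2) yz(4)[OF k]
        by (simp add: a_minus_def C.r_neg)
    qed
    moreover have "y \<ominus>\<^bsub>?S\<^esub> z \<in> S" using S.minus_closed yz by simp
    ultimately have "y \<ominus>\<^bsub>?S\<^esub> z \<in> Z" by (auto simp: Z_def S_def)
    then show ?thesis using g yz by simp
  qed
  \<comment> \<open>The family that \<open>x\<close> at stage \<open>i\<close> generates. Entries
    not above \<open>i\<close> are invisible modulo \<open>Z\<close>; zero keeps them in the
    carrier.\<close>
  define th where "th i x k = (if k \<in> L \<and> rl i k then f i k x else \<zero>\<^bsub>C\<^esub>)" for i x k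
  have thS: "th i x \<in> S" if "i \<in> L" "x \<in> carrier C" for i x
  proof -
    have "co (th i x) i"
      using that by (auto simp: co_def th_def rfl fid)
    moreover have "th i x \<in> carrier ?W" using that fc by (auto simp: s th_def)
    ultimately show ?thesis by (auto simp: S_def)
  qed
  define j where "j i x = g (th i x)" for i x
  have th_hom: "th i \<in> mod_hom R C ?S" if i: "i \<in> L" for i
  proof (rule mod_homI)
    show "th i x \<in> carrier ?S" if "x \<in> carrier C" for x using thS[OF i that] by simp
    show "th i (x \<oplus>\<^bsub>C\<^esub> y) = th i x \<oplus>\<^bsub>?S\<^esub> th i y" if "x \<in> carrier C" "y \<in> carrier C" for x y
      using mod_homD(2)[OF fh[OF i]] that by (auto simp: th_def s fun_eq_iff)
    show "th i (r \<odot>\<^bsub>C\<^esub> x) = r \<odot>\<^bsub>?S\<^esub> th i x" if "r \<in> carrier R" "x \<in> carrier C" for r x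
      using mod_homD(3)[OF fh[OF i]] that by (auto simp: th_def s fun_eq_iff C.smult_zero)
  qed
  have jh: "j i \<in> mod_hom R C T" if "i \<in> L" for i
    using mod_hom_comp[OF th_hom[OF that] T(2)] unfolding j_def .
  have jf: "j k (f i k x) = j i x" if "i \<in> L" "k \<in> L" "rl i k" "x \<in> carrier C" for i k x
    unfolding j_def
    by (rule g_eq[of _ _ k]) (use that thS fc ff trn[of i k] in \<open>auto simp: th_def\<close>)
  have surj: "\<exists>i\<in>L. \<exists>x\<in>carrier C. j i x = y" if y: "y \<in> carrier T" for y
  proof -
    obtain z where z: "z \<in> S" "y = g z" using y T(3) by auto
    then obtain i where i: "co z i" by (auto simp: S_def)
    then have "i \<in> L" "z i \<in> carrier C" using z(1) by (auto simp: co_def S_def s)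
    moreover have "j i (z i) = g z"
      unfolding j_def
      by (rule g_eq[of _ _ i]) (use thS calculation z i in \<open>auto simp: th_def co_def\<close>)
    ultimately show ?thesis using z(2) by blast
  qed
  have kill: "\<exists>k\<in>L. rl i k \<and> f i k x = \<zero>\<^bsub>C\<^esub>" if "i \<in> L" "x \<in> carrier C" "j i x = \<zero>\<^bsub>T\<^esub>" for i x
  proof -
    have "th i x \<in> Z" using T(4)[of "th i x"] thS that by (simp add: j_def)
    then obtain l where l: "ze (th i x) l" by (auto simp: Z_def)
    then obtain k where k: "k \<in> L" "rl i k" "rl l k" using dir[of i l] \<open>i \<in> L\<close> by (auto simp: ze_def)
    then have "th i x k = \<zero>\<^bsub>C\<^esub>" using l by (simp add: ze_def)
    then show ?thesis using k by (auto simp: th_def)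
  qed
  have exT: "exact_module T"
  proof (rule exact_directed_colimit[where N = "\<lambda>_. C" and L = L and rl = rl and j = j and f = f])
    show "exact_module C" by (rule C)
    show "left_module R T" by (rule T(1))
    show "L \<noteq> {}" by (rule L)
    show "j i \<in> mod_hom R C T" if "i \<in> L" for i using that by (rule jh)
    show "\<exists>l\<in>L. rl i l \<and> rl k l" if "i \<in> L" "k \<in> L" for i k using that by (rule dir)
    show "f i k \<in> mod_hom R C C" if "i \<in> L" "k \<in> L" "rl i k" for i k using that by (rule fh)
    show "j k (f i k x) = j i x" if "i \<in> L" "k \<in> L" "rl i k" "x \<in> carrier C" for i k x using that by (rule jf)
    show "rl i l" if "i \<in> L" "k \<in> L" "l \<in> L" "rl i k" "rl k l" for i k l using that by (rule trn)
    show "f k l (f i k x) = f i l x" if "i \<in> L" "k \<in> L" "l \<in> L" "rl i k" "rl k l" "x \<in> carrier C" for i k l x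
      using that by (rule ff)
    show "\<exists>i\<in>L. \<exists>y\<in>carrier C. j i y = x" if "x \<in> carrier T" for x using that by (rule surj)
    show "\<exists>k\<in>L. rl i k \<and> f i k x = \<zero>\<^bsub>C\<^esub>" if "i \<in> L" "x \<in> carrier C" "j i x = \<zero>\<^bsub>T\<^esub>" for i x
      using that by (rule kill)
  qed
  \<comment> \<open>Transition maps commute with \<phi>, so \<phi> is constant along the compatible
    part of a family. This eventual value, unique by directedness, defines the map to
    \<open>M\<close>.\<close>
  define ev where "ev z m \<longleftrightarrow> (\<exists>i\<in>L. \<forall>k\<in>L. rl i k \<longrightarrow> \<phi> (z k) = m)" for z m
  have evS: "ev z (\<phi> (z i))" if "co z i" "z \<in> S" for z i
    unfolding ev_def by (rule bexI[of _ i]) (use that f\<phi>[of i _ "z i"] in \<open>auto simp: co_def S_def s\<close>)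
  have evu: "m = m'" if mm: "ev z m" "ev z m'" for z m m'
  proof -
    obtain i k where "i \<in> L" "k \<in> L" "\<And>l. l \<in> L \<Longrightarrow> rl i l \<Longrightarrow> \<phi> (z l) = m" "\<And>l. l \<in> L \<Longrightarrow> rl k l \<Longrightarrow> \<phi> (z l) = m'"
      using mm unfolding ev_def by blast
    moreover obtain l where "l \<in> L" "rl i l" "rl k l" using dir[of i k] calculation(1,2) by blast
    ultimately show ?thesis by metis
  qed
  define \<sigma> where "\<sigma> z = (THE m. ev z m)" for z
  have \<sigma>ev: "\<sigma> z = m" if "ev z m" for z m
    unfolding \<sigma>_def by (rule the_equality) (use that evu in auto)
  have \<sigma>: "\<sigma> z = \<phi> (z i)" if "co z i" "z \<in> S" for z i
    by (rule \<sigma>ev[OF evS[OF that]])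
  have zP: "z i \<in> carrier C" if "co z i" "z \<in> S" for z i
    using that by (auto simp: co_def S_def s)
  have "\<sigma> \<in> mod_hom R ?S M"
  proof (rule mod_homI)
    show "\<sigma> z \<in> carrier M" if z: "z \<in> carrier ?S" for z
    proof -
      obtain i where "co z i" using z by (auto simp: S_def)
      then show ?thesis using \<sigma> zP z mod_homD(1)[OF \<phi>] by simp
    qed
    show "\<sigma> (y \<oplus>\<^bsub>?S\<^esub> z) = \<sigma> y \<oplus>\<^bsub>M\<^esub> \<sigma> z" if yz: "y \<in> carrier ?S" "z \<in> carrier ?S" for y z
    proof -
      obtain i where i: "co y i" "co z i" using co2 yz by auto
      obtain l where l: "co (y \<oplus>\<^bsub>?S\<^esub> z) l" "co y l" "co z l"
      proof -
        have S3: "y \<oplus>\<^bsub>?S\<^esub> z \<in> S" using S.a_closed[OF yz] by simp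
        then obtain k where k: "co (y \<oplus>\<^bsub>?S\<^esub> z) k" by (auto simp: S_def)
        obtain l where l: "l \<in> L" "rl i l" "rl k l" using dir[of i k] i k by (auto simp: co_def)
        show thesis
          by (rule that[of l]) (use co_mono[OF k l(1,3)] co_mono[OF i(1) l(1,2)] co_mono[OF i(2) l(1,2)] yz S3 in \<open>auto simp: S_def\<close>)
      qed
      have "y \<oplus>\<^bsub>?S\<^esub> z \<in> S" using S.a_closed[OF yz] by simp
      then have "\<sigma> (y \<oplus>\<^bsub>?S\<^esub> z) = \<phi> ((y \<oplus>\<^bsub>?S\<^esub> z) l)" by (rule \<sigma>[OF l(1)])
      also have "\<dots> = \<phi> (y l) \<oplus>\<^bsub>M\<^esub> \<phi> (z l)"
        using l yz mod_homD(2)[OF \<phi>] zP by (simp add: s co_def)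
      finally show ?thesis using \<sigma> l yz by simp
    qed
    show "\<sigma> (r \<odot>\<^bsub>?S\<^esub> z) = r \<odot>\<^bsub>M\<^esub> \<sigma> z" if rz: "r \<in> carrier R" "z \<in> carrier ?S" for r z
    proof -
      obtain i where i: "co z i" using rz by (auto simp: S_def)
      have "r \<odot>\<^bsub>?S\<^esub> z \<in> S" using S.smult_closed[OF rz] by simp
      have "ev (r \<odot>\<^bsub>?S\<^esub> z) (r \<odot>\<^bsub>M\<^esub> \<phi> (z i))"
        unfolding ev_def
      proof (intro bexI[of _ i] ballI impI)
        show "i \<in> L" using i by (simp add: co_def)
        fix k assume k: "k \<in> L" "rl i k"
        have "z i \<in> carrier C" using zP i rz by simp
        then show "\<phi> ((r \<odot>\<^bsub>?S\<^esub> z) k) = r \<odot>\<^bsub>M\<^esub> \<phi> (z i)"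
          using i k mod_homD(3)[OF \<phi> rz(1)] fc[OF \<open>i \<in> L\<close> k] f\<phi>[OF \<open>i \<in> L\<close> k] by (simp add: s co_def)
      qed
      then show ?thesis using \<sigma>ev \<sigma>[OF i] rz by simp
    qed
  qed
  moreover have "\<sigma> z = \<zero>\<^bsub>M\<^esub>" if "z \<in> carrier ?S" "g z = \<zero>\<^bsub>T\<^esub>" for z
  proof (rule \<sigma>ev)
    have "z \<in> Z" using T(4) that by simp
    then obtain i where "ze z i" by (auto simp: Z_def)
    then show "ev z \<zero>\<^bsub>M\<^esub>" using mod_hom_minus(1)[OF Pl M \<phi>] unfolding ev_def ze_def by metis
  qed
  ultimately obtain \<tau> where \<tau>: "\<tau> \<in> mod_hom R T M" "\<And>z. z \<in> carrier ?S \<Longrightarrow> \<tau> (g z) = \<sigma> z"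
    using mod_hom_factor[OF Sl T(1) M T(2) T(3)[symmetric], of \<sigma>] by metis
  have "\<tau> (j i x) = \<phi> x" if "i \<in> L" "x \<in> carrier C" for i x
  proof -
    have "ev (th i x) (\<phi> x)"
      unfolding ev_def by (rule bexI[of _ i]) (use that f\<phi> in \<open>auto simp: th_def\<close>)
    then show ?thesis using \<tau>(2) thS[OF that] \<sigma>ev by (simp add: j_def)
  qed
  then show thesis using that[OF exT \<tau>(1) jh _ jf surj] by blast
qed

end

section \<open>Covers\<close>

context mat_complex
begin

lemma end_overD:
  assumes "g \<in> end_over C \<phi>"
  shows "g \<in> mod_hom R C C" "\<And>x. x \<in> carrier C \<Longrightarrow> \<phi> (g x) = \<phi> x" "\<And>x. x \<in> carrier C \<Longrightarrow> g x \<in> carrier C"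
  using assms mod_homD(1) by (auto simp: end_over_def)

lemma end_over_id: "(\<lambda>x. x) \<in> end_over C \<phi>"
  by (simp add: end_over_def mod_hom_id)

lemma end_over_comp: "g \<in> end_over C \<phi> \<Longrightarrow> h \<in> end_over C \<phi> \<Longrightarrow> (\<lambda>x. g (h x)) \<in> end_over C \<phi>"
  using mod_hom_comp[of h R C C g C] mod_homD(1)[of h R C C] by (simp add: end_over_def)

text \<open>A system is a set of triples \<open>(i, k, f)\<close> that says that \<open>f\<close> is the transition map from \<open>i\<close> to
  \<open>k\<close>; all objects are copies of \<open>C\<close>, and \<open>b\<close> is the first index.\<close>

definition end_system ::
  "('r, 'p) module \<Rightarrow> ('p \<Rightarrow> 'm) \<Rightarrow> (('p \<Rightarrow> 'p) \<Rightarrow> ('p \<Rightarrow> 'p) \<Rightarrow> bool) \<Rightarrow> 'i \<Rightarrow> ('i \<times> 'i \<times> ('p \<Rightarrow> 'p)) set \<Rightarrow> bool" where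
  "end_system C \<phi> S b A \<longleftrightarrow>
     (\<forall>i k f. (i, k, f) \<in> A \<longrightarrow> f \<in> end_over C \<phi> \<and> (i, i, \<lambda>x. x) \<in> A \<and> (k, k, \<lambda>x. x) \<in> A) \<and>
     (\<forall>i k f f'. (i, k, f) \<in> A \<longrightarrow> (i, k, f') \<in> A \<longrightarrow> f = f') \<and>
     (\<forall>i k l f g. (i, k, f) \<in> A \<longrightarrow> (k, l, g) \<in> A \<longrightarrow> (\<exists>h. (i, l, h) \<in> A \<and> (\<forall>x\<in>carrier C. h x = g (f x)))) \<and>
     (\<forall>i k. (i, i, \<lambda>x. x) \<in> A \<longrightarrow> (k, k, \<lambda>x. x) \<in> A \<longrightarrow> (\<exists>f. (i, k, f) \<in> A \<or> (k, i, f) \<in> A)) \<and>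
     (b, b, \<lambda>x. x) \<in> A \<and> (\<forall>i. (i, i, \<lambda>x. x) \<in> A \<longrightarrow> (\<exists>f. (b, i, f) \<in> A)) \<and>
     (\<forall>i k f h. (i, k, f) \<in> A \<longrightarrow> i \<noteq> k \<longrightarrow> (b, i, h) \<in> A \<longrightarrow> S h f)"

lemma end_systemD:
  assumes "end_system C \<phi> S b A"
  shows "(i, k, f) \<in> A \<Longrightarrow> f \<in> end_over C \<phi>"
    and "(i, k, f) \<in> A \<Longrightarrow> (i, i, \<lambda>x. x) \<in> A" and "(i, k, f) \<in> A \<Longrightarrow> (k, k, \<lambda>x. x) \<in> A"
    and "(i, k, f) \<in> A \<Longrightarrow> (i, k, f') \<in> A \<Longrightarrow> f = f'"
    and "(i, k, f) \<in> A \<Longrightarrow> (k, l, g) \<in> A \<Longrightarrow> \<exists>h. (i, l, h) \<in> A \<and> (\<forall>x\<in>carrier C. h x = g (f x))"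
    and "(i, i, \<lambda>x. x) \<in> A \<Longrightarrow> (k, k, \<lambda>x. x) \<in> A \<Longrightarrow> \<exists>f. (i, k, f) \<in> A \<or> (k, i, f) \<in> A"
    and "(b, b, \<lambda>x. x) \<in> A" and "(i, i, \<lambda>x. x) \<in> A \<Longrightarrow> \<exists>f. (b, i, f) \<in> A"
    and "(i, k, f) \<in> A \<Longrightarrow> i \<noteq> k \<Longrightarrow> (b, i, h) \<in> A \<Longrightarrow> S h f"
proof -
  note a1 = assms[unfolded end_system_def, THEN conjunct1]
  note b1 = assms[unfolded end_system_def, THEN conjunct2]
  note a2 = b1[THEN conjunct1] and b2 = b1[THEN conjunct2]
  note a3 = b2[THEN conjunct1] and b3 = b2[THEN conjunct2]
  note a4 = b3[THEN conjunct1] and b4 = b3[THEN conjunct2]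
  note a5 = b4[THEN conjunct1] and b5 = b4[THEN conjunct2]
  note a6 = b5[THEN conjunct1] and a7 = b5[THEN conjunct2]
  show "(i, k, f) \<in> A \<Longrightarrow> f \<in> end_over C \<phi>" and "(i, k, f) \<in> A \<Longrightarrow> (i, i, \<lambda>x. x) \<in> A"
    and "(i, k, f) \<in> A \<Longrightarrow> (k, k, \<lambda>x. x) \<in> A"
    using a1 by simp_all
  show "(i, k, f) \<in> A \<Longrightarrow> (i, k, f') \<in> A \<Longrightarrow> f = f'" using a2 by simp
  show "(i, k, f) \<in> A \<Longrightarrow> (k, l, g) \<in> A \<Longrightarrow> \<exists>h. (i, l, h) \<in> A \<and> (\<forall>x\<in>carrier C. h x = g (f x))"
    using a3 by simp
  show "(i, i, \<lambda>x. x) \<in> A \<Longrightarrow> (k, k, \<lambda>x. x) \<in> A \<Longrightarrow> \<exists>f. (i, k, f) \<in> A \<or> (k, i, f) \<in> A"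
    using a4 by simp
  show "(b, b, \<lambda>x. x) \<in> A" by (rule a5)
  show "(i, i, \<lambda>x. x) \<in> A \<Longrightarrow> \<exists>f. (b, i, f) \<in> A" using a6 by simp
  show "(i, k, f) \<in> A \<Longrightarrow> i \<noteq> k \<Longrightarrow> (b, i, h) \<in> A \<Longrightarrow> S h f" using a7 by simp
qed

text \<open>Every clause of \<open>end_system\<close> speaks of at most two given triples, and two
  triples of the union lie in a common member of the chain.\<close>

lemma end_system_Union:
  assumes C: "\<C> \<noteq> {}" "subset.chain {A. end_system C \<phi> S b A} \<C>"
  shows "end_system C \<phi> S b (\<Union>\<C>)"
proof -
  have sys: "end_system C \<phi> S b A" if "A \<in> \<C>" for A using C(2) that by (auto simp: subset.chain_def)
  note d = end_systemD[OF sys]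
  have two: "\<exists>A\<in>\<C>. x \<in> A \<and> y \<in> A" if "x \<in> \<Union>\<C>" "y \<in> \<Union>\<C>" for x y
    using that C(2) unfolding subset.chain_def by blast
  show ?thesis
    unfolding end_system_def
  proof (intro conjI allI impI)
    fix i k f assume "(i, k, f) \<in> \<Union>\<C>"
    then obtain A where A: "A \<in> \<C>" "(i, k, f) \<in> A" by blast
    show "f \<in> end_over C \<phi>" using d(1)[OF A] .
    show "(i, i, \<lambda>x. x) \<in> \<Union>\<C>" using d(2)[OF A] A(1) by blast
    show "(k, k, \<lambda>x. x) \<in> \<Union>\<C>" using d(3)[OF A] A(1) by blast
  next
    fix i k f f' assume "(i, k, f) \<in> \<Union>\<C>" "(i, k, f') \<in> \<Union>\<C>"
    from two[OF this] obtain A where A: "A \<in> \<C>" "(i, k, f) \<in> A" "(i, k, f') \<in> A" by blast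
    show "f = f'" using d(4)[OF A] .
  next
    fix i k l f g assume "(i, k, f) \<in> \<Union>\<C>" "(k, l, g) \<in> \<Union>\<C>"
    from two[OF this] obtain A where A: "A \<in> \<C>" "(i, k, f) \<in> A" "(k, l, g) \<in> A" by blast
    show "\<exists>h. (i, l, h) \<in> \<Union>\<C> \<and> (\<forall>x\<in>carrier C. h x = g (f x))"
      using d(5)[OF A] A(1) by blast
  next
    fix i k assume "(i, i, \<lambda>x. x) \<in> \<Union>\<C>" "(k, k, \<lambda>x. x) \<in> \<Union>\<C>"
    from two[OF this] obtain A where A: "A \<in> \<C>" "(i, i, \<lambda>x. x) \<in> A" "(k, k, \<lambda>x. x) \<in> A" by blast
    show "\<exists>f. (i, k, f) \<in> \<Union>\<C> \<or> (k, i, f) \<in> \<Union>\<C>" using d(6)[OF A] A(1) by blast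
  next
    show "(b, b, \<lambda>x. x) \<in> \<Union>\<C>" using d(7) C(1) by blast
  next
    fix i assume "(i, i, \<lambda>x. x) \<in> \<Union>\<C>"
    then obtain A where A: "A \<in> \<C>" "(i, i, \<lambda>x. x) \<in> A" by blast
    show "\<exists>f. (b, i, f) \<in> \<Union>\<C>" using d(8)[OF A] A(1) by blast
  next
    fix i k f h assume "(i, k, f) \<in> \<Union>\<C>" "i \<noteq> k" and h: "(b, i, h) \<in> \<Union>\<C>"
    from two[OF this(1) h] obtain A where A: "A \<in> \<C>" "(i, k, f) \<in> A" "(b, i, h) \<in> A" by blast
    show "S h f" by (rule d(9)[OF A(1,2) \<open>i \<noteq> k\<close> A(3)])
  qed
qed

text \<open>A maximal system has fewer indices than there are labels, because \<open>V\<close> separates the indices.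
  Composing the maps into the colimit with a map back to \<open>C\<close> and one more strict step then extends
  the system.\<close>

lemma no_unbounded_chain:
  fixes C :: "('r, 'p) module" and M :: "('r, 'm) module"
    and V :: "('p \<Rightarrow> 'p) \<Rightarrow> ('p \<Rightarrow> 'p) \<Rightarrow> 'p set"
  assumes C: "exact_module C" and M: "left_module R M" and \<phi>: "\<phi> \<in> mod_hom R C M"
    and weak: "\<And>(T :: ('r, 'p set set \<Rightarrow> 'p) module) \<tau>. exact_module T \<Longrightarrow> \<tau> \<in> mod_hom R T M \<Longrightarrow>
      \<exists>h\<in>mod_hom R T C. \<forall>x\<in>carrier T. \<phi> (h x) = \<tau> x"
    and step: "\<And>h. h \<in> end_over C \<phi> \<Longrightarrow> \<exists>g\<in>end_over C \<phi>. S h g"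
    and shift: "\<And>h0 h r g. \<lbrakk>h0 \<in> end_over C \<phi>; h \<in> end_over C \<phi>; r \<in> end_over C \<phi>; g \<in> end_over C \<phi>;
      \<forall>x\<in>carrier C. h0 x = r (h x); S h0 g\<rbrakk> \<Longrightarrow> S h (\<lambda>x. g (r x))"
    and sep: "\<And>h g r h' r'. \<lbrakk>h \<in> end_over C \<phi>; g \<in> end_over C \<phi>; r \<in> end_over C \<phi>; h' \<in> end_over C \<phi>;
      r' \<in> end_over C \<phi>; S h g; \<forall>x\<in>carrier C. h' x = g (h x); \<forall>x\<in>carrier C. r x = r' (g x)\<rbrakk> \<Longrightarrow> V h r \<noteq> V h' r'"
  shows False
proof -
  let ?E = "end_over C \<phi>"
  \<comment> \<open>An arbitrary label for the first index.\<close>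
  let ?b = "{} :: 'p set set"
  let ?sys = "end_system C \<phi> S ?b"
  have "\<exists>A\<in>{A. ?sys A}. \<forall>X\<in>{A. ?sys A}. A \<subseteq> X \<longrightarrow> X = A"
  proof (rule subset_Zorn_nonempty)
    have "?sys {(?b, ?b, \<lambda>x. x)}" by (simp add: end_system_def end_over_id)
    then show "{A. ?sys A} \<noteq> {}" by blast
    show "\<Union>\<C> \<in> {A. ?sys A}" if "\<C> \<noteq> {}" "subset.chain {A. ?sys A} \<C>" for \<C>
      using end_system_Union[OF that] by simp
  qed
  then obtain A where A: "?sys A" and max: "\<And>X. ?sys X \<Longrightarrow> A \<subseteq> X \<Longrightarrow> X = A" by blast
  note d = end_systemD[OF A]
  define L where "L = {i. (i, i, \<lambda>x. x) \<in> A}"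
  define rl where "rl i k \<longleftrightarrow> (\<exists>f. (i, k, f) \<in> A)" for i k
  define f where "f i k = (THE f. (i, k, f) \<in> A)" for i k
  have f_eq: "f i k = g" if "(i, k, g) \<in> A" for i k g
    unfolding f_def using that d(4)[OF _ that] by (intro the_equality)
  have fA: "(i, k, f i k) \<in> A" if "rl i k" for i k
    using that f_eq unfolding rl_def by metis
  have AL: "i \<in> L" "k \<in> L" "rl i k" if "(i, k, g) \<in> A" for i k g
    using d(2,3)[OF that] that by (auto simp: L_def rl_def)
  have bL: "?b \<in> L" using d(7) by (simp add: L_def)
  have bi: "rl ?b i" if "i \<in> L" for i using d(8)[of i] that by (auto simp: L_def rl_def)
  have lin: "rl i k \<or> rl k i" if "i \<in> L" "k \<in> L" for i k
    using d(6)[of i k] that by (auto simp: L_def rl_def)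
  have rfl: "rl i i" if "i \<in> L" for i using that by (auto simp: L_def rl_def)
  have trn: "rl i l" if "rl i k" "rl k l" for i k l using d(5) that unfolding rl_def by blast
  have ff: "f k l (f i k x) = f i l x" if rl: "rl i k" "rl k l" and x: "x \<in> carrier C" for i k l x
  proof -
    obtain h where "(i, l, h) \<in> A" "\<forall>x\<in>carrier C. h x = f k l (f i k x)"
      using d(5)[OF fA[OF rl(1)] fA[OF rl(2)]] by blast
    then show ?thesis using f_eq x by simp
  qed
  have fE: "f i k \<in> ?E" if "rl i k" for i k using d(1)[OF fA[OF that]] .
  obtain T :: "('r, 'p set set \<Rightarrow> 'p) module" and \<tau> j where T: "exact_module T" "\<tau> \<in> mod_hom R T M"
    and j: "\<And>i. i \<in> L \<Longrightarrow> j i \<in> mod_hom R C T"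
    and \<tau>j: "\<And>i x. i \<in> L \<Longrightarrow> x \<in> carrier C \<Longrightarrow> \<tau> (j i x) = \<phi> x"
    and jf: "\<And>i k x. i \<in> L \<Longrightarrow> k \<in> L \<Longrightarrow> rl i k \<Longrightarrow> x \<in> carrier C \<Longrightarrow> j k (f i k x) = j i x"
  proof (rule colimit_exists[OF C M \<phi>, of L rl f])
    show "L \<noteq> {}" using d(7) by (auto simp: L_def)
    show "\<exists>l\<in>L. rl i l \<and> rl k l" if "i \<in> L" "k \<in> L" for i k using lin[OF that] rfl that by blast
    show "f i i x = x" if "i \<in> L" for i x using f_eq[of i i "\<lambda>x. x"] that by (simp add: L_def)
    show "rl i l" if "rl i k" "rl k l" for i k l using that by (rule trn)
    show "f k l (f i k x) = f i l x" if "rl i k" "rl k l" "x \<in> carrier C" for i k l x using that by (rule ff)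
    show "rl i i" if "i \<in> L" for i using that by (rule rfl)
    show "f i k \<in> ?E" if "rl i k" for i k using that by (rule fE)
  qed (rule that)
  obtain r where r: "r \<in> mod_hom R T C" "\<And>x. x \<in> carrier T \<Longrightarrow> \<phi> (r x) = \<tau> x"
    using weak[OF T] by metis
  \<comment> \<open>Through the colimit and back to \<open>C\<close>: these are endomorphisms over
    \<open>M\<close> that absorb the transition maps, by \<open>pf\<close>.\<close>
  define p where "p i = (\<lambda>x. r (j i x))" for i
  have pE: "p i \<in> ?E" if i: "i \<in> L" for i
    using mod_hom_comp[OF j[OF i] r(1)] mod_homD(1)[OF j[OF i]] \<tau>j[OF i] r(2)
    by (simp add: end_over_def p_def)
  have pf: "p k (f i k x) = p i x" if "rl i k" "x \<in> carrier C" for i k x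
    using jf AL fA[OF that(1)] that by (simp add: p_def)
  \<comment> \<open>\<open>S h f\<close> says that \<open>f\<close> is strict after
    \<open>h\<close>, where \<open>h\<close> leads from the first index to the source of
    \<open>f\<close>. The invariant of a stage therefore uses both its map from the first index and
    its map into the colimit.\<close>
  define v where "v i = V (f ?b i) (p i)" for i
  have vneq: "v i \<noteq> v k" if "rl i k" "i \<noteq> k" for i k
  proof -
    note ik = AL[OF fA[OF that(1)]]
    have "S (f ?b i) (f i k)"
      by (rule d(9)[OF fA[OF that(1)] that(2) fA[OF bi[OF ik(1)]]])
    then show ?thesis
      unfolding v_def
      using sep[of "f ?b i" "f i k" "p i" "f ?b k" "p k"] fE bi ik pE ff[OF bi[OF ik(1)] that(1)] pf[OF that(1)] by simp
  qed
  have "inj_on v L"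
    unfolding inj_on_def using vneq lin by metis
  have "L \<noteq> UNIV"
  proof
    \<comment> \<open>Otherwise \<open>v\<close> would embed the double powerset of
      \<open>'p\<close> into the powerset.\<close>
    assume "L = UNIV"
    then have "range (inv_into UNIV v) = Pow UNIV"
      using inj_imp_surj_inv[of v] \<open>inj_on v L\<close> by simp
    then show False using Cantors_theorem[of "UNIV :: 'p set set"] by blast
  qed
  then obtain c where c: "c \<notin> L" by blast
  \<comment> \<open>The step is chosen strict after the whole path from the first index through the
    colimit back to \<open>C\<close>. Stage \<open>i\<close> is joined to the new last stage
    \<open>c\<close> by \<open>g\<close> after \<open>p i\<close>.\<close>
  obtain g where g: "g \<in> ?E" "S (p ?b) g" using step[OF pE[OF bL]] by blast
  let ?q = "\<lambda>i x. g (p i x)"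
  let ?A = "A \<union> {(i, c, ?q i) | i. i \<in> L} \<union> {(c, c, \<lambda>x. x)}"
  have cA: "(i, c, h) \<notin> A" "(c, i, h) \<notin> A" for i h using AL c by blast+
  have "?sys ?A"
    unfolding end_system_def
  proof (intro conjI allI impI)
    fix i k h assume ikh: "(i, k, h) \<in> ?A"
    from ikh consider "(i, k, h) \<in> A" | "i \<in> L" "h = ?q i" | "h = (\<lambda>x. x)" by blast
    then show "h \<in> ?E"
    proof cases
      case 1
      then show ?thesis by (rule d(1))
    next
      case 2
      show ?thesis unfolding 2(2) by (rule end_over_comp[OF g(1) pE[OF 2(1)]])
    next
      case 3
      show ?thesis unfolding 3 by (rule end_over_id)
    qed
    show "(i, i, \<lambda>x. x) \<in> ?A" using ikh d(2) by (auto simp: L_def)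
    show "(k, k, \<lambda>x. x) \<in> ?A" using ikh d(3) by auto
  next
    show "h = h'" if "(i, k, h) \<in> ?A" "(i, k, h') \<in> ?A" for i k h h'
      using that d(4) cA c by auto
  next
    fix i k l h h' assume h: "(i, k, h) \<in> ?A" and h': "(k, l, h') \<in> ?A"
    show "\<exists>u. (i, l, u) \<in> ?A \<and> (\<forall>x\<in>carrier C. u x = h' (h x))"
    proof (cases "l = c")
      case False
      then have klA: "(k, l, h') \<in> A" using h' by auto
      then have "k \<noteq> c" using AL(1) c by blast
      then have ikA: "(i, k, h) \<in> A" using h by blast
      obtain u where "(i, l, u) \<in> A" "\<forall>x\<in>carrier C. u x = h' (h x)" using d(5)[OF ikA klA] by blast
      then show ?thesis by (intro exI[of _ u]) simp
    next
      case l: True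
      show ?thesis
      proof (cases "k = c")
        case True
        then have "h' = (\<lambda>x. x)" using h' l cA c by auto
        then show ?thesis using h l True by blast
      next
        case False
        then have k: "k \<in> L" "h' = ?q k" "(i, k, h) \<in> A" using h h' l cA by auto
        then have "i \<in> L" "rl i k" "f i k = h" using AL f_eq by blast+
        then show ?thesis using l pf[of i k] k(2) by (intro exI[of _ "?q i"]) auto
      qed
    qed
  next
    fix i k assume "(i, i, \<lambda>x. x) \<in> ?A" "(k, k, \<lambda>x. x) \<in> ?A"
    then have "i \<in> insert c L" "k \<in> insert c L" by (auto simp: L_def)
    then show "\<exists>f. (i, k, f) \<in> ?A \<or> (k, i, f) \<in> ?A"
      using lin[of i k] by (auto simp: rl_def)
  next
    show "(?b, ?b, \<lambda>x. x) \<in> ?A" using d(7) by blast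
  next
    fix i assume "(i, i, \<lambda>x. x) \<in> ?A"
    then have "i \<in> insert c L" by (auto simp: L_def)
    then show "\<exists>f. (?b, i, f) \<in> ?A" using bi[of i] bL by (auto simp: rl_def)
  next
    fix i k h u assume h: "(i, k, h) \<in> ?A" "i \<noteq> k" and u: "(?b, i, u) \<in> ?A"
    have iL: "i \<in> L" using h AL by auto
    then have uA: "(?b, i, u) \<in> A" using u c by auto
    show "S u h"
    proof (cases "k = c")
      case True
      then have "h = ?q i" using h cA by auto
      have "f ?b i = u" using f_eq[OF uA] .
      \<comment> \<open>\<open>p ?b\<close> factors as \<open>p i\<close> after \<open>u\<close>,
        and \<open>shift\<close> moves the strictness of \<open>g\<close> after \<open>p ?b\<close>
        to strictness of the composite \<open>g\<close> after \<open>p i\<close> with respect to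
        \<open>u\<close>.\<close>
      then have "\<forall>x\<in>carrier C. p ?b x = p i (u x)" using pf[OF bi[OF iL]] by auto
      then show ?thesis
        unfolding \<open>h = ?q i\<close> by (intro shift[OF pE[OF AL(1)[OF uA]] d(1)[OF uA] pE[OF iL] g(1) _ g(2)])
    next
      case False
      then have "(i, k, h) \<in> A" using h iL c by auto
      then show ?thesis using d(9) h(2) uA by blast
    qed
  qed
  then have "?A = A" using max by blast
  then show False using cA(1)[of c] by blast
qed

text \<open>The colimit \<open>T\<close> has only automorphisms over \<open>M\<close> but sits in a
  large type. Maps over \<open>M\<close> in both directions between \<open>T\<close> and its
  reduction \<open>C\<close> carry this property to \<open>C\<close>.\<close>

lemma cover_exists:
  fixes M :: "('r, 'm) module" and e :: "('r, 'b, 'm) big_tree \<Rightarrow> 'u"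
  assumes M: "left_module R M" and e: "inj e"
  obtains C :: "('r, 'u) module" and \<phi> h where
    "exact_module C" "\<phi> \<in> mod_hom R C M"
    "h \<in> mod_hom R (sum_over M :: ('r, ('r, 'u) module \<times> ('u \<Rightarrow> 'm) \<Rightarrow> 'u) module) C"
    "\<And>x. x \<in> carrier (sum_over M) \<Longrightarrow> \<phi> (h x) = map_over M x"
    "\<And>g. g \<in> end_over C \<phi> \<Longrightarrow> bij_betw g (carrier C) (carrier C)"
proof -
  define P0 :: "('r, ('r, 'u) module \<times> ('u \<Rightarrow> 'm) \<Rightarrow> 'u) module" where "P0 = sum_over M"
  define \<phi>0 :: "(('r, 'u) module \<times> ('u \<Rightarrow> 'm) \<Rightarrow> 'u) \<Rightarrow> 'm" where "\<phi>0 = map_over M"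
  have P0: "exact_module P0" unfolding P0_def by (rule exact_sum_over)
  have \<phi>0: "\<phi>0 \<in> mod_hom R P0 M" unfolding P0_def \<phi>0_def by (rule map_over_hom[OF M])
  note weak = map_over_weakly_terminal[OF M e, folded P0_def \<phi>0_def]
  note P0l = exact_moduleD[OF P0]
  interpret P0: left_module R P0 by (rule P0l)
  let ?E0 = "end_over P0 \<phi>0"
  have "\<exists>h\<in>?E0. \<forall>g\<in>?E0. \<forall>x\<in>carrier P0. g (h x) = \<zero>\<^bsub>P0\<^esub> \<longrightarrow> h x = \<zero>\<^bsub>P0\<^esub>"
  proof (rule ccontr)
    assume neg: "\<not> ?thesis"
    show False
    \<comment> \<open>A step is strict if it kills something that the path before it has not yet
      killed; the invariant is the kernel of that path.\<close>
    proof (rule no_unbounded_chain[OF P0 M \<phi>0, where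
          S = "\<lambda>h g. \<exists>x\<in>carrier P0. h x \<noteq> \<zero>\<^bsub>P0\<^esub> \<and> g (h x) = \<zero>\<^bsub>P0\<^esub>" and
          V = "\<lambda>h r. {x \<in> carrier P0. h x = \<zero>\<^bsub>P0\<^esub>}"])
      show "\<exists>g\<in>?E0. \<exists>x\<in>carrier P0. h x \<noteq> \<zero>\<^bsub>P0\<^esub> \<and> g (h x) = \<zero>\<^bsub>P0\<^esub>" if "h \<in> ?E0" for h
        using neg that by blast
      show "\<exists>x\<in>carrier P0. h x \<noteq> \<zero>\<^bsub>P0\<^esub> \<and> g (r (h x)) = \<zero>\<^bsub>P0\<^esub>"
        if hr: "r \<in> ?E0" "\<forall>x\<in>carrier P0. h0 x = r (h x)" "\<exists>x\<in>carrier P0. h0 x \<noteq> \<zero>\<^bsub>P0\<^esub> \<and> g (h0 x) = \<zero>\<^bsub>P0\<^esub>"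
        for h0 h r g
      proof -
        obtain x where x: "x \<in> carrier P0" "h0 x \<noteq> \<zero>\<^bsub>P0\<^esub>" "g (h0 x) = \<zero>\<^bsub>P0\<^esub>" using hr(3) by blast
        then show ?thesis
          using hr(2) mod_hom_minus(1)[OF P0l P0l end_overD(1)[OF hr(1)]] by (intro bexI[of _ x]) auto
      qed
      show "{x \<in> carrier P0. h x = \<zero>\<^bsub>P0\<^esub>} \<noteq> {x \<in> carrier P0. h' x = \<zero>\<^bsub>P0\<^esub>}"
        if hg: "\<exists>x\<in>carrier P0. h x \<noteq> \<zero>\<^bsub>P0\<^esub> \<and> g (h x) = \<zero>\<^bsub>P0\<^esub>" "\<forall>x\<in>carrier P0. h' x = g (h x)" for h g h'
        using hg by auto
    qed (rule weak)
  qed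
  then obtain h where h: "h \<in> ?E0"
    and hker: "\<And>g x. g \<in> ?E0 \<Longrightarrow> x \<in> carrier P0 \<Longrightarrow> g (h x) = \<zero>\<^bsub>P0\<^esub> \<Longrightarrow> h x = \<zero>\<^bsub>P0\<^esub>" by blast
  have hn: "(h ^^ n) \<in> ?E0" for n
  proof (induction n)
    case 0
    show ?case using end_over_id by (simp add: id_def)
  next
    case (Suc n)
    then show ?case using end_over_comp[OF h Suc] by (simp add: comp_def)
  qed
  obtain T :: "('r, nat \<Rightarrow> ('r, 'u) module \<times> ('u \<Rightarrow> 'm) \<Rightarrow> 'u) module" and \<tau> j where
    T: "exact_module T" and \<tau>: "\<tau> \<in> mod_hom R T M" and j: "\<And>i. j i \<in> mod_hom R P0 T"
    and \<tau>j: "\<And>i x. x \<in> carrier P0 \<Longrightarrow> \<tau> (j i x) = \<phi>0 x"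
    and jh: "\<And>i k x. i \<le> k \<Longrightarrow> x \<in> carrier P0 \<Longrightarrow> j k ((h ^^ (k - i)) x) = j i x"
    and jsurj: "\<And>y. y \<in> carrier T \<Longrightarrow> \<exists>i. \<exists>x\<in>carrier P0. j i x = y"
  proof (rule colimit_exists[OF P0 M \<phi>0, of "UNIV :: nat set" "(\<le>)" "\<lambda>i k. h ^^ (k - i)"])
    show "(h ^^ (l - k)) ((h ^^ (k - i)) x) = (h ^^ (l - i)) x" if "i \<le> k" "k \<le> l" for i k l x
      using that funpow_add[of "l - k" "k - i" h] by (simp add: fun_eq_iff)
    show "\<exists>l\<in>UNIV. i \<le> l \<and> k \<le> l" for i k :: nat by (rule bexI[of _ "max i k"]) auto
  qed (simp_all add: hn, rule that)
  note Tl = exact_moduleD[OF T]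
  interpret T: left_module R T by (rule Tl)
  let ?ET = "end_over T \<tau>"
  \<comment> \<open>Write \<open>y\<close> as the image of some \<open>x\<close> at stage
    \<open>i\<close>, hence of \<open>h x\<close> at the next stage. Preceded by the map of that
    stage, \<open>t\<close> becomes an endomorphism of \<open>P0\<close> that kills
    \<open>h x\<close>, so \<open>h x\<close> vanishes by the choice of \<open>h\<close>.\<close>
  have inj0: "t y = \<zero>\<^bsub>P0\<^esub> \<Longrightarrow> y = \<zero>\<^bsub>T\<^esub>"
    if t: "t \<in> mod_hom R T P0" "\<And>y. y \<in> carrier T \<Longrightarrow> \<phi>0 (t y) = \<tau> y" and y: "y \<in> carrier T" for t y
  proof -
    assume ty: "t y = \<zero>\<^bsub>P0\<^esub>"
    obtain i x where x: "x \<in> carrier P0" "j i x = y" using jsurj[OF y] by blast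
    have hx: "j (Suc i) (h x) = y" using jh[of i "Suc i" x] x by simp
    have "(\<lambda>x. t (j (Suc i) x)) \<in> ?E0"
      using mod_hom_comp[OF j t(1)] t(2) mod_homD(1)[OF j] \<tau>j by (simp add: end_over_def)
    from hker[OF this x(1)] have "h x = \<zero>\<^bsub>P0\<^esub>" using hx ty by simp
    then show "y = \<zero>\<^bsub>T\<^esub>" using hx mod_hom_minus(1)[OF P0l Tl j] by simp
  qed
  have weakT: "\<exists>k\<in>mod_hom R N T. \<forall>x\<in>carrier N. \<tau> (k x) = \<psi> x"
    if h: "h \<in> mod_hom R N P0" "\<forall>x\<in>carrier N. \<phi>0 (h x) = \<psi> x" for N :: "('r, 'x) module" and \<psi> h
    by (rule bexI[OF _ mod_hom_comp[OF h(1) j[of 0]]]) (use h(2) mod_homD(1)[OF h(1)] \<tau>j in auto)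
  obtain r where r: "r \<in> mod_hom R T P0" "\<And>y. y \<in> carrier T \<Longrightarrow> \<phi>0 (r y) = \<tau> y"
    using weak[OF T \<tau>] by blast
  \<comment> \<open>Followed by \<open>r\<close>, an endomorphism of \<open>T\<close> becomes a map
    to \<open>P0\<close>, to which \<open>inj0\<close> applies.\<close>
  have injT: "inj_on g (carrier T)" if g: "g \<in> ?ET" for g
  proof (rule inj_onI)
    fix x y assume x: "x \<in> carrier T" and y: "y \<in> carrier T" and gxy: "g x = g y"
    note gd = end_overD[OF g]
    have rg: "(\<lambda>x. r (g x)) \<in> mod_hom R T P0" by (rule mod_hom_comp[OF gd(1) r(1)])
    have "g (x \<ominus>\<^bsub>T\<^esub> y) = \<zero>\<^bsub>T\<^esub>"
      using mod_hom_minus(3)[OF Tl Tl gd(1) x y] gxy gd(3)[OF y] by (simp add: T.minus_eq_zero_iff)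
    then have "r (g (x \<ominus>\<^bsub>T\<^esub> y)) = \<zero>\<^bsub>P0\<^esub>"
      using mod_hom_minus(1)[OF Tl P0l r(1)] by simp
    then have "x \<ominus>\<^bsub>T\<^esub> y = \<zero>\<^bsub>T\<^esub>"
      using inj0[OF rg, of "x \<ominus>\<^bsub>T\<^esub> y"] r(2) gd x y by simp
    then show "x = y" using x y by (simp add: T.minus_eq_zero_iff)
  qed
  have surjT: "g ` carrier T = carrier T" if g: "g \<in> ?ET" for g
  proof (rule ccontr)
    assume ng: "g ` carrier T \<noteq> carrier T"
    have im: "u ` carrier T \<subseteq> carrier T" if "u \<in> ?ET" for u
      by (rule image_subsetI) (rule end_overD(3)[OF that])
    show False
    \<comment> \<open>Strict now means not onto, and one non-surjective \<open>g\<close> serves at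
      every stage. The invariant is the image of the stage; the injectivity just shown makes these
      images differ.\<close>
    proof (rule no_unbounded_chain[OF T M \<tau>, where
          S = "\<lambda>h g. g ` carrier T \<noteq> carrier T" and V = "\<lambda>h r. r ` carrier T"])
      show "\<exists>h\<in>mod_hom R N T. \<forall>x\<in>carrier N. \<tau> (h x) = \<psi> x"
        if N: "exact_module N" "\<psi> \<in> mod_hom R N M"
        for N :: "('r, (nat \<Rightarrow> ('r, 'u) module \<times> ('u \<Rightarrow> 'm) \<Rightarrow> 'u) set set \<Rightarrow> (nat \<Rightarrow> ('r, 'u) module \<times> ('u \<Rightarrow> 'm) \<Rightarrow> 'u)) module" and \<psi>
        using weak[OF N] mod_hom_comp[OF _ j[of 0]] \<tau>j mod_homD(1) by (metis (no_types, lifting))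
      show "\<exists>g\<in>?ET. g ` carrier T \<noteq> carrier T" using g ng by blast
      show "(\<lambda>x. u (r x)) ` carrier T \<noteq> carrier T"
        if "r \<in> ?ET" "u \<in> ?ET" "u ` carrier T \<noteq> carrier T" for r u
        using that im[OF that(1)] im[OF that(2)] by blast
      show "r ` carrier T \<noteq> r' ` carrier T"
        if gr: "g \<in> ?ET" "r' \<in> ?ET" "g ` carrier T \<noteq> carrier T" "\<forall>x\<in>carrier T. r x = r' (g x)" for g r r'
      proof
        assume "r ` carrier T = r' ` carrier T"
        then have "r' ` (g ` carrier T) = r' ` carrier T" using gr(4) by (auto simp: image_image)
        then have "g ` carrier T = carrier T"
          using inj_on_image_eq_iff[OF injT[OF gr(2)] im[OF gr(1)] subset_refl] by blast
        then show False using gr(3) by blast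
      qed
    qed
  qed
  obtain C :: "('r, 'u) module" and \<phi> q where C: "exact_module C" "\<phi> \<in> mod_hom R C M"
    and q: "q \<in> mod_hom R T C" and qs: "q ` carrier T = carrier C"
    and q\<phi>: "\<And>x. x \<in> carrier T \<Longrightarrow> \<phi> (q x) = \<tau> x"
    by (rule reduction_exists[OF T M \<tau> e], rule that)
  obtain s0 where s0: "s0 \<in> mod_hom R C P0" "\<And>y. y \<in> carrier C \<Longrightarrow> \<phi>0 (s0 y) = \<phi> y"
    using weak[OF C] by blast
  define s where "s = (\<lambda>y. j 0 (s0 y))"
  have s: "s \<in> mod_hom R C T" "\<And>y. y \<in> carrier C \<Longrightarrow> \<tau> (s y) = \<phi> y"
    using mod_hom_comp[OF s0(1) j[of 0]] \<tau>j s0 mod_homD(1)[OF s0(1)] by (auto simp: s_def)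
  \<comment> \<open>Any endomorphism \<open>g\<close> of \<open>C\<close> is conjugated into
    \<open>T\<close> by \<open>q\<close> and \<open>s\<close>. The case of the identity gives that
    \<open>s\<close> is bijective, and then \<open>g\<close> is bijective as well.\<close>
  have sgq: "bij_betw (\<lambda>x. s (g (q x))) (carrier T) (carrier T)" if g: "g \<in> end_over C \<phi>" for g
  proof -
    have "(\<lambda>x. s (g (q x))) \<in> ?ET"
      using mod_hom_comp[OF mod_hom_comp[OF q end_overD(1)[OF g]] s(1)] s(2) end_overD[OF g] q\<phi> mod_homD(1)[OF q]
      by (simp add: end_over_def)
    then show ?thesis using injT surjT by (simp add: bij_betw_def)
  qed
  have qinj: "inj_on q (carrier T)"
    using sgq[OF end_over_id] by (auto simp: bij_betw_def inj_on_def)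
  have bij: "bij_betw g (carrier C) (carrier C)" if g: "g \<in> end_over C \<phi>" for g
    unfolding bij_betw_def
  proof
    show "inj_on g (carrier C)"
      using sgq[OF g] unfolding bij_betw_def inj_on_def qs[symmetric] by auto
    have sinj: "inj_on s (carrier C)"
      using sgq[OF end_over_id] unfolding bij_betw_def inj_on_def qs[symmetric] by auto
    have "s ` (g ` carrier C) = carrier T"
      using sgq[OF g] unfolding bij_betw_def qs[symmetric] by (simp add: image_image)
    moreover have "s ` carrier C = carrier T"
      using sgq[OF end_over_id] unfolding bij_betw_def qs[symmetric] by (simp add: image_image)
    moreover have "g ` carrier C \<subseteq> carrier C" by (rule image_subsetI) (rule end_overD(3)[OF g])
    ultimately show "g ` carrier C = carrier C"
      using inj_on_image_eq_iff[OF sinj, of "g ` carrier C" "carrier C"] by simp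
  qed
  show thesis
  proof (rule that[OF C, of "\<lambda>x. q (j 0 x)"])
    show "(\<lambda>x. q (j 0 x)) \<in> mod_hom R (sum_over M) C"
      using mod_hom_comp[OF j q] by (simp add: P0_def)
    show "\<phi> (q (j 0 x)) = map_over M x" if "x \<in> carrier (sum_over M)" for x
      using that q\<phi> mod_homD(1)[OF j] \<tau>j by (simp add: P0_def \<phi>0_def)
    show "bij_betw g (carrier C) (carrier C)" if "g \<in> end_over C \<phi>" for g using that by (rule bij)
  qed
qed

end

section \<open>Free resolutions\<close>

text \<open>A right module is a left module over the opposite ring, so the constructions for left
  modules serve for resolutions too.\<close>

definition opposite_ring :: "'r ring \<Rightarrow> 'r ring" where
  "opposite_ring R = R\<lparr>monoid.mult := (\<lambda>a b. b \<otimes>\<^bsub>R\<^esub> a)\<rparr>"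

definition regular_module :: "'r ring \<Rightarrow> ('r, 'r) module" where
  "regular_module R = \<lparr>carrier = carrier R, monoid.mult = undefined, one = undefined,
     ring.zero = \<zero>\<^bsub>R\<^esub>, ring.add = (\<oplus>\<^bsub>R\<^esub>), smult = (\<otimes>\<^bsub>R\<^esub>)\<rparr>"

lemma opposite_ring_sel [simp]:
  "carrier (opposite_ring R) = carrier R" "\<zero>\<^bsub>opposite_ring R\<^esub> = \<zero>\<^bsub>R\<^esub>" "\<one>\<^bsub>opposite_ring R\<^esub> = \<one>\<^bsub>R\<^esub>"
  "x \<oplus>\<^bsub>opposite_ring R\<^esub> y = x \<oplus>\<^bsub>R\<^esub> y" "x \<otimes>\<^bsub>opposite_ring R\<^esub> y = y \<otimes>\<^bsub>R\<^esub> x"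
  by (simp_all add: opposite_ring_def)

lemma regular_module_sel [simp]:
  "carrier (regular_module R) = carrier R" "\<zero>\<^bsub>regular_module R\<^esub> = \<zero>\<^bsub>R\<^esub>"
  "x \<oplus>\<^bsub>regular_module R\<^esub> y = x \<oplus>\<^bsub>R\<^esub> y" "r \<odot>\<^bsub>regular_module R\<^esub> x = r \<otimes>\<^bsub>R\<^esub> x"
  by (simp_all add: regular_module_def)

lemma ring_opposite_ring:
  assumes "ring R"
  shows "ring (opposite_ring R)"
proof -
  interpret ring R by fact
  show ?thesis
  proof (rule ringI)
    show "abelian_group (opposite_ring R)"
      by (rule abelian_groupI) (auto simp: a_ac l_neg intro: bexI[of _ "\<ominus>\<^bsub>R\<^esub> x" for x])
    show "Group.monoid (opposite_ring R)" by (rule monoidI) (auto simp: m_assoc)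
  qed (auto simp: l_distr r_distr)
qed

lemma left_module_regular:
  assumes "ring R"
  shows "left_module R (regular_module R)"
proof -
  interpret ring R by fact
  have "abelian_group (regular_module R)"
    by (rule abelian_groupI) (auto simp: a_ac l_neg intro: bexI[of _ "\<ominus>\<^bsub>R\<^esub> x" for x])
  then show ?thesis
    by (intro left_moduleI) (auto simp: l_distr r_distr m_assoc intro: ring_axioms)
qed

text \<open>\<open>free_right_module\<close> and the corresponding \<open>power_module\<close> have
  the same carrier, but their operations agree only there.\<close>

lemma left_module_cong:
  assumes M: "left_module R M" and c: "carrier N = carrier M" and z: "\<zero>\<^bsub>N\<^esub> = \<zero>\<^bsub>M\<^esub>"
    and a: "\<And>x y. x \<in> carrier M \<Longrightarrow> y \<in> carrier M \<Longrightarrow> x \<oplus>\<^bsub>N\<^esub> y = x \<oplus>\<^bsub>M\<^esub> y"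
    and s: "\<And>r x. r \<in> carrier R \<Longrightarrow> x \<in> carrier M \<Longrightarrow> r \<odot>\<^bsub>N\<^esub> x = r \<odot>\<^bsub>M\<^esub> x"
  shows "left_module R N"
proof -
  interpret left_module R M by fact
  have "abelian_group N"
    by (rule abelian_groupI) (auto simp: c z a M.a_ac M.l_neg intro: bexI[of _ "\<ominus>\<^bsub>M\<^esub> x" for x])
  then show ?thesis
    by (intro left_moduleI)
      (auto simp: c a s smult_closed smult_l_distr smult_r_distr smult_assoc smult_one R.ring_axioms)
qed

lemma free_right_module_sel:
  assumes "ring R"
  shows "carrier (free_right_module R B) = fin_supp B (\<lambda>_. regular_module (opposite_ring R))"
    "\<zero>\<^bsub>free_right_module R B\<^esub> = (\<lambda>_. \<zero>\<^bsub>R\<^esub>)"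
    "f \<oplus>\<^bsub>free_right_module R B\<^esub> g = (\<lambda>b. f b \<oplus>\<^bsub>R\<^esub> g b)"
    "r \<odot>\<^bsub>free_right_module R B\<^esub> f = (\<lambda>b. f b \<otimes>\<^bsub>R\<^esub> r)"
proof -
  interpret ring R by fact
  show "carrier (free_right_module R B) = fin_supp B (\<lambda>_. regular_module (opposite_ring R))"
    by (auto simp: free_right_module_def fin_supp_iff) (metis zero_closed)
qed (simp_all add: free_right_module_def)

lemma free_right_module_ops:
  assumes "ring R" "f \<in> carrier (free_right_module R B)"
  shows "g \<in> carrier (free_right_module R B) \<Longrightarrow>
      f \<oplus>\<^bsub>free_right_module R B\<^esub> g = f \<oplus>\<^bsub>power_module B (regular_module (opposite_ring R))\<^esub> g"
    "r \<in> carrier R \<Longrightarrow>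
      r \<odot>\<^bsub>free_right_module R B\<^esub> f = r \<odot>\<^bsub>power_module B (regular_module (opposite_ring R))\<^esub> f"
proof -
  interpret ring R by fact
  show "f \<oplus>\<^bsub>free_right_module R B\<^esub> g = f \<oplus>\<^bsub>power_module B (regular_module (opposite_ring R))\<^esub> g"
    if "g \<in> carrier (free_right_module R B)"
    using that assms by (auto simp: free_right_module_sel direct_sum_sel fin_supp_iff fun_eq_iff)
  show "r \<odot>\<^bsub>free_right_module R B\<^esub> f = r \<odot>\<^bsub>power_module B (regular_module (opposite_ring R))\<^esub> f"
    if "r \<in> carrier R"
    using that assms by (auto simp: free_right_module_sel direct_sum_sel fin_supp_iff fun_eq_iff)
qed

lemma left_module_free_right:
  assumes "ring R"
  shows "left_module (opposite_ring R) (free_right_module R B)"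
proof (rule left_module_cong)
  let ?O = "opposite_ring R"
  show "left_module ?O (power_module B (regular_module ?O))"
    by (intro direct_sum left_module_regular ring_opposite_ring assms)
qed (use assms free_right_module_ops[OF assms] in \<open>auto simp: free_right_module_sel direct_sum_sel\<close>)

section \<open>Free modules and resolutions by them\<close>

definition unit_vec :: "'r ring \<Rightarrow> 'b \<Rightarrow> 'b \<Rightarrow> 'r" where
  "unit_vec R c = (\<lambda>b. if b = c then \<one>\<^bsub>R\<^esub> else \<zero>\<^bsub>R\<^esub>)"

lemma unit_vec_closed: "ring R \<Longrightarrow> c \<in> B \<Longrightarrow> unit_vec R c \<in> carrier (free_right_module R B)"
  by (auto simp: free_right_module_def unit_vec_def ring.ring_simprules)

lemma free_right_module_closed: "f \<in> carrier (free_right_module R B) \<Longrightarrow> f b \<in> carrier R"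
  by (simp add: free_right_module_def)

text \<open>Universal property of the free module. Giving \<open>x\<close> on the whole type avoids
  membership conditions inside the sum.\<close>

lemma linear_combination:
  assumes R: "ring R" and X: "left_module (opposite_ring R) X" and x: "\<And>b. x b \<in> carrier X"
  shows "(\<lambda>f. supp_sum X (\<lambda>b. f b \<odot>\<^bsub>X\<^esub> x b)) \<in> mod_hom R (free_right_module R B) X" (is "?h \<in> _")
    and "supp_sum X (\<lambda>b. unit_vec R c b \<odot>\<^bsub>X\<^esub> x b) = x c"
proof -
  interpret R: ring R by fact
  interpret X: left_module "opposite_ring R" X by fact
  have fin: "finite {b. f b \<odot>\<^bsub>X\<^esub> x b \<noteq> \<zero>\<^bsub>X\<^esub>}" and cl: "f b \<odot>\<^bsub>X\<^esub> x b \<in> carrier X"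
    if f: "f \<in> carrier (free_right_module R B)" for f b
  proof -
    have "finite {b. f b \<noteq> \<zero>\<^bsub>R\<^esub>}" using f by (simp add: free_right_module_def)
    then show "finite {b. f b \<odot>\<^bsub>X\<^esub> x b \<noteq> \<zero>\<^bsub>X\<^esub>}"
      by (rule rev_finite_subset) (use X.zero_smult[OF x] in auto)
    show "f b \<odot>\<^bsub>X\<^esub> x b \<in> carrier X"
      using X.smult_closed[of "f b" "x b"] x free_right_module_closed[OF f] by simp
  qed
  show "?h \<in> mod_hom R (free_right_module R B) X"
  proof (rule mod_homI)
    show "?h f \<in> carrier X" if f: "f \<in> carrier (free_right_module R B)" for f
      by (rule X.supp_sum_closed) (rule cl[OF f])
    show "?h (f \<oplus>\<^bsub>free_right_module R B\<^esub> g) = ?h f \<oplus>\<^bsub>X\<^esub> ?h g"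
      if f: "f \<in> carrier (free_right_module R B)" and g: "g \<in> carrier (free_right_module R B)" for f g
    proof -
      have "(f b \<oplus>\<^bsub>R\<^esub> g b) \<odot>\<^bsub>X\<^esub> x b = f b \<odot>\<^bsub>X\<^esub> x b \<oplus>\<^bsub>X\<^esub> g b \<odot>\<^bsub>X\<^esub> x b" for b
        using X.smult_l_distr[of "f b" "g b" "x b"] x free_right_module_closed[OF f] free_right_module_closed[OF g] by simp
      then show ?thesis
        using X.supp_sum_add[OF cl[OF f] cl[OF g] fin[OF f] fin[OF g]] by (simp add: free_right_module_sel[OF R])
    qed
    show "?h (r \<odot>\<^bsub>free_right_module R B\<^esub> f) = r \<odot>\<^bsub>X\<^esub> ?h f"
      if r: "r \<in> carrier R" and f: "f \<in> carrier (free_right_module R B)" for r f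
    proof -
      have "(f b \<otimes>\<^bsub>R\<^esub> r) \<odot>\<^bsub>X\<^esub> x b = r \<odot>\<^bsub>X\<^esub> (f b \<odot>\<^bsub>X\<^esub> x b)" for b
        using X.smult_assoc[of r "f b" "x b"] x r free_right_module_closed[OF f] by simp
      moreover have "(\<lambda>y. r \<odot>\<^bsub>X\<^esub> y) \<in> hom (add_monoid X) (add_monoid X)"
        using r by (auto simp: hom_def X.smult_closed X.smult_r_distr)
      ultimately show ?thesis
        using X.supp_sum_hom[OF X.abelian_group_axioms _ cl[OF f] fin[OF f]] by (simp add: free_right_module_sel[OF R])
    qed
  qed
  have "(\<lambda>b. unit_vec R c b \<odot>\<^bsub>X\<^esub> x b) = (\<lambda>b. if b = c then x c else \<zero>\<^bsub>X\<^esub>)"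
    using X.smult_one[OF x] X.zero_smult[OF x] by (auto simp: unit_vec_def)
  then show "supp_sum X (\<lambda>b. unit_vec R c b \<odot>\<^bsub>X\<^esub> x b) = x c"
    using X.supp_sum_single[OF x] by simp
qed

text \<open>One basis element \<open>e y\<close> for each element \<open>y\<close>, sent back to
  \<open>y\<close>.\<close>

lemma free_cover_exists:
  assumes R: "ring R" and X: "left_module (opposite_ring R) X" and e: "inj_on e (carrier X)"
  shows "\<exists>d\<in>mod_hom R (free_right_module R (e ` carrier X)) X.
    d ` carrier (free_right_module R (e ` carrier X)) = carrier X"
proof -
  interpret X: left_module "opposite_ring R" X by fact
  define x where "x b = (if b \<in> e ` carrier X then inv_into (carrier X) e b else \<zero>\<^bsub>X\<^esub>)" for b
  have xc: "x b \<in> carrier X" for b by (auto simp: x_def inv_into_into)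
  let ?F = "free_right_module R (e ` carrier X)"
  let ?d = "\<lambda>f. supp_sum X (\<lambda>b. f b \<odot>\<^bsub>X\<^esub> x b)"
  have d: "?d \<in> mod_hom R ?F X" by (rule linear_combination(1)[OF R X xc])
  have "y \<in> ?d ` carrier ?F" if y: "y \<in> carrier X" for y
  proof
    show "unit_vec R (e y) \<in> carrier ?F" using y by (intro unit_vec_closed R) auto
    show "y = ?d (unit_vec R (e y))"
      using linear_combination(2)[OF R X xc, of "e y"] y by (simp add: x_def e)
  qed
  then have "?d ` carrier ?F = carrier X" using mod_homD(1)[OF d] by blast
  then show ?thesis using d by blast
qed

text \<open>A finitely supported function is determined by the finite list of its nonzero entries,
  so elements of a free module can again be named by basis elements. Hence one basis type suffices
  in all degrees.\<close>

lemma inj_on_fin_supp_basis: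
  "\<exists>e :: (('r, 'x) basis \<Rightarrow> 'r) \<Rightarrow> ('r, 'x) basis. inj_on e {f. finite {b. f b \<noteq> z}}"
proof -
  have k: "infinite (UNIV :: ('r + 'x + nat) set)"
    by (simp add: UNIV_Plus_UNIV[symmetric] del: UNIV_Plus_UNIV)
  have r: "inj (Inl :: 'r \<Rightarrow> 'r + 'x + nat)" by simp
  have x: "inj (Inr \<circ> Inl :: 'x \<Rightarrow> 'r + 'x + nat)" by (intro inj_compose) auto
  obtain b where b: "inj (b :: ('r, 'x) basis \<Rightarrow> 'r + 'x + nat)" using inj_basis[OF k r x] by blast
  obtain p where p: "inj (p :: ('r, 'x) basis \<times> 'r \<Rightarrow> 'r + 'x + nat)" using inj_prod_infinite[OF k b r] by blast
  obtain l where l: "inj (l :: (('r, 'x) basis \<times> 'r) list \<Rightarrow> 'r + 'x + nat)" using inj_list_infinite[OF k p] by blast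
  define g where "g f = (SOME xs. set xs = {(b, f b) | b. f b \<noteq> z})" for f :: "('r, 'x) basis \<Rightarrow> 'r"
  have g: "set (g f) = {(b, f b) | b. f b \<noteq> z}" if "finite {b. f b \<noteq> z}" for f
  proof -
    have "finite {(b, f b) | b. f b \<noteq> z}" using that by (simp add: setcompr_eq_image)
    then show ?thesis unfolding g_def by (rule someI_ex[OF finite_list])
  qed
  have "inj_on (\<lambda>f. [l (g f)]) {f. finite {b. f b \<noteq> z}}"
  proof (rule inj_onI)
    fix f f' assume f: "f \<in> {f. finite {b. f b \<noteq> z}}" and f': "f' \<in> {f. finite {b. f b \<noteq> z}}"
      and eq: "[l (g f)] = [l (g f')]"
    have "{(b, f b) | b. f b \<noteq> z} = {(b, f' b) | b. f' b \<noteq> z}"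
      using g[of f] g[of f'] f f' eq l by (simp add: inj_eq)
    then have "(b, y) \<in> {(b, f b) | b. f b \<noteq> z} \<longleftrightarrow> (b, y) \<in> {(b, f' b) | b. f' b \<noteq> z}" for b y by (simp only:)
    then have "(y = f b \<and> y \<noteq> z) \<longleftrightarrow> (y = f' b \<and> y \<noteq> z)" for b y by auto
    then show "f = f'" by (metis ext)
  qed
  then show ?thesis by blast
qed

lemma a_kernel_eq: "a_kernel G H h = {x \<in> carrier G. h x = \<zero>\<^bsub>H\<^esub>}"
  by (simp add: a_kernel_def kernel_def)

lemma mod_hom_opposite: "mod_hom (opposite_ring R) M N = mod_hom R M N"
  by (simp add: mod_hom_def)

lemma free_resolution_exists:
  fixes R :: "'r ring" and X :: "('r, 'x) module"
  assumes R: "ring R" and X: "left_module (opposite_ring R) X"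
  shows "\<exists>(B :: nat \<Rightarrow> ('r, 'x) basis set) d \<epsilon>. free_resolution R X B d \<epsilon>"
proof -
  let ?O = "opposite_ring R"
  let ?F = "\<lambda>B :: ('r, 'x) basis set. free_right_module R B"
  note Fl = left_module_free_right[OF R]
  have step: "\<exists>B' d. d \<in> mod_hom R (?F B') (?F B) \<and> d ` carrier (?F B') = K"
    if K: "submodule_of ?O (?F B) K" for B K
  proof -
    let ?K = "(?F B)\<lparr>carrier := K\<rparr>"
    obtain e :: "(('r, 'x) basis \<Rightarrow> 'r) \<Rightarrow> ('r, 'x) basis" where e: "inj_on e {f. finite {b. f b \<noteq> \<zero>\<^bsub>R\<^esub>}}"
      using inj_on_fin_supp_basis[of "\<zero>\<^bsub>R\<^esub>"] by (elim exE) (rule that)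
    have KF: "K \<subseteq> carrier (?F B)" using K by (simp add: submodule_of_def)
    then have "inj_on e (carrier ?K)"
      by (intro inj_on_subset[OF e]) (auto simp: free_right_module_def)
    from free_cover_exists[OF R submodule_of_left_module[OF Fl K] this]
    obtain B' d where d: "d \<in> mod_hom R (?F B') ?K" "d ` carrier (?F B') = K" by auto
    have "d \<in> mod_hom R (?F B') (?F B)"
      using mod_hom_comp[OF d(1) mod_hom_incl[OF KF]] by simp
    then show ?thesis using d(2) by blast
  qed
  obtain nB nd where nB: "\<And>B K. submodule_of ?O (?F B) K \<Longrightarrow> nd B K \<in> mod_hom R (?F (nB B K)) (?F B)"
    and nd: "\<And>B K. submodule_of ?O (?F B) K \<Longrightarrow> nd B K ` carrier (?F (nB B K)) = K"
    using step by metis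
  define B0 :: "('r, 'x) basis set" where "B0 = (\<lambda>a. [Inr (Inl a)]) ` carrier X"
  have "inj_on (\<lambda>a. [Inr (Inl a)] :: ('r, 'x) basis) (carrier X)" by (simp add: inj_on_def)
  from free_cover_exists[OF R X this, folded B0_def]
  obtain \<epsilon> where \<epsilon>: "\<epsilon> \<in> mod_hom R (?F B0) X" "\<epsilon> ` carrier (?F B0) = carrier X" by blast
  \<comment> \<open>The recursion carries the current basis together with the kernel that the next
    free module has to cover.\<close>
  define st where "st = rec_nat (B0, {f \<in> carrier (?F B0). \<epsilon> f = \<zero>\<^bsub>X\<^esub>})
    (\<lambda>_ (B, K). (nB B K, {f \<in> carrier (?F (nB B K)). nd B K f = \<zero>\<^bsub>?F B\<^esub>}))"
  define B where "B n = fst (st n)" for n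
  define K where "K n = snd (st n)" for n
  have st0: "B 0 = B0" "K 0 = {f \<in> carrier (?F B0). \<epsilon> f = \<zero>\<^bsub>X\<^esub>}" by (simp_all add: B_def K_def st_def)
  have stS: "B (Suc n) = nB (B n) (K n)"
    "K (Suc n) = {f \<in> carrier (?F (B (Suc n))). nd (B n) (K n) f = \<zero>\<^bsub>?F (B n)\<^esub>}" for n
    by (simp_all add: B_def K_def st_def split_beta)
  have K: "submodule_of ?O (?F (B n)) (K n)" for n
  proof (induction n)
    case 0
    show ?case
      using submodule_of_kernel[OF Fl X, of \<epsilon>] \<epsilon>(1) by (simp add: st0 mod_hom_opposite)
  next
    case (Suc n)
    show ?case
      using submodule_of_kernel[OF Fl Fl, of "nd (B n) (K n)"] nB[OF Suc] by (simp add: stS mod_hom_opposite)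
  qed
  have "free_resolution R X B (\<lambda>n. nd (B n) (K n)) \<epsilon>"
    unfolding free_resolution_def Let_def a_kernel_eq
  proof (intro conjI allI)
    show "nd (B n) (K n) \<in> mod_hom R (?F (B (Suc n))) (?F (B n))" for n using nB[OF K] by (simp add: stS(1))
    show "\<epsilon> \<in> mod_hom R (?F (B 0)) X" "\<epsilon> ` carrier (?F (B 0)) = carrier X" using \<epsilon> by (simp_all add: st0)
    show "nd (B 0) (K 0) ` carrier (?F (B 1)) = {f \<in> carrier (?F (B 0)). \<epsilon> f = \<zero>\<^bsub>X\<^esub>}"
      using nd[OF K, of 0] stS(1)[of 0] st0 by simp
    show "nd (B (Suc n)) (K (Suc n)) ` carrier (?F (B (Suc (Suc n)))) =
        {f \<in> carrier (?F (B (Suc n))). nd (B n) (K n) f = \<zero>\<^bsub>?F (B n)\<^esub>}" for n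
      using nd[OF K, of "Suc n"] stS[of "Suc n"] stS(2)[of n] by simp
  qed
  then show ?thesis by blast
qed

lemma left_module_ideal_right:
  assumes "ideal A R"
  shows "left_module (opposite_ring R) (ideal_right_module R A)"
proof -
  interpret ideal A R by fact
  have s: "carrier (ideal_right_module R A) = A" "\<zero>\<^bsub>ideal_right_module R A\<^esub> = \<zero>\<^bsub>R\<^esub>"
    "x \<oplus>\<^bsub>ideal_right_module R A\<^esub> y = x \<oplus>\<^bsub>R\<^esub> y" "r \<odot>\<^bsub>ideal_right_module R A\<^esub> x = x \<otimes>\<^bsub>R\<^esub> r" for x y r
    by (simp_all add: ideal_right_module_def)
  have A: "x \<in> A \<Longrightarrow> x \<in> carrier R" for x using a_subset by blast
  have "abelian_group (ideal_right_module R A)"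
  proof (rule abelian_groupI)
    show "\<exists>y\<in>carrier (ideal_right_module R A). y \<oplus>\<^bsub>ideal_right_module R A\<^esub> x = \<zero>\<^bsub>ideal_right_module R A\<^esub>"
      if "x \<in> carrier (ideal_right_module R A)" for x
      using that A by (intro bexI[of _ "\<ominus>\<^bsub>R\<^esub> x"]) (auto simp: s l_neg a_inv_closed)
  qed (auto simp: s A a_ac a_closed additive_subgroup.zero_closed[OF additive_subgroup_axioms])
  then show ?thesis
    by (intro left_moduleI ring_opposite_ring ring_axioms)
      (auto simp: s A I_r_closed r_distr l_distr m_assoc)
qed

text \<open>Makes the choice in the definition of \<open>Tor\<close> meaningful: a resolution exists
  within the type \<open>basis\<close>.\<close>

lemma chosen_resolution:
  assumes "ideal A R"
  shows "case chosen_resolution R (ideal_right_module R A) of (B, d, \<epsilon>) \<Rightarrow> free_resolution R (ideal_right_module R A) B d \<epsilon>"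
proof -
  interpret ideal A R by fact
  from free_resolution_exists[OF ring_axioms left_module_ideal_right[OF assms]]
  have "\<exists>t. case t of (B :: nat \<Rightarrow> ('a, 'a) basis set, d, \<epsilon>) \<Rightarrow> free_resolution R (ideal_right_module R A) B d \<epsilon>" by auto
  then show ?thesis unfolding chosen_resolution_def by (rule someI_ex)
qed

section \<open>Tensor products with free modules\<close>

text \<open>The homomorphic extension of \<open>f\<close> to the free abelian group, written in the
  form of the sum in \<open>tensor_mult\<close>.\<close>

definition eval_frag :: "('r, 'm) module \<Rightarrow> ('p \<Rightarrow> 'm) \<Rightarrow> ('p \<Rightarrow>\<^sub>0 int) \<Rightarrow> 'm" where
  "eval_frag M f x = (\<Oplus>\<^bsub>M\<^esub>p\<in>Poly_Mapping.keys x. [Poly_Mapping.lookup x p] \<cdot>\<^bsub>M\<^esub> f p)"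

lemma eval_frag:
  assumes M: "abelian_group M" and f: "f \<in> S \<rightarrow> carrier M"
  shows "Poly_Mapping.keys x \<subseteq> S \<Longrightarrow> eval_frag M f x \<in> carrier M"
    and "Poly_Mapping.keys x \<subseteq> S \<Longrightarrow> Poly_Mapping.keys y \<subseteq> S \<Longrightarrow>
      eval_frag M f (x + y) = eval_frag M f x \<oplus>\<^bsub>M\<^esub> eval_frag M f y"
    and "Poly_Mapping.keys x \<subseteq> S \<Longrightarrow> Poly_Mapping.keys y \<subseteq> S \<Longrightarrow>
      eval_frag M f (x - y) = eval_frag M f x \<ominus>\<^bsub>M\<^esub> eval_frag M f y"
    and "eval_frag M f 0 = \<zero>\<^bsub>M\<^esub>"
    and "p \<in> S \<Longrightarrow> eval_frag M f (frag_of p) = f p"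
proof -
  interpret M: abelian_group M by fact
  have pw: "add_pow M (k) (f p) \<in> carrier M" "add_pow M (k + l) (f p) = add_pow M (k) (f p) \<oplus>\<^bsub>M\<^esub> add_pow M (l) (f p)"
    "add_pow M (0::int) (f p) = \<zero>\<^bsub>M\<^esub>" "add_pow M (1::int) (f p) = f p"
    if "p \<in> S" for p and k l :: int
    using group.int_pow_closed[OF M.a_group, of "f p" k] group.int_pow_mult[OF M.a_group, of "f p" k l]
      group.int_pow_1[OF M.a_group, of "f p"] funcset_mem[OF f that]
    by (simp_all add: add_pow_def)
  have sup: "eval_frag M f x = (\<Oplus>\<^bsub>M\<^esub>p\<in>K. add_pow M (Poly_Mapping.lookup x p) (f p))"
    if "finite K" "Poly_Mapping.keys x \<subseteq> K" "K \<subseteq> S" for x K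
    unfolding eval_frag_def
    by (rule M.add.finprod_mono_neutral_cong_left)
      (use that pw in \<open>auto simp: in_keys_iff subset_iff\<close>)
  show cl: "Poly_Mapping.keys x \<subseteq> S \<Longrightarrow> eval_frag M f x \<in> carrier M" for x
    unfolding eval_frag_def by (rule M.finsum_closed) (use pw in auto)
  have add: "eval_frag M f (x + y) = eval_frag M f x \<oplus>\<^bsub>M\<^esub> eval_frag M f y"
    if x: "Poly_Mapping.keys x \<subseteq> S" and y: "Poly_Mapping.keys y \<subseteq> S" for x y
  proof -
    let ?K = "Poly_Mapping.keys x \<union> Poly_Mapping.keys y"
    have KS: "?K \<subseteq> S" using x y by blast
    have "Poly_Mapping.keys (x + y) \<subseteq> ?K" by (rule Poly_Mapping.keys_add)
    then have "eval_frag M f (x + y) = (\<Oplus>\<^bsub>M\<^esub>p\<in>?K. add_pow M (Poly_Mapping.lookup (x + y) p) (f p))"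
      using KS by (intro sup) auto
    also have "\<dots> = (\<Oplus>\<^bsub>M\<^esub>p\<in>?K. add_pow M (Poly_Mapping.lookup x p) (f p) \<oplus>\<^bsub>M\<^esub> add_pow M (Poly_Mapping.lookup y p) (f p))"
      using KS pw by (intro M.finsum_cong') (auto simp: Poly_Mapping.lookup_add)
    also have "\<dots> = eval_frag M f x \<oplus>\<^bsub>M\<^esub> eval_frag M f y"
      by (subst M.finsum_addf) (use KS pw in \<open>auto simp: sup[of ?K, symmetric] subset_iff\<close>)
    finally show ?thesis .
  qed
  then show "Poly_Mapping.keys x \<subseteq> S \<Longrightarrow> Poly_Mapping.keys y \<subseteq> S \<Longrightarrow>
      eval_frag M f (x + y) = eval_frag M f x \<oplus>\<^bsub>M\<^esub> eval_frag M f y" .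
  show "eval_frag M f (x - y) = eval_frag M f x \<ominus>\<^bsub>M\<^esub> eval_frag M f y"
    if x: "Poly_Mapping.keys x \<subseteq> S" and y: "Poly_Mapping.keys y \<subseteq> S"
  proof -
    have d: "Poly_Mapping.keys (x - y) \<subseteq> S" using keys_diff[of x y] x y by blast
    have "eval_frag M f x = eval_frag M f (x - y) \<oplus>\<^bsub>M\<^esub> eval_frag M f y"
      using add[OF d y] by simp
    then show ?thesis using cl[OF d] cl[OF y] by (simp add: a_minus_def M.a_assoc M.r_neg)
  qed
  show "eval_frag M f 0 = \<zero>\<^bsub>M\<^esub>" by (simp add: eval_frag_def)
  show "p \<in> S \<Longrightarrow> eval_frag M f (frag_of p) = f p"
    using pw(1)[of p 1] pw(4)[of p] by (simp add: eval_frag_def keys_frag_of)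
qed

lemma tensor_rels_subgroup:
  assumes P: "left_module (opposite_ring R) P" and M: "left_module R M"
  shows "subgroup (tensor_rels R P M) (free_Abelian_group (carrier P \<times> carrier M))"
proof -
  interpret P: left_module "opposite_ring R" P by fact
  interpret M: left_module R M by fact
  have k: "Poly_Mapping.keys (a - b - c) \<subseteq> S"
    if "Poly_Mapping.keys a \<subseteq> S" "Poly_Mapping.keys b \<subseteq> S" "Poly_Mapping.keys c \<subseteq> S"
    for a b c :: "'b \<times> 'c \<Rightarrow>\<^sub>0 int" and S
    using keys_diff[of "a - b" c] keys_diff[of a b] that by blast
  have k2: "Poly_Mapping.keys (a - b) \<subseteq> S" if "Poly_Mapping.keys a \<subseteq> S" "Poly_Mapping.keys b \<subseteq> S"
    for a b :: "'b \<times> 'c \<Rightarrow>\<^sub>0 int" and S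
    using keys_diff[of a b] that by blast
  have sm: "r \<odot>\<^bsub>P\<^esub> p \<in> carrier P" if "r \<in> carrier R" "p \<in> carrier P" for r p
    using P.smult_closed[of r p] that by simp
  show ?thesis
    unfolding tensor_rels_def
  proof (rule group.generate_is_subgroup[OF group_free_Abelian_group], intro Un_least subsetI, goal_cases)
    case (1 x)
    then show ?case
      by (elim CollectE exE conjE, simp only: carrier_free_Abelian_group_iff) (rule k; simp add: keys_frag_of)
  next
    case (2 x)
    then show ?case
      by (elim CollectE exE conjE, simp only: carrier_free_Abelian_group_iff) (rule k; simp add: keys_frag_of)
  next
    case (3 x)
    then show ?case
      by (elim CollectE exE conjE, simp only: carrier_free_Abelian_group_iff)
        (rule k2; simp add: keys_frag_of sm M.smult_closed)
  qed
qed

lemma tensor_rels_closed: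
  assumes "left_module (opposite_ring R) P" "left_module R M"
  shows "x \<in> tensor_rels R P M \<Longrightarrow> Poly_Mapping.keys x \<subseteq> carrier P \<times> carrier M"
    and "0 \<in> tensor_rels R P M"
    and "x \<in> tensor_rels R P M \<Longrightarrow> y \<in> tensor_rels R P M \<Longrightarrow> x + y \<in> tensor_rels R P M"
    and "x \<in> tensor_rels R P M \<Longrightarrow> - x \<in> tensor_rels R P M"
    and "x \<in> tensor_rels R P M \<Longrightarrow> y \<in> tensor_rels R P M \<Longrightarrow> x - y \<in> tensor_rels R P M"
proof -
  let ?T = "tensor_rels R P M"
  interpret T: subgroup ?T "free_Abelian_group (carrier P \<times> carrier M)"
    by (rule tensor_rels_subgroup[OF assms])
  show k: "x \<in> ?T \<Longrightarrow> Poly_Mapping.keys x \<subseteq> carrier P \<times> carrier M" for x using T.mem_carrier by simp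
  show "0 \<in> ?T" using T.one_closed by simp
  show a: "x \<in> ?T \<Longrightarrow> y \<in> ?T \<Longrightarrow> x + y \<in> ?T" for x y using T.m_closed by simp
  show m: "x \<in> ?T \<Longrightarrow> - x \<in> ?T" for x using T.m_inv_closed[of x] k[of x] by simp
  show "x \<in> ?T \<Longrightarrow> y \<in> ?T \<Longrightarrow> x - y \<in> ?T" using a[of x "- y"] m[of y] by simp
qed

lemma tensor_rels_intros:
  "\<lbrakk>p \<in> carrier P; q \<in> carrier P; m \<in> carrier M\<rbrakk> \<Longrightarrow>
    frag_of (p \<oplus>\<^bsub>P\<^esub> q, m) - frag_of (p, m) - frag_of (q, m) \<in> tensor_rels R P M"
  "\<lbrakk>p \<in> carrier P; m \<in> carrier M; n \<in> carrier M\<rbrakk> \<Longrightarrow>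
    frag_of (p, m \<oplus>\<^bsub>M\<^esub> n) - frag_of (p, m) - frag_of (p, n) \<in> tensor_rels R P M"
  "\<lbrakk>p \<in> carrier P; r \<in> carrier R; m \<in> carrier M\<rbrakk> \<Longrightarrow>
    frag_of (r \<odot>\<^bsub>P\<^esub> p, m) - frag_of (p, r \<odot>\<^bsub>M\<^esub> m) \<in> tensor_rels R P M"
  unfolding tensor_rels_def by (rule generate.incl; blast)+

text \<open>Differences are enough in the inductive step: together with zero they yield negatives
  and sums.\<close>

lemma tensor_rels_induct [consumes 3, case_names left right assoc zero diff]:
  assumes mods: "left_module (opposite_ring R) P" "left_module R M"
    and x: "x \<in> tensor_rels R P M"
    and left: "\<And>p q m. \<lbrakk>p \<in> carrier P; q \<in> carrier P; m \<in> carrier M\<rbrakk> \<Longrightarrow>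
      Q (frag_of (p \<oplus>\<^bsub>P\<^esub> q, m) - frag_of (p, m) - frag_of (q, m))"
    and right: "\<And>p m n. \<lbrakk>p \<in> carrier P; m \<in> carrier M; n \<in> carrier M\<rbrakk> \<Longrightarrow>
      Q (frag_of (p, m \<oplus>\<^bsub>M\<^esub> n) - frag_of (p, m) - frag_of (p, n))"
    and assoc: "\<And>p r m. \<lbrakk>p \<in> carrier P; r \<in> carrier R; m \<in> carrier M\<rbrakk> \<Longrightarrow>
      Q (frag_of (r \<odot>\<^bsub>P\<^esub> p, m) - frag_of (p, r \<odot>\<^bsub>M\<^esub> m))"
    and zero: "Q 0"
    and diff: "\<And>x y. \<lbrakk>x \<in> tensor_rels R P M; y \<in> tensor_rels R P M; Q x; Q y\<rbrakk> \<Longrightarrow> Q (x - y)"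
  shows "Q x"
proof -
  let ?G = "free_Abelian_group (carrier P \<times> carrier M)"
  note cl = tensor_rels_closed[OF mods]
  have "subgroup {x \<in> tensor_rels R P M. Q x} ?G"
  proof (rule group.subgroupI[OF group_free_Abelian_group])
    show "{x \<in> tensor_rels R P M. Q x} \<subseteq> carrier ?G" using cl(1) by auto
    show "{x \<in> tensor_rels R P M. Q x} \<noteq> {}" using cl(2) zero by blast
    show "inv\<^bsub>?G\<^esub> x \<in> {x \<in> tensor_rels R P M. Q x}" if "x \<in> {x \<in> tensor_rels R P M. Q x}" for x
      using that cl(1,2,4) diff[of 0 x] zero by simp
    show "x \<otimes>\<^bsub>?G\<^esub> y \<in> {x \<in> tensor_rels R P M. Q x}"
      if "x \<in> {x \<in> tensor_rels R P M. Q x}" "y \<in> {x \<in> tensor_rels R P M. Q x}" for x y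
      using that cl(2,3,4) diff[of 0 y] diff[of x "- y"] zero by simp
  qed
  then have "tensor_rels R P M \<subseteq> {x \<in> tensor_rels R P M. Q x}"
    by (subst tensor_rels_def, intro group.generate_subgroup_incl[OF group_free_Abelian_group])
      (use left right assoc tensor_rels_intros[where P = P and M = M and R = R] in auto)
  then show ?thesis using x by blast
qed

text \<open>On representatives, the isomorphism from the tensor product of a free module on
  \<open>B\<close> with \<open>M\<close> to the finitely supported families on \<open>B\<close> in
  \<open>M\<close>.\<close>

definition tensor_coords :: "('r, 'm) module \<Rightarrow> (('b \<Rightarrow> 'r) \<times> 'm \<Rightarrow>\<^sub>0 int) \<Rightarrow> 'b \<Rightarrow> 'm" where
  "tensor_coords M x = (\<lambda>b. eval_frag M (\<lambda>(p, m). p b \<odot>\<^bsub>M\<^esub> m) x)"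

abbreviation frag_fst :: "('p \<Rightarrow> 'q) \<Rightarrow> ('p \<times> 'm \<Rightarrow>\<^sub>0 int) \<Rightarrow> ('q \<times> 'm \<Rightarrow>\<^sub>0 int)" where
  "frag_fst f \<equiv> frag_extend (\<lambda>(p, m). frag_of (f p, m))"

lemma frag_fst_keys:
  assumes "Poly_Mapping.keys x \<subseteq> S \<times> C" "\<And>p. p \<in> S \<Longrightarrow> f p \<in> S'"
  shows "Poly_Mapping.keys (frag_fst f x) \<subseteq> S' \<times> C"
  using keys_frag_extend[of "\<lambda>(p, m). frag_of (f p, m)" x] assms by (fastforce simp: keys_frag_of)

lemma frag_fst_tensor_rels:
  assumes mods: "left_module (opposite_ring R) P" "left_module (opposite_ring R) Q" "left_module R M"
    and f: "f \<in> mod_hom R P Q" and x: "x \<in> tensor_rels R P M"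
  shows "frag_fst f x \<in> tensor_rels R Q M"
  using mods(1,3) x
proof (induction rule: tensor_rels_induct)
  case (diff x y)
  then show ?case using tensor_rels_closed(5)[OF mods(2,3)] by (simp add: frag_extend_diff)
qed (use tensor_rels_intros[where P = Q and M = M and R = R] tensor_rels_closed(2)[OF mods(2,3)] mod_homD[OF f] in
    \<open>simp_all add: frag_extend_diff\<close>)

lemma frag_fst_surj:
  assumes "\<And>q. q \<in> S' \<Longrightarrow> \<exists>p\<in>S. f p = q" "Poly_Mapping.keys x \<subseteq> S' \<times> C"
  shows "\<exists>y. Poly_Mapping.keys y \<subseteq> S \<times> C \<and> frag_fst f y = x"
  using assms(2)
proof (induction rule: free_Abelian_group_induct[consumes 1, case_names 1 2 3])
  case 1
  show ?case by (rule exI[of _ 0]) simp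
next
  case (2 x y)
  then obtain u v where "Poly_Mapping.keys u \<subseteq> S \<times> C" "frag_fst f u = x" "Poly_Mapping.keys v \<subseteq> S \<times> C" "frag_fst f v = y"
    by blast
  then show ?case using keys_diff[of u v] by (intro exI[of _ "u - v"]) (auto simp: frag_extend_diff)
next
  case (3 a)
  then obtain q m p where "a = (q, m)" "m \<in> C" "p \<in> S" "f p = q" using assms(1) by blast
  then show ?case by (intro exI[of _ "frag_of (p, m)"]) (simp add: keys_frag_of)
qed

section \<open>Coordinates of a tensor product with a free module\<close>

context left_module
begin

text \<open>A right linear \<open>h\<close> into \<open>R\<close> induces
  \<open>p \<otimes> m \<mapsto> h p m\<close>. It is applied to a coordinate of a free module and
  to the inclusion of the ideal.\<close>

lemma eval_frag_rels:
  assumes P: "left_module (opposite_ring R) P" and x: "x \<in> tensor_rels R P M"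
    and h: "\<And>p. p \<in> carrier P \<Longrightarrow> h p \<in> carrier R"
      "\<And>p q. p \<in> carrier P \<Longrightarrow> q \<in> carrier P \<Longrightarrow> h (p \<oplus>\<^bsub>P\<^esub> q) = h p \<oplus>\<^bsub>R\<^esub> h q"
      "\<And>p r. p \<in> carrier P \<Longrightarrow> r \<in> carrier R \<Longrightarrow> h (r \<odot>\<^bsub>P\<^esub> p) = h p \<otimes>\<^bsub>R\<^esub> r"
  shows "eval_frag M (\<lambda>(p, m). h p \<odot>\<^bsub>M\<^esub> m) x = \<zero>\<^bsub>M\<^esub>"
proof -
  interpret P: left_module "opposite_ring R" P by fact
  let ?S = "carrier P \<times> carrier M"
  let ?e = "eval_frag M (\<lambda>(p, m). h p \<odot>\<^bsub>M\<^esub> m)"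
  have f: "(\<lambda>(p, m). h p \<odot>\<^bsub>M\<^esub> m) \<in> ?S \<rightarrow> carrier M"
    using h(1) by (auto simp: smult_closed)
  note ev = eval_frag[OF M.abelian_group_axioms f]
  note Ml = left_module_axioms
  have sm: "r \<odot>\<^bsub>P\<^esub> p \<in> carrier P" if "r \<in> carrier R" "p \<in> carrier P" for r p
    using P.smult_closed[of r p] that by simp
  have of: "?e (frag_of (p, m)) = h p \<odot>\<^bsub>M\<^esub> m" "Poly_Mapping.keys (frag_of (p, m)) \<subseteq> ?S"
    if "p \<in> carrier P" "m \<in> carrier M" for p m
    using that ev(5) by (auto simp: keys_frag_of)
  have d3: "?e (a - b - c) = ?e a \<ominus>\<^bsub>M\<^esub> ?e b \<ominus>\<^bsub>M\<^esub> ?e c"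
    if "Poly_Mapping.keys a \<subseteq> ?S" "Poly_Mapping.keys b \<subseteq> ?S" "Poly_Mapping.keys c \<subseteq> ?S" for a b c
  proof -
    have "Poly_Mapping.keys (a - b) \<subseteq> ?S" using that keys_diff[of a b] by blast
    from ev(3)[OF this that(3)] ev(3)[OF that(1,2)] show ?thesis by simp
  qed
  have cancel: "(a \<oplus>\<^bsub>M\<^esub> b) \<ominus>\<^bsub>M\<^esub> a \<ominus>\<^bsub>M\<^esub> b = \<zero>\<^bsub>M\<^esub>" if "a \<in> carrier M" "b \<in> carrier M" for a b
  proof -
    have "(a \<oplus>\<^bsub>M\<^esub> b) \<ominus>\<^bsub>M\<^esub> a = b"
      using that by (simp add: a_minus_def M.a_comm[of a b] M.a_assoc M.r_neg)
    then show ?thesis using that by (simp add: a_minus_def M.r_neg)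
  qed
  show ?thesis
    using P Ml x
  proof (induction rule: tensor_rels_induct)
    case (left p q m)
    then show ?case
      using cancel[of "h p \<odot>\<^bsub>M\<^esub> m" "h q \<odot>\<^bsub>M\<^esub> m"] h
      by (simp add: d3 of smult_l_distr smult_closed)
  next
    case (right p m n)
    then show ?case
      using cancel[of "h p \<odot>\<^bsub>M\<^esub> m" "h p \<odot>\<^bsub>M\<^esub> n"] h
      by (simp add: d3 of smult_r_distr smult_closed)
  next
    case (assoc p r m)
    then have "?e (frag_of (r \<odot>\<^bsub>P\<^esub> p, m) - frag_of (p, r \<odot>\<^bsub>M\<^esub> m)) = h (r \<odot>\<^bsub>P\<^esub> p) \<odot>\<^bsub>M\<^esub> m \<ominus>\<^bsub>M\<^esub> h p \<odot>\<^bsub>M\<^esub> (r \<odot>\<^bsub>M\<^esub> m)"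
      using ev(3) of sm smult_closed by simp
    then show ?case using assoc h by (simp add: smult_assoc smult_closed a_minus_def M.r_neg)
  next
    case zero
    show ?case by (rule ev(4))
  next
    case (diff x y)
    then show ?case
      using ev(3)[of x y] tensor_rels_closed(1)[OF P Ml] by (simp add: a_minus_def)
  qed
qed

lemma tensor_coords_props:
  fixes B :: "'b set"
  defines "S \<equiv> carrier (free_right_module R B) \<times> carrier M"
  shows "Poly_Mapping.keys x \<subseteq> S \<Longrightarrow> tensor_coords M x \<in> fin_supp B (\<lambda>_. M)"
    and "Poly_Mapping.keys x \<subseteq> S \<Longrightarrow> Poly_Mapping.keys y \<subseteq> S \<Longrightarrow>
      tensor_coords M (x + y) = (\<lambda>b. tensor_coords M x b \<oplus>\<^bsub>M\<^esub> tensor_coords M y b)"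
    and "Poly_Mapping.keys x \<subseteq> S \<Longrightarrow> Poly_Mapping.keys y \<subseteq> S \<Longrightarrow>
      tensor_coords M (x - y) = (\<lambda>b. tensor_coords M x b \<ominus>\<^bsub>M\<^esub> tensor_coords M y b)"
    and "tensor_coords M 0 = (\<lambda>_. \<zero>\<^bsub>M\<^esub>)"
    and "p \<in> carrier (free_right_module R B) \<Longrightarrow> m \<in> carrier M \<Longrightarrow>
      tensor_coords M (frag_of (p, m)) = (\<lambda>b. p b \<odot>\<^bsub>M\<^esub> m)"
proof -
  have f: "(\<lambda>(p, m). p b \<odot>\<^bsub>M\<^esub> m) \<in> S \<rightarrow> carrier M" for b
    using free_right_module_closed[of _ R B] by (auto simp: S_def smult_closed)
  note ev = eval_frag[OF M.abelian_group_axioms f]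
  show 2: "tensor_coords M (x + y) = (\<lambda>b. tensor_coords M x b \<oplus>\<^bsub>M\<^esub> tensor_coords M y b)"
    if "Poly_Mapping.keys x \<subseteq> S" "Poly_Mapping.keys y \<subseteq> S" for x y
    unfolding tensor_coords_def using ev(2) that by simp
  show 3: "tensor_coords M (x - y) = (\<lambda>b. tensor_coords M x b \<ominus>\<^bsub>M\<^esub> tensor_coords M y b)"
    if "Poly_Mapping.keys x \<subseteq> S" "Poly_Mapping.keys y \<subseteq> S" for x y
    unfolding tensor_coords_def using ev(3) that by simp
  show 4: "tensor_coords M 0 = (\<lambda>_. \<zero>\<^bsub>M\<^esub>)" by (simp add: tensor_coords_def eval_frag_def)
  show 5: "tensor_coords M (frag_of (p, m)) = (\<lambda>b. p b \<odot>\<^bsub>M\<^esub> m)"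
    if "p \<in> carrier (free_right_module R B)" "m \<in> carrier M" for p m
    unfolding tensor_coords_def using ev(5)[of "(p, m)"] that by (simp add: S_def)
  show "tensor_coords M x \<in> fin_supp B (\<lambda>_. M)" if "Poly_Mapping.keys x \<subseteq> S"
    using that
  proof (induction rule: free_Abelian_group_induct[consumes 1, case_names 1 2 3])
    case 1
    show ?case by (simp add: 4 fin_supp_zero M.abelian_group_axioms)
  next
    case (2 x y)
    then show ?case using fin_supp_minus[OF M.abelian_group_axioms] by (simp add: 3)
  next
    case (3 a)
    then obtain p m where a: "a = (p, m)" "p \<in> carrier (free_right_module R B)" "m \<in> carrier M" by (auto simp: S_def)
    have "(\<lambda>b. p b \<odot>\<^bsub>M\<^esub> m) \<in> fin_supp B (\<lambda>_. M)"
      by (rule fin_supp_hom[of p B "regular_module (opposite_ring R)"])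
        (use a in \<open>auto simp: free_right_module_sel[OF R.ring_axioms] smult_closed zero_smult\<close>)
    then show ?case using a by (simp add: 5)
  qed
qed

lemma tensor_coords_rels:
  assumes "x \<in> tensor_rels R (free_right_module R B) M"
  shows "tensor_coords M x = (\<lambda>_. \<zero>\<^bsub>M\<^esub>)"
  unfolding tensor_coords_def
  by (rule ext, rule eval_frag_rels[OF left_module_free_right assms])
    (auto simp: R.ring_axioms free_right_module_closed free_right_module_sel)

lemma tensor_coords_surj:
  assumes "z \<in> fin_supp B (\<lambda>_. M)"
  shows "\<exists>x. Poly_Mapping.keys x \<subseteq> carrier (free_right_module R B) \<times> carrier M \<and> tensor_coords M x = z"
  using M.abelian_group_axioms assms
proof (induction rule: fin_supp_induct)
  case zero
  show ?case by (rule exI[of _ 0]) (simp add: tensor_coords_props(4))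
next
  case (add y c m)
  let ?S = "carrier (free_right_module R B) \<times> carrier M"
  obtain x where x: "Poly_Mapping.keys x \<subseteq> ?S" "tensor_coords M x = y" using add.IH by blast
  have u: "unit_vec R c \<in> carrier (free_right_module R B)" by (rule unit_vec_closed[OF R.ring_axioms add.hyps(2)])
  let ?t = "frag_of (unit_vec R c, m)"
  have t: "Poly_Mapping.keys ?t \<subseteq> ?S" using u add.hyps by (simp add: keys_frag_of)
  have "tensor_coords M ?t = (\<lambda>i. if i = c then m else \<zero>\<^bsub>M\<^esub>)"
    using tensor_coords_props(5)[OF u add.hyps(3)] add.hyps(3)
    by (auto simp: unit_vec_def smult_one zero_smult)
  then have "tensor_coords M (x + ?t) = (\<lambda>i. y i \<oplus>\<^bsub>M\<^esub> (if i = c then m else \<zero>\<^bsub>M\<^esub>))"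
    using tensor_coords_props(2)[OF x(1) t] x(2) by simp
  then show ?case using keys_add[of x ?t] x(1) t by (intro exI[of _ "x + ?t"]) blast
qed

end

text \<open>Modulo the relations, every element is a sum of terms \<open>e\<^sub>b \<otimes> z b\<close>.\<close>

lemma (in left_module) tensor_coords_kernel:
  fixes B :: "'b set"
  defines "F \<equiv> free_right_module R B"
  assumes x: "Poly_Mapping.keys x \<subseteq> carrier F \<times> carrier M" and x0: "tensor_coords M x = (\<lambda>_. \<zero>\<^bsub>M\<^esub>)"
  shows "x \<in> tensor_rels R F M"
proof -
  note R = R.ring_axioms and Ml = left_module_axioms
  have Fl: "left_module (opposite_ring R) F" unfolding F_def by (rule left_module_free_right[OF R])
  let ?T = "tensor_rels R F M" and ?S = "carrier F \<times> carrier M"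
  note T = tensor_rels_closed[OF Fl Ml] and Ti = tensor_rels_intros[where P = F and M = M and R = R]
  let ?u = "unit_vec R"
  have u: "?u b \<in> carrier F" if "b \<in> B" for b unfolding F_def by (rule unit_vec_closed[OF R that])
  have Tsum: "(\<Sum>b\<in>S. t b) \<in> ?T" if "finite S" "\<And>b. b \<in> S \<Longrightarrow> t b \<in> ?T" for S :: "'b set" and t
    using that by (induction S rule: finite_induct) (auto simp: T)
  have T0: "frag_of (p, \<zero>\<^bsub>M\<^esub>) \<in> ?T" if "p \<in> carrier F" for p
    using Ti(2)[of p "\<zero>\<^bsub>M\<^esub>" "\<zero>\<^bsub>M\<^esub>"] that T(4)[of "- frag_of (p, \<zero>\<^bsub>M\<^esub>)"] by simp
  define \<sigma> where "\<sigma> z = (\<Sum>b\<in>{b. z b \<noteq> \<zero>\<^bsub>M\<^esub>}. frag_of (?u b, z b))" for z :: "'b \<Rightarrow> 'm"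
  \<comment> \<open>Enlarging the support adds only terms with second factor zero, and these are
    relations.\<close>
  have \<sigma>S: "(\<Sum>b\<in>S. frag_of (?u b, z b)) - \<sigma> z \<in> ?T"
    if S: "finite S" "S \<subseteq> B" "{b. z b \<noteq> \<zero>\<^bsub>M\<^esub>} \<subseteq> S" for S z
  proof -
    have "(\<Sum>b\<in>S. frag_of (?u b, z b)) - \<sigma> z = (\<Sum>b\<in>S - {b. z b \<noteq> \<zero>\<^bsub>M\<^esub>}. frag_of (?u b, z b))"
      unfolding \<sigma>_def using sum_diff[OF S(1,3), of "\<lambda>b. frag_of (?u b, z b)"] by simp
    also have "\<dots> \<in> ?T" by (rule Tsum) (use S u T0 in auto)
    finally show ?thesis .
  qed
  have \<sigma>add: "\<sigma> (\<lambda>b. z b \<oplus>\<^bsub>M\<^esub> w b) - \<sigma> z - \<sigma> w \<in> ?T"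
    if z: "z \<in> fin_supp B (\<lambda>_. M)" and w: "w \<in> fin_supp B (\<lambda>_. M)" for z w
  proof -
    let ?zw = "\<lambda>b. z b \<oplus>\<^bsub>M\<^esub> w b"
    let ?K = "{b. z b \<noteq> \<zero>\<^bsub>M\<^esub>} \<union> {b. w b \<noteq> \<zero>\<^bsub>M\<^esub>}"
    have K: "finite ?K" "?K \<subseteq> B" using z w by (auto simp: fin_supp_iff)
    have c: "z b \<in> carrier M" "w b \<in> carrier M" for b
      by (rule fin_supp_closed[OF M.abelian_group_axioms z], rule fin_supp_closed[OF M.abelian_group_axioms w])
    let ?s = "\<lambda>z. \<Sum>b\<in>?K. frag_of (?u b, z b)"
    have "?s ?zw - ?s z - ?s w = (\<Sum>b\<in>?K. frag_of (?u b, ?zw b) - frag_of (?u b, z b) - frag_of (?u b, w b))"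
      by (simp add: sum_subtractf)
    also have "\<dots> \<in> ?T"
      by (rule Tsum[OF K(1)], rule Ti(2)) (use K u c in auto)
    finally have 1: "?s ?zw - ?s z - ?s w \<in> ?T" .
    have 2: "?s ?zw - \<sigma> ?zw \<in> ?T" by (rule \<sigma>S) (use K in auto)
    have 3: "?s z - \<sigma> z \<in> ?T" by (rule \<sigma>S) (use K in auto)
    have 4: "?s w - \<sigma> w \<in> ?T" by (rule \<sigma>S) (use K in auto)
    have "\<sigma> ?zw - \<sigma> z - \<sigma> w = (?s ?zw - ?s z - ?s w) - (?s ?zw - \<sigma> ?zw) + (?s z - \<sigma> z) + (?s w - \<sigma> w)"
      by (simp add: algebra_simps)
    then show ?thesis using T(3)[OF T(3)[OF T(5)[OF 1 2] 3] 4] by simp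
  qed
  have \<sigma>coords: "tensor_coords M (\<sigma> z) = z" "Poly_Mapping.keys (\<sigma> z) \<subseteq> ?S" if z: "z \<in> fin_supp B (\<lambda>_. M)" for z
  proof -
    have c: "z b \<in> carrier M" for b by (rule fin_supp_closed[OF M.abelian_group_axioms z])
    have "Poly_Mapping.keys (\<Sum>b\<in>S. frag_of (?u b, z b)) \<subseteq> ?S \<and>
        tensor_coords M (\<Sum>b\<in>S. frag_of (?u b, z b)) = (\<lambda>a. if a \<in> S then z a else \<zero>\<^bsub>M\<^esub>)"
      if "finite S" "S \<subseteq> B" for S
      using that
    proof (induction S rule: finite_induct)
      case empty
      show ?case by (simp add: tensor_coords_props(4))
    next
      case (insert b S)
      let ?t = "frag_of (?u b, z b)" and ?r = "\<Sum>b\<in>S. frag_of (?u b, z b)"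
      have b: "b \<in> B" using insert.prems by simp
      have t: "Poly_Mapping.keys ?t \<subseteq> ?S" using u[OF b] c by (simp add: keys_frag_of)
      have r: "Poly_Mapping.keys ?r \<subseteq> ?S" "tensor_coords M ?r = (\<lambda>a. if a \<in> S then z a else \<zero>\<^bsub>M\<^esub>)"
        using insert by auto
      have "tensor_coords M ?t = (\<lambda>a. if a = b then z b else \<zero>\<^bsub>M\<^esub>)"
        using tensor_coords_props(5)[OF u[OF b, unfolded F_def] c[of b]] c[of b]
        by (auto simp: unit_vec_def smult_one zero_smult)
      then have "tensor_coords M (?t + ?r) = (\<lambda>a. if a \<in> insert b S then z a else \<zero>\<^bsub>M\<^esub>)"
        using tensor_coords_props(2)[OF t[unfolded F_def] r(1)[unfolded F_def]] r(2) insert.hyps(2) c by (auto simp: fun_eq_iff)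
      moreover have "Poly_Mapping.keys (?t + ?r) \<subseteq> ?S" using keys_add[of ?t ?r] t r(1) by blast
      ultimately show ?case using insert.hyps by simp
    qed
    moreover have "finite {b. z b \<noteq> \<zero>\<^bsub>M\<^esub>}" "{b. z b \<noteq> \<zero>\<^bsub>M\<^esub>} \<subseteq> B" using z by (auto simp: fin_supp_iff)
    ultimately have *: "Poly_Mapping.keys (\<sigma> z) \<subseteq> ?S \<and>
        tensor_coords M (\<sigma> z) = (\<lambda>a. if a \<in> {b. z b \<noteq> \<zero>\<^bsub>M\<^esub>} then z a else \<zero>\<^bsub>M\<^esub>)"
      unfolding \<sigma>_def by blast
    then show "Poly_Mapping.keys (\<sigma> z) \<subseteq> ?S" by (rule conjunct1)
    show "tensor_coords M (\<sigma> z) = z" unfolding conjunct2[OF *] by auto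
  qed
  \<comment> \<open>A pure tensor is treated one entry \<open>r\<close> of \<open>p\<close> at a
    time, by moving \<open>r\<close> from the unit vector across the tensor sign to
    \<open>m\<close>.\<close>
  have sing: "\<exists>z\<in>fin_supp B (\<lambda>_. M). frag_of (p, m) - \<sigma> z \<in> ?T" if p: "p \<in> carrier F" and m: "m \<in> carrier M" for p m
  proof -
    let ?reg = "regular_module (opposite_ring R)"
    have "p \<in> fin_supp B (\<lambda>_. ?reg)" using p unfolding F_def by (simp add: free_right_module_sel[OF R])
    with left_moduleE(2)[OF left_module_regular[OF ring_opposite_ring[OF R]]] show ?thesis
    proof (induction rule: fin_supp_induct)
      case zero
      have "(\<lambda>_. \<zero>\<^bsub>R\<^esub>) = \<zero>\<^bsub>F\<^esub>" by (simp add: F_def free_right_module_sel[OF R])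
      moreover have "frag_of (\<zero>\<^bsub>F\<^esub>, m) \<in> ?T"
        using Ti(1)[of "\<zero>\<^bsub>F\<^esub>" "\<zero>\<^bsub>F\<^esub>" m] m T(4)[of "- frag_of (\<zero>\<^bsub>F\<^esub>, m)"]
          abelian_groupE(2,5)[OF left_moduleE(2)[OF Fl]] by simp
      ultimately show ?case
        by (intro bexI[of _ "\<lambda>_. \<zero>\<^bsub>M\<^esub>"]) (simp_all add: \<sigma>_def fin_supp_zero M.abelian_group_axioms)
    next
      case (add y c r)
      obtain z where z: "z \<in> fin_supp B (\<lambda>_. M)" "frag_of (y, m) - \<sigma> z \<in> ?T" using add.IH by blast
      have yF: "y \<in> carrier F" using add.hyps by (simp add: F_def free_right_module_sel[OF R])
      have rR: "r \<in> carrier R" using add.hyps by simp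
      let ?s = "r \<odot>\<^bsub>F\<^esub> ?u c"
      have sF: "?s \<in> carrier F" using left_module.smult_closed[OF Fl, of r "?u c"] rR u[OF add.hyps(2)] by simp
      have s: "?s = (\<lambda>i. if i = c then r else \<zero>\<^bsub>R\<^esub>)"
        using rR by (auto simp: F_def free_right_module_sel[OF R] unit_vec_def)
      have ys: "(\<lambda>i. y i \<oplus>\<^bsub>?reg\<^esub> (if i = c then r else \<zero>\<^bsub>?reg\<^esub>)) = y \<oplus>\<^bsub>F\<^esub> ?s"
        unfolding s by (simp add: F_def free_right_module_sel[OF R] cong: if_cong)
      let ?w = "\<lambda>i. if i = c then r \<odot>\<^bsub>M\<^esub> m else \<zero>\<^bsub>M\<^esub>"
      have rm: "r \<odot>\<^bsub>M\<^esub> m \<in> carrier M" using rR m smult_closed by blast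
      have w: "?w \<in> fin_supp B (\<lambda>_. M)" by (rule fin_supp_single[OF M.abelian_group_axioms add.hyps(2) rm])
      have 1: "frag_of (y \<oplus>\<^bsub>F\<^esub> ?s, m) - frag_of (y, m) - frag_of (?s, m) \<in> ?T" by (rule Ti(1)[OF yF sF m])
      have 2: "frag_of (?s, m) - frag_of (?u c, r \<odot>\<^bsub>M\<^esub> m) \<in> ?T" by (rule Ti(3)[OF u[OF add.hyps(2)] rR m])
      have 3: "frag_of (?u c, r \<odot>\<^bsub>M\<^esub> m) - \<sigma> ?w \<in> ?T"
      proof -
        have "{b. ?w b \<noteq> \<zero>\<^bsub>M\<^esub>} \<subseteq> {c}" by auto
        then show ?thesis using \<sigma>S[of "{c}" ?w] add.hyps(2) by simp
      qed
      note 4 = \<sigma>add[OF z(1) w]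
      let ?zw = "\<lambda>b. z b \<oplus>\<^bsub>M\<^esub> ?w b"
      have "frag_of (y \<oplus>\<^bsub>F\<^esub> ?s, m) - \<sigma> ?zw =
          (frag_of (y \<oplus>\<^bsub>F\<^esub> ?s, m) - frag_of (y, m) - frag_of (?s, m)) + (frag_of (?s, m) - frag_of (?u c, r \<odot>\<^bsub>M\<^esub> m))
          + (frag_of (?u c, r \<odot>\<^bsub>M\<^esub> m) - \<sigma> ?w) + (frag_of (y, m) - \<sigma> z) - (\<sigma> ?zw - \<sigma> z - \<sigma> ?w)"
        by (simp add: algebra_simps)
      also have "\<dots> \<in> ?T" by (rule T(5)[OF T(3)[OF T(3)[OF T(3)[OF 1 2] 3] z(2)] 4])
      finally have "frag_of (y \<oplus>\<^bsub>F\<^esub> ?s, m) - \<sigma> ?zw \<in> ?T" .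
      then show ?case unfolding ys using fin_supp_add[OF M.abelian_group_axioms z(1) w] by blast
    qed
  qed
  have "\<exists>z\<in>fin_supp B (\<lambda>_. M). x - \<sigma> z \<in> ?T"
    using x
  proof (induction rule: free_Abelian_group_induct[consumes 1, case_names 1 2 3])
    case 1
    show ?case
      by (intro bexI[of _ "\<lambda>_. \<zero>\<^bsub>M\<^esub>"]) (simp_all add: \<sigma>_def T(2) fin_supp_zero M.abelian_group_axioms)
  next
    case (2 x y)
    then obtain z w where z: "z \<in> fin_supp B (\<lambda>_. M)" "x - \<sigma> z \<in> ?T" and w: "w \<in> fin_supp B (\<lambda>_. M)" "y - \<sigma> w \<in> ?T"
      by blast
    let ?d = "\<lambda>b. z b \<ominus>\<^bsub>M\<^esub> w b"
    have d: "?d \<in> fin_supp B (\<lambda>_. M)" by (rule fin_supp_minus[OF M.abelian_group_axioms z(1) w(1)])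
    have "(\<lambda>b. ?d b \<oplus>\<^bsub>M\<^esub> w b) = z"
      using M.minus_add_cancel fin_supp_closed[OF M.abelian_group_axioms z(1)] fin_supp_closed[OF M.abelian_group_axioms w(1)] by simp
    then have "\<sigma> z - \<sigma> ?d - \<sigma> w \<in> ?T" using \<sigma>add[OF d w(1)] by simp
    then have "(x - \<sigma> z) - (y - \<sigma> w) + (\<sigma> z - \<sigma> ?d - \<sigma> w) \<in> ?T"
      by (rule T(3)[OF T(5)[OF z(2) w(2)]])
    then have "(x - y) - \<sigma> ?d \<in> ?T" by (simp add: algebra_simps)
    then show ?case using d by blast
  next
    case (3 a)
    then show ?case using sing by auto
  qed
  then obtain z where z: "z \<in> fin_supp B (\<lambda>_. M)" "x - \<sigma> z \<in> ?T" by blast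
  \<comment> \<open>Congruent elements have equal coordinates, and those of
    \<open>\<sigma> z\<close> are \<open>z\<close>; so \<open>z\<close> is zero and \<open>x\<close>
    itself is a relation.\<close>
  have "(\<lambda>b. tensor_coords M x b \<ominus>\<^bsub>M\<^esub> tensor_coords M (\<sigma> z) b) = (\<lambda>_. \<zero>\<^bsub>M\<^esub>)"
    using tensor_coords_rels[OF z(2)[unfolded F_def]] tensor_coords_props(3)[OF x[unfolded F_def] \<sigma>coords(2)[OF z(1), unfolded F_def]]
    by simp
  then have "\<zero>\<^bsub>M\<^esub> \<ominus>\<^bsub>M\<^esub> z b = \<zero>\<^bsub>M\<^esub>" for b
    unfolding x0 \<sigma>coords(1)[OF z(1)] by (rule fun_cong)
  then have "z b = \<zero>\<^bsub>M\<^esub>" for b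
    using M.minus_eq_zero_iff[OF M.zero_closed fin_supp_closed[OF M.abelian_group_axioms z(1)]] by metis
  then have "\<sigma> z = 0" by (simp add: \<sigma>_def)
  then show ?thesis using z(2) by simp
qed

text \<open>A homomorphism on a free module is determined by the unit vectors, so it equals a linear
  combination of their images. This is what turns the differentials into matrices.\<close>

lemma free_hom_expand:
  assumes R: "ring R" and X: "left_module (opposite_ring R) X"
    and h: "h \<in> mod_hom R (free_right_module R B) X" and f: "f \<in> carrier (free_right_module R B)"
  defines "x \<equiv> \<lambda>b. if b \<in> B then h (unit_vec R b) else \<zero>\<^bsub>X\<^esub>"
  shows "h f = supp_sum X (\<lambda>b. f b \<odot>\<^bsub>X\<^esub> x b)" "f b \<odot>\<^bsub>X\<^esub> x b \<in> carrier X" "finite {b. f b \<odot>\<^bsub>X\<^esub> x b \<noteq> \<zero>\<^bsub>X\<^esub>}"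
proof -
  interpret R: ring R by fact
  interpret X: left_module "opposite_ring R" X by fact
  let ?F = "free_right_module R B"
  let ?reg = "regular_module (opposite_ring R)"
  note Fl = left_module_free_right[OF R, of B]
  have xc: "x b \<in> carrier X" for b using mod_homD(1)[OF h unit_vec_closed[OF R]] by (simp add: x_def)
  let ?l = "\<lambda>f. supp_sum X (\<lambda>b. f b \<odot>\<^bsub>X\<^esub> x b)"
  note l = linear_combination[of R X x, OF R X xc]
  have "finite {b. f b \<noteq> \<zero>\<^bsub>R\<^esub>}" using f by (simp add: free_right_module_def)
  then show "finite {b. f b \<odot>\<^bsub>X\<^esub> x b \<noteq> \<zero>\<^bsub>X\<^esub>}"
    by (rule rev_finite_subset) (use X.zero_smult[OF xc] in auto)
  show "f b \<odot>\<^bsub>X\<^esub> x b \<in> carrier X"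
    using X.smult_closed[of "f b" "x b"] xc free_right_module_closed[OF f] by simp
  have "f \<in> fin_supp B (\<lambda>_. ?reg)" using f by (simp add: free_right_module_sel[OF R])
  with left_moduleE(2)[OF left_module_regular[OF ring_opposite_ring[OF R]]]
  show "h f = ?l f"
  proof (induction rule: fin_supp_induct)
    case zero
    have "h (\<lambda>_. \<zero>\<^bsub>?reg\<^esub>) = \<zero>\<^bsub>X\<^esub>"
      using mod_hom_minus(1)[OF Fl X] h by (simp add: mod_hom_opposite free_right_module_sel[OF R])
    then show ?case
      using X.zero_smult[OF xc] by (simp add: X.supp_sum_zero)
  next
    case (add y c r)
    have yF: "y \<in> carrier ?F" using add.hyps by (simp add: free_right_module_sel[OF R])
    have rR: "r \<in> carrier R" using add.hyps by simp
    note u = unit_vec_closed[OF R add.hyps(2)]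
    have ys: "(\<lambda>i. y i \<oplus>\<^bsub>?reg\<^esub> (if i = c then r else \<zero>\<^bsub>?reg\<^esub>)) = y \<oplus>\<^bsub>?F\<^esub> (r \<odot>\<^bsub>?F\<^esub> unit_vec R c)"
      using rR by (auto simp: free_right_module_sel[OF R] unit_vec_def)
    have sF: "r \<odot>\<^bsub>?F\<^esub> unit_vec R c \<in> carrier ?F"
      using left_module.smult_closed[OF Fl, of r] rR u by simp
    have "h (unit_vec R c) = ?l (unit_vec R c)" using l(2)[of c] add.hyps by (simp add: x_def)
    then have "h (y \<oplus>\<^bsub>?F\<^esub> (r \<odot>\<^bsub>?F\<^esub> unit_vec R c)) = ?l (y \<oplus>\<^bsub>?F\<^esub> (r \<odot>\<^bsub>?F\<^esub> unit_vec R c))"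
      using mod_homD(2,3)[OF h] mod_homD(2,3)[OF l(1)] yF sF u rR add.IH by simp
    then show ?case unfolding ys[symmetric] .
  qed
qed

context left_module
begin

lemma supp_sum_smult:
  assumes "\<And>c. u c \<in> carrier R" "finite {c. u c \<noteq> \<zero>\<^bsub>R\<^esub>}" "m \<in> carrier M"
  shows "supp_sum R u \<odot>\<^bsub>M\<^esub> m = supp_sum M (\<lambda>c. u c \<odot>\<^bsub>M\<^esub> m)"
proof -
  have "(\<lambda>r. r \<odot>\<^bsub>M\<^esub> m) \<in> hom (add_monoid R) (add_monoid M)"
    using assms(3) by (auto simp: hom_def smult_closed smult_l_distr)
  from R.supp_sum_hom[OF M.abelian_group_axioms this assms(1,2)] show ?thesis .
qed

lemma mat_apply_coords:
  assumes Q: "\<And>a c. Q a c \<in> carrier R" and p: "p \<in> carrier (free_right_module R B)" and m: "m \<in> carrier M"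
  shows "mat_apply Q M (\<lambda>b. p b \<odot>\<^bsub>M\<^esub> m) a = supp_sum R (\<lambda>c. Q a c \<otimes>\<^bsub>R\<^esub> p c) \<odot>\<^bsub>M\<^esub> m"
proof -
  note pc = free_right_module_closed[OF p]
  have "finite {c. p c \<noteq> \<zero>\<^bsub>R\<^esub>}" using p by (simp add: free_right_module_def)
  then have fin: "finite {c. Q a c \<otimes>\<^bsub>R\<^esub> p c \<noteq> \<zero>\<^bsub>R\<^esub>}"
    by (rule rev_finite_subset) (use Q in auto)
  have "supp_sum R (\<lambda>c. Q a c \<otimes>\<^bsub>R\<^esub> p c) \<odot>\<^bsub>M\<^esub> m = supp_sum M (\<lambda>c. (Q a c \<otimes>\<^bsub>R\<^esub> p c) \<odot>\<^bsub>M\<^esub> m)"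
    by (rule supp_sum_smult) (use Q pc fin m in auto)
  then show ?thesis
    unfolding mat_apply_def using smult_assoc[OF Q pc m] by simp
qed

text \<open>In coordinates, tensoring \<open>h\<close> with \<open>M\<close> is multiplication by
  the matrix of \<open>h\<close>; by additivity only pure tensors have to be compared.\<close>

lemma tensor_coords_frag_fst:
  assumes h: "h \<in> mod_hom R (free_right_module R B1) (free_right_module R B2)"
    and Q: "\<And>a c. Q a c \<in> carrier R"
    and hQ: "\<And>p a. p \<in> carrier (free_right_module R B1) \<Longrightarrow> h p a = supp_sum R (\<lambda>c. Q a c \<otimes>\<^bsub>R\<^esub> p c)"
    and x: "Poly_Mapping.keys x \<subseteq> carrier (free_right_module R B1) \<times> carrier M"
  shows "tensor_coords M (frag_fst h x) = mat_apply Q M (tensor_coords M x)"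
  using x
proof (induction rule: free_Abelian_group_induct[consumes 1, case_names 1 2 3])
  case 1
  show ?case by (simp add: tensor_coords_props(4) mat_apply_zero Q)
next
  case (2 x y)
  have k: "Poly_Mapping.keys (frag_fst h z) \<subseteq> carrier (free_right_module R B2) \<times> carrier M"
    if "Poly_Mapping.keys z \<subseteq> carrier (free_right_module R B1) \<times> carrier M" for z
    by (rule frag_fst_keys[OF that]) (rule mod_homD(1)[OF h])
  show ?case
    using tensor_coords_props(3)[OF k k, OF 2(1,2)] tensor_coords_props(3)[OF 2(1,2)] 2(3,4)
      mat_apply_minus[where P = Q, OF Q tensor_coords_props(1) tensor_coords_props(1), OF 2(1,2)]
    by (simp add: frag_extend_diff)
next
  case (3 a)
  then obtain p m where a: "a = (p, m)" "p \<in> carrier (free_right_module R B1)" "m \<in> carrier M" by auto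
  have "tensor_coords M (frag_fst h (frag_of a)) = (\<lambda>b. h p b \<odot>\<^bsub>M\<^esub> m)"
    using tensor_coords_props(5)[OF mod_homD(1)[OF h a(2)] a(3)] a(1) by simp
  moreover have "tensor_coords M (frag_of a) = (\<lambda>b. p b \<odot>\<^bsub>M\<^esub> m)"
    using tensor_coords_props(5)[OF a(2,3)] a(1) by simp
  ultimately show ?case using mat_apply_coords[where Q = Q, OF Q a(2,3)] hQ[OF a(2)] by auto
qed

end


section \<open>Cosets\<close>

lemma trivial_group_Mod_iff:
  assumes H: "comm_group H" and N: "subgroup N H"
  shows "trivial_group (H Mod N) \<longleftrightarrow> carrier H \<subseteq> N"
proof -
  interpret comm_group H by fact
  have n: "N \<lhd> H" by (rule subgroup_imp_normal[OF N])
  have g: "group (H Mod N)" by (rule normal.factorgroup_is_group[OF n])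
  have c: "carrier (H Mod N) = (\<lambda>x. N #>\<^bsub>H\<^esub> x) ` carrier H" by (auto simp: FactGroup_def RCOSETS_def)
  have o: "\<one>\<^bsub>H Mod N\<^esub> = N" by (simp add: FactGroup_def)
  have j: "N #>\<^bsub>H\<^esub> x = N \<longleftrightarrow> x \<in> N" if "x \<in> carrier H" for x
    using coset_join1[OF _ that N] coset_join2[OF that N] by blast
  show ?thesis
  proof
    assume "trivial_group (H Mod N)"
    then have "(\<lambda>x. N #>\<^bsub>H\<^esub> x) ` carrier H = {N}" by (simp add: trivial_group_def c o)
    then show "carrier H \<subseteq> N" using j by blast
  next
    assume sub: "carrier H \<subseteq> N"
    have "(\<lambda>x. N #>\<^bsub>H\<^esub> x) ` carrier H = (\<lambda>x. N) ` carrier H"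
      by (rule image_cong[OF refl]) (use j sub in blast)
    also have "\<dots> = {N}" using one_closed by blast
    finally show "trivial_group (H Mod N)" by (simp add: trivial_group_def c o g)
  qed
qed

text \<open>Cosets written through representatives, so that equations between cosets become
  membership of a difference in the relations.\<close>

definition tensor_class ::
    "'r ring \<Rightarrow> ('r, 'p) module \<Rightarrow> ('r, 'm) module \<Rightarrow> ('p \<times> 'm \<Rightarrow>\<^sub>0 int) \<Rightarrow> ('p \<times> 'm \<Rightarrow>\<^sub>0 int) set" where
  "tensor_class R P M x = (\<lambda>t. t + x) ` tensor_rels R P M"

context
  fixes R :: "'r ring" and P :: "('r, 'p) module" and M :: "('r, 'm) module"
  assumes P: "left_module (opposite_ring R) P" and M: "left_module R M"
begin

lemma tensor_class_eq_iff:
  "tensor_class R P M x = tensor_class R P M y \<longleftrightarrow> x - y \<in> tensor_rels R P M"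
proof -
  note T = tensor_rels_closed[OF P M]
  show ?thesis
  proof
    assume eq: "tensor_class R P M x = tensor_class R P M y"
    have "0 + x \<in> tensor_class R P M x" unfolding tensor_class_def using T(2) by (rule imageI)
    then have "x \<in> tensor_class R P M y" using eq by simp
    then obtain t where "t \<in> tensor_rels R P M" "x = t + y" unfolding tensor_class_def by blast
    then show "x - y \<in> tensor_rels R P M" by simp
  next
    assume d: "x - y \<in> tensor_rels R P M"
    have "t + x \<in> tensor_class R P M y" "t + y \<in> tensor_class R P M x" if "t \<in> tensor_rels R P M" for t
    proof -
      have "(t + (x - y)) + y \<in> tensor_class R P M y" "(t - (x - y)) + x \<in> tensor_class R P M x"
        unfolding tensor_class_def by (rule imageI, rule T(3)[OF that d], rule imageI, rule T(5)[OF that d])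
      then show "t + x \<in> tensor_class R P M y" "t + y \<in> tensor_class R P M x" by (simp_all add: algebra_simps)
    qed
    then show "tensor_class R P M x = tensor_class R P M y" unfolding tensor_class_def[of R P M x] tensor_class_def[of R P M y]
      by (auto simp: tensor_class_def)
  qed
qed

lemma tensor_sel:
  "carrier (tensor R P M) = tensor_class R P M ` {x. Poly_Mapping.keys x \<subseteq> carrier P \<times> carrier M}"
  "\<one>\<^bsub>tensor R P M\<^esub> = tensor_class R P M 0"
  "\<lbrakk>Poly_Mapping.keys x \<subseteq> carrier P \<times> carrier M; Poly_Mapping.keys y \<subseteq> carrier P \<times> carrier M\<rbrakk> \<Longrightarrow>
    tensor_class R P M x \<otimes>\<^bsub>tensor R P M\<^esub> tensor_class R P M y = tensor_class R P M (x + y)"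
  "comm_group (tensor R P M)"
proof -
  let ?G = "free_Abelian_group (carrier P \<times> carrier M)" and ?T = "tensor_rels R P M"
  interpret G: comm_group ?G by (rule abelian_free_Abelian_group)
  note S = tensor_rels_subgroup[OF P M]
  have cl: "?T #>\<^bsub>?G\<^esub> x = tensor_class R P M x" for x by (auto simp: r_coset_def tensor_class_def)
  show "carrier (tensor R P M) = tensor_class R P M ` {x. Poly_Mapping.keys x \<subseteq> carrier P \<times> carrier M}"
    by (auto simp: tensor_def FactGroup_def RCOSETS_def cl)
  show "\<one>\<^bsub>tensor R P M\<^esub> = tensor_class R P M 0"
    by (simp add: tensor_def FactGroup_def tensor_class_def)
  show "tensor_class R P M x \<otimes>\<^bsub>tensor R P M\<^esub> tensor_class R P M y = tensor_class R P M (x + y)"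
    if "Poly_Mapping.keys x \<subseteq> carrier P \<times> carrier M" "Poly_Mapping.keys y \<subseteq> carrier P \<times> carrier M"
    using normal.rcos_sum[OF G.subgroup_imp_normal[OF S], of x y] that
    by (simp add: tensor_def FactGroup_def cl)
  show "comm_group (tensor R P M)"
    unfolding tensor_def by (rule G.abelian_FactGroup[OF S])
qed

end

text \<open>\<open>tensor_map\<close> applies \<open>f\<close> to all representatives and adds all
  relations of the target. The result is one coset because \<open>f\<close> carries relations to
  relations.\<close>

lemma tensor_map_class:
  assumes P: "left_module (opposite_ring R) P" and Q: "left_module (opposite_ring R) Q" and M: "left_module R M"
    and f: "f \<in> mod_hom R P Q"
  shows "tensor_map R Q M f (tensor_class R P M x) = tensor_class R Q M (frag_fst f x)"
proof -
  note T = tensor_rels_closed[OF P M] and U = tensor_rels_closed[OF Q M]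
  have "tensor_map R Q M f (tensor_class R P M x) = {u + frag_fst f (t + x) | u t. u \<in> tensor_rels R Q M \<and> t \<in> tensor_rels R P M}"
    unfolding tensor_map_def tensor_class_def set_mult_def by auto
  also have "\<dots> = tensor_class R Q M (frag_fst f x)"
  proof (intro equalityI subsetI)
    fix y assume "y \<in> {u + frag_fst f (t + x) | u t. u \<in> tensor_rels R Q M \<and> t \<in> tensor_rels R P M}"
    then obtain u t where ut: "y = (u + frag_fst f t) + frag_fst f x" "u \<in> tensor_rels R Q M" "t \<in> tensor_rels R P M"
      by (auto simp: frag_extend_add add.assoc)
    show "y \<in> tensor_class R Q M (frag_fst f x)"
      unfolding tensor_class_def ut(1) by (rule imageI) (rule U(3)[OF ut(2) frag_fst_tensor_rels[OF P Q M f ut(3)]])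
  next
    fix y assume "y \<in> tensor_class R Q M (frag_fst f x)"
    then obtain u where "u \<in> tensor_rels R Q M" "y = u + frag_fst f (0 + x)" by (auto simp: tensor_class_def)
    then show "y \<in> {u + frag_fst f (t + x) | u t. u \<in> tensor_rels R Q M \<and> t \<in> tensor_rels R P M}"
      using T(2) by blast
  qed
  finally show ?thesis .
qed

lemma tensor_map_hom:
  assumes P: "left_module (opposite_ring R) P" and Q: "left_module (opposite_ring R) Q" and M: "left_module R M"
    and f: "f \<in> mod_hom R P Q"
  shows "group_hom (tensor R P M) (tensor R Q M) (tensor_map R Q M f)"
proof -
  have k: "Poly_Mapping.keys (frag_fst f x) \<subseteq> carrier Q \<times> carrier M"
    if "Poly_Mapping.keys x \<subseteq> carrier P \<times> carrier M" for x
    by (rule frag_fst_keys[OF that]) (rule mod_homD(1)[OF f])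
  note s = tensor_sel[OF P M] and s' = tensor_sel[OF Q M]
  have "tensor_map R Q M f \<in> hom (tensor R P M) (tensor R Q M)"
  proof (rule homI)
    show "tensor_map R Q M f X \<in> carrier (tensor R Q M)" if "X \<in> carrier (tensor R P M)" for X
      using that k by (auto simp: s(1) s'(1) tensor_map_class[OF P Q M f])
    show "tensor_map R Q M f (X \<otimes>\<^bsub>tensor R P M\<^esub> Y) = tensor_map R Q M f X \<otimes>\<^bsub>tensor R Q M\<^esub> tensor_map R Q M f Y"
      if "X \<in> carrier (tensor R P M)" "Y \<in> carrier (tensor R P M)" for X Y
      using that k by (auto simp: s(1,3) s'(3) tensor_map_class[OF P Q M f] frag_extend_add)
  qed
  then show ?thesis
    using comm_group.axioms(2)[OF s(4)] comm_group.axioms(2)[OF s'(4)] by (simp add: group_hom_def group_hom_axioms_def)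
qed

text \<open>Trivial homology says that every cycle is congruent to a boundary. Stated on
  representatives, it removes cosets from the computation of \<open>Tor\<close>; \<open>fg\<close>
  ensures that boundaries are cycles, so that the quotient makes sense.\<close>

lemma homology_trivial_iff:
  assumes P0: "left_module (opposite_ring R) P0" and P1: "left_module (opposite_ring R) P1"
    and P2: "left_module (opposite_ring R) P2" and M: "left_module R M"
    and f: "f \<in> mod_hom R P1 P0" and g: "g \<in> mod_hom R P2 P1"
    and fg: "\<And>x. Poly_Mapping.keys x \<subseteq> carrier P2 \<times> carrier M \<Longrightarrow> frag_fst f (frag_fst g x) \<in> tensor_rels R P0 M"
  shows "trivial_group ((tensor R P1 M)\<lparr>carrier := kernel (tensor R P1 M) (tensor R P0 M) (tensor_map R P0 M f)\<rparr>
      Mod (tensor_map R P1 M g ` carrier (tensor R P2 M))) \<longleftrightarrow>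
    (\<forall>x. Poly_Mapping.keys x \<subseteq> carrier P1 \<times> carrier M \<longrightarrow> frag_fst f x \<in> tensor_rels R P0 M \<longrightarrow>
      (\<exists>y. Poly_Mapping.keys y \<subseteq> carrier P2 \<times> carrier M \<and> x - frag_fst g y \<in> tensor_rels R P1 M))"
    (is "trivial_group (?T1\<lparr>carrier := ?Z\<rparr> Mod ?N) \<longleftrightarrow> ?rhs")
proof -
  let ?S = "\<lambda>P. {x. Poly_Mapping.keys x \<subseteq> carrier P \<times> carrier M}"
  note s0 = tensor_sel[OF P0 M] and s1 = tensor_sel[OF P1 M] and s2 = tensor_sel[OF P2 M]
  note e0 = tensor_class_eq_iff[OF P0 M] and e1 = tensor_class_eq_iff[OF P1 M]
  interpret T1: comm_group ?T1 by (rule s1(4))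
  interpret fh: group_hom ?T1 "tensor R P0 M" "tensor_map R P0 M f" by (rule tensor_map_hom[OF P1 P0 M f])
  interpret gh: group_hom "tensor R P2 M" ?T1 "tensor_map R P1 M g" by (rule tensor_map_hom[OF P2 P1 M g])
  have Z: "?Z = tensor_class R P1 M ` {x \<in> ?S P1. frag_fst f x \<in> tensor_rels R P0 M}"
  proof -
    have "tensor_map R P0 M f (tensor_class R P1 M x) = \<one>\<^bsub>tensor R P0 M\<^esub> \<longleftrightarrow> frag_fst f x \<in> tensor_rels R P0 M" for x
      by (simp add: s0(2) tensor_map_class[OF P1 P0 M f] e0)
    then show ?thesis unfolding kernel_def s1(1) by blast
  qed
  have N: "?N = tensor_class R P1 M ` frag_fst g ` ?S P2"
    by (auto simp: s2(1) tensor_map_class[OF P2 P1 M g] image_image)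
  have kg: "frag_fst g x \<in> ?S P1" if "x \<in> ?S P2" for x
    using that frag_fst_keys[of x "carrier P2" "carrier M" g "carrier P1"] mod_homD(1)[OF g] by simp
  have NZ: "?N \<subseteq> ?Z" unfolding N Z using kg fg by blast
  have Zs: "subgroup ?Z ?T1" by (rule fh.subgroup_kernel)
  have Ns: "subgroup ?N (?T1\<lparr>carrier := ?Z\<rparr>)" by (rule T1.subgroup_incl[OF gh.img_is_subgroup Zs NZ])
  have "comm_group (?T1\<lparr>carrier := ?Z\<rparr>)"
  proof (rule group.group_comm_groupI[OF subgroup.subgroup_is_group[OF Zs T1.is_group]])
    show "x \<otimes>\<^bsub>?T1\<lparr>carrier := ?Z\<rparr>\<^esub> y = y \<otimes>\<^bsub>?T1\<lparr>carrier := ?Z\<rparr>\<^esub> x"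
      if "x \<in> carrier (?T1\<lparr>carrier := ?Z\<rparr>)" "y \<in> carrier (?T1\<lparr>carrier := ?Z\<rparr>)" for x y
      using that subgroup.mem_carrier[OF Zs] T1.m_comm by simp
  qed
  from trivial_group_Mod_iff[OF this Ns]
  have "trivial_group (?T1\<lparr>carrier := ?Z\<rparr> Mod ?N) \<longleftrightarrow> ?Z \<subseteq> ?N" by simp
  also have "\<dots> \<longleftrightarrow> (\<forall>x\<in>{x \<in> ?S P1. frag_fst f x \<in> tensor_rels R P0 M}. \<exists>y\<in>?S P2.
      tensor_class R P1 M x = tensor_class R P1 M (frag_fst g y))"
    unfolding Z N by (auto simp: image_subset_iff image_iff)
  also have "\<dots> \<longleftrightarrow> ?rhs" unfolding e1 by auto
  finally show ?thesis .
qed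

section \<open>H-unitary modules as exact modules\<close>

text \<open>The relation of additivity for 0 + 0 = 0 is the negative of this element.\<close>

lemma tensor_rels_zero_left:
  assumes P: "left_module (opposite_ring R) P" and M: "left_module R M" and m: "m \<in> carrier M"
  shows "frag_of (\<zero>\<^bsub>P\<^esub>, m) \<in> tensor_rels R P M"
proof -
  interpret P: left_module "opposite_ring R" P by fact
  show ?thesis
    using tensor_rels_intros(1)[where P = P and M = M and R = R, of "\<zero>\<^bsub>P\<^esub>" "\<zero>\<^bsub>P\<^esub>" m] m
      tensor_rels_closed(4)[OF P M, of "- frag_of (\<zero>\<^bsub>P\<^esub>, m)"] by simp
qed

context left_module
begin

lemma tensor_coords_diff_iff:
  assumes x: "Poly_Mapping.keys x \<subseteq> carrier (free_right_module R B) \<times> carrier M"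
    and y: "Poly_Mapping.keys y \<subseteq> carrier (free_right_module R B) \<times> carrier M"
  shows "x - y \<in> tensor_rels R (free_right_module R B) M \<longleftrightarrow> tensor_coords M x = tensor_coords M y"
proof -
  have d: "Poly_Mapping.keys (x - y) \<subseteq> carrier (free_right_module R B) \<times> carrier M"
    using keys_diff[of x y] x y by blast
  have c: "tensor_coords M x b \<in> carrier M" "tensor_coords M y b \<in> carrier M" for b
    by (rule fin_supp_closed[OF M.abelian_group_axioms tensor_coords_props(1)[OF x]],
        rule fin_supp_closed[OF M.abelian_group_axioms tensor_coords_props(1)[OF y]])
  have "x - y \<in> tensor_rels R (free_right_module R B) M \<longleftrightarrow> tensor_coords M (x - y) = (\<lambda>_. \<zero>\<^bsub>M\<^esub>)"
    using tensor_coords_rels tensor_coords_kernel[OF d] by blast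
  also have "\<dots> \<longleftrightarrow> tensor_coords M x = tensor_coords M y"
    unfolding tensor_coords_props(3)[OF x y] fun_eq_iff by (simp add: M.minus_eq_zero_iff[OF c])
  finally show ?thesis .
qed

lemma tensor_coords_zero_iff:
  assumes "Poly_Mapping.keys x \<subseteq> carrier (free_right_module R B) \<times> carrier M"
  shows "x \<in> tensor_rels R (free_right_module R B) M \<longleftrightarrow> tensor_coords M x = (\<lambda>_. \<zero>\<^bsub>M\<^esub>)"
  using tensor_coords_diff_iff[OF assms, of 0] by (simp add: tensor_coords_props(4))

end

text \<open>Any free resolution of the ideal. That it is the one chosen in the definition of
  \<open>Tor\<close> enters as a separate hypothesis where \<open>Tor\<close> appears.\<close>

locale ideal_resolution =
  fixes R :: "'r ring" (structure) and A :: "'r set" and B :: "nat \<Rightarrow> ('r, 'r) basis set"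
    and d :: "nat \<Rightarrow> (('r, 'r) basis \<Rightarrow> 'r) \<Rightarrow> (('r, 'r) basis \<Rightarrow> 'r)" and eps :: "(('r, 'r) basis \<Rightarrow> 'r) \<Rightarrow> 'r"
  assumes ideal: "ideal A R" and res: "free_resolution R (ideal_right_module R A) B d eps"
begin

abbreviation "FR n \<equiv> free_right_module R (B n)"
abbreviation "AR \<equiv> ideal_right_module R A"

lemma ring_R: "ring R" using ideal by (simp add: ideal_def)

lemma FR_module: "left_module (opposite_ring R) (FR n)" by (rule left_module_free_right[OF ring_R])

lemma AR_module: "left_module (opposite_ring R) AR" by (rule left_module_ideal_right[OF ideal])

lemma AR_sel: "carrier AR = A" "\<zero>\<^bsub>AR\<^esub> = \<zero>" "x \<oplus>\<^bsub>AR\<^esub> y = x \<oplus> y" "r \<odot>\<^bsub>AR\<^esub> x = x \<otimes> r"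
  by (simp_all add: ideal_right_module_def)

lemma A_subset: "a \<in> A \<Longrightarrow> a \<in> carrier R"
  using ideal by (meson additive_subgroup.a_Hcarr ideal.axioms(1))

lemma d_hom: "d n \<in> mod_hom R (FR (Suc n)) (FR n)"
  and eps_hom: "eps \<in> mod_hom R (FR 0) AR"
  and eps_surj: "eps ` carrier (FR 0) = A"
  and d_image_0: "d 0 ` carrier (FR (Suc 0)) = {f \<in> carrier (FR 0). eps f = \<zero>}"
  and d_image_Suc: "d (Suc n) ` carrier (FR (Suc (Suc n))) = {f \<in> carrier (FR (Suc n)). d n f = (\<lambda>_. \<zero>)}"
  using res unfolding free_resolution_def Let_def a_kernel_eq by (simp_all add: AR_sel free_right_module_sel[OF ring_R])

text \<open>The resolution augmented by \<open>eps\<close> and shifted by two, so that degree 1 is \<open>R\<close> itself with the single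
  basis element \<open>[]\<close>.\<close>

definition cbasis :: "nat \<Rightarrow> ('r, 'r) basis set" where
  "cbasis n = (case n of 0 \<Rightarrow> {} | Suc k \<Rightarrow> (case k of 0 \<Rightarrow> {[]} | Suc j \<Rightarrow> B j))"

text \<open>The columns are images of unit vectors. By the shift, index 0 is the zero map out of
  \<open>R\<close>, index 1 the augmentation, and index \<open>j + 2\<close> the map
  \<open>d j\<close>.\<close>

definition cmat :: "nat \<Rightarrow> ('r, 'r) basis \<Rightarrow> ('r, 'r) basis \<Rightarrow> 'r" where
  "cmat n b c = (case n of 0 \<Rightarrow> \<zero> | Suc k \<Rightarrow> (case k of
     0 \<Rightarrow> if b = [] \<and> c \<in> B 0 then eps (unit_vec R c) else \<zero>
   | Suc j \<Rightarrow> if c \<in> B (Suc j) then d j (unit_vec R c) b else \<zero>))"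

lemma cbasis_simps [simp]: "cbasis 0 = {}" "cbasis (Suc 0) = {[]}" "cbasis (Suc (Suc j)) = B j"
  by (simp_all add: cbasis_def)

lemma cmat_simps: "cmat 0 b c = \<zero>"
  "cmat (Suc 0) b c = (if b = [] \<and> c \<in> B 0 then eps (unit_vec R c) else \<zero>)"
  "cmat (Suc (Suc j)) b c = (if c \<in> B (Suc j) then d j (unit_vec R c) b else \<zero>)"
  by (simp_all add: cmat_def)

text \<open>Scalars act from the right on \<open>FR n\<close>, so the matrix entries stand on the
  left.\<close>

lemma d_expand:
  assumes f: "f \<in> carrier (FR (Suc n))"
  shows "d n f a = supp_sum R (\<lambda>c. cmat (Suc (Suc n)) a c \<otimes> f c)"
proof -
  interpret R: ring R by (rule ring_R)
  note e = free_hom_expand[OF ring_R FR_module d_hom f]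
  have "(\<lambda>g. g a) \<in> hom (add_monoid (FR n)) (add_monoid R)"
    by (auto simp: hom_def free_right_module_closed free_right_module_sel[OF ring_R] simp del: free_right_module_sel(1))
  from abelian_group.supp_sum_hom[OF left_moduleE(2)[OF FR_module] R.abelian_group_axioms this e(2,3)]
  show ?thesis
    unfolding e(1) by (simp add: free_right_module_sel[OF ring_R] cmat_simps if_distrib[of "\<lambda>g. g a"] cong: if_cong)
qed

lemma eps_expand:
  assumes f: "f \<in> carrier (FR 0)"
  shows "eps f = supp_sum R (\<lambda>c. cmat (Suc 0) [] c \<otimes> f c)"
proof -
  interpret R: ring R by (rule ring_R)
  note e = free_hom_expand[OF ring_R AR_module eps_hom f]
  have "(\<lambda>g. g) \<in> hom (add_monoid AR) (add_monoid R)"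
    by (auto simp: hom_def AR_sel A_subset)
  from abelian_group.supp_sum_hom[OF left_moduleE(2)[OF AR_module] R.abelian_group_axioms this e(2,3)]
  show ?thesis
    unfolding e(1) by (simp add: AR_sel cmat_simps cong: if_cong)
qed

lemma cmat_closed: "cmat n b c \<in> carrier R"
proof -
  interpret R: ring R by (rule ring_R)
  have "eps (unit_vec R c) \<in> carrier R" if "c \<in> B 0"
    using mod_homD(1)[OF eps_hom unit_vec_closed[OF ring_R that]] A_subset by (simp add: AR_sel)
  moreover have "d j (unit_vec R c) b \<in> carrier R" if "c \<in> B (Suc j)" for j
    by (rule free_right_module_closed[OF mod_homD(1)[OF d_hom unit_vec_closed[OF ring_R that]]])
  ultimately show ?thesis
    by (auto simp: cmat_def split: nat.splits)
qed

text \<open>Consecutive matrices multiply to zero because a column of the second is the image of a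
  unit vector and so lies in the kernel of the first map.\<close>

sublocale mat_complex R cbasis cmat
proof -
  interpret R: ring R by (rule ring_R)
  have dF: "d j (unit_vec R c) \<in> carrier (FR j)" if "c \<in> B (Suc j)" for j c
    by (rule mod_homD(1)[OF d_hom unit_vec_closed[OF ring_R that]])
  show "mat_complex R cbasis cmat"
  proof (unfold_locales)
    show "cbasis 0 = {}" by simp
    show "cmat n b c \<in> carrier R" for n b c by (rule cmat_closed)
    show "cmat n b c = \<zero>" if "b \<notin> cbasis n" for n b c
    proof (cases n)
      case 0
      then show ?thesis by (simp add: cmat_simps)
    next
      case (Suc k)
      then show ?thesis using that dF by (cases k) (auto simp: cmat_simps free_right_module_def)
    qed
    show "finite {b. cmat n b c \<noteq> \<zero>}" for n c
    proof (cases n)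
      case 0
      then show ?thesis by (simp add: cmat_simps)
    next
      case (Suc k)
      then show ?thesis using dF by (cases k) (auto simp: cmat_simps free_right_module_def)
    qed
    show "supp_sum R (\<lambda>b. cmat n a b \<otimes> cmat (Suc n) b c) = \<zero>" if c: "c \<in> cbasis (Suc (Suc n))" for n a c
    proof (cases n)
      case 0
      then show ?thesis by (simp add: cmat_simps(1) cmat_closed R.supp_sum_zero)
    next
      case (Suc k)
      show ?thesis
      proof (cases k)
        case 0
        show ?thesis
        proof (cases "a = []")
          case True
          have "d 0 (unit_vec R c) \<in> {f \<in> carrier (FR 0). eps f = \<zero>}"
            unfolding d_image_0[symmetric] using c Suc 0 by (intro imageI unit_vec_closed[OF ring_R]) simp
          then have "supp_sum R (\<lambda>b. cmat (Suc 0) [] b \<otimes> d 0 (unit_vec R c) b) = \<zero>"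
            using eps_expand by auto
          then show ?thesis using Suc 0 c True by (simp add: cmat_simps(3))
        next
          case False
          then show ?thesis using Suc 0 by (simp add: cmat_simps(2) cmat_closed R.supp_sum_zero)
        qed
      next
        case (Suc j)
        have "d (Suc j) (unit_vec R c) \<in> {f \<in> carrier (FR (Suc j)). d j f = (\<lambda>_. \<zero>)}"
          unfolding d_image_Suc[symmetric]
          using c \<open>n = Suc k\<close> Suc by (intro imageI unit_vec_closed[OF ring_R]) simp
        then have "supp_sum R (\<lambda>b. cmat (Suc (Suc j)) a b \<otimes> d (Suc j) (unit_vec R c) b) = \<zero>"
          using d_expand[of "d (Suc j) (unit_vec R c)" j a] by auto
        then show ?thesis using \<open>n = Suc k\<close> Suc c by (simp add: cmat_simps(3)[of "Suc j"])
      qed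
    qed
  qed
qed

abbreviation "aug M w \<equiv> mat_apply (cmat (Suc 0)) M w []"

text \<open>The lowest two degrees are separated from the rest. In degree 1 a chain is its entry at
  \<open>[]\<close>, an element of \<open>M\<close>, so exactness there says that the augmentation
  is onto.\<close>

lemma exact_module_iff:
  assumes M: "left_module R M"
  shows "exact_module M \<longleftrightarrow>
    (\<forall>m\<in>carrier M. \<exists>w\<in>fin_supp (B 0) (\<lambda>_. M). aug M w = m) \<and>
    (\<forall>z\<in>fin_supp (B 0) (\<lambda>_. M). aug M z = \<zero>\<^bsub>M\<^esub> \<longrightarrow>
       (\<exists>w\<in>fin_supp (B (Suc 0)) (\<lambda>_. M). mat_apply (cmat (Suc (Suc 0))) M w = z)) \<and>
    (\<forall>n. \<forall>z\<in>fin_supp (B (Suc n)) (\<lambda>_. M). mat_apply (cmat (Suc (Suc n))) M z = (\<lambda>_. \<zero>\<^bsub>M\<^esub>) \<longrightarrow>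
       (\<exists>w\<in>fin_supp (B (Suc (Suc n))) (\<lambda>_. M). mat_apply (cmat (Suc (Suc (Suc n)))) M w = z))"
    (is "_ \<longleftrightarrow> ?C0 \<and> ?C1 \<and> ?C2")
proof -
  interpret M: left_module R M by fact
  define E where "E n \<longleftrightarrow> (\<forall>z\<in>chains (Suc n) M. bdry n M z = (\<lambda>_. \<zero>\<^bsub>M\<^esub>) \<longrightarrow>
        (\<exists>w\<in>chains (Suc (Suc n)) M. bdry (Suc n) M w = z))" for n
  have ex: "exact_module M \<longleftrightarrow> E 0 \<and> E (Suc 0) \<and> (\<forall>n. E (Suc (Suc n)))"
    using M unfolding exact_module_def E_def[symmetric] by (metis not0_implies_Suc)
  have b1: "bdry (Suc 0) M w = (\<lambda>b. if b = [] then aug M w else \<zero>\<^bsub>M\<^esub>)" if "w \<in> fin_supp (B 0) (\<lambda>_. M)" for w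
  proof
    have "bdry (Suc 0) M w \<in> chains (Suc 0) M" by (rule bdry_closed[OF M]) (simp add: chains_def that)
    then show "bdry (Suc 0) M w b = (if b = [] then aug M w else \<zero>\<^bsub>M\<^esub>)" for b
      by (auto simp: chains_def fin_supp_iff bdry_def)
  qed
  have "E 0 \<longleftrightarrow> ?C0"
  proof
    assume E: "E 0"
    show ?C0
    proof
      fix m assume m: "m \<in> carrier M"
      let ?z = "\<lambda>b. if b = [] then m else \<zero>\<^bsub>M\<^esub>"
      have z: "?z \<in> chains (Suc 0) M"
        unfolding chains_def by (rule fin_supp_single[OF M.abelian_group_axioms _ m]) simp
      have "bdry 0 M ?z = (\<lambda>_. \<zero>\<^bsub>M\<^esub>)" using chains_0[OF bdry_closed[OF M z]] .
      then obtain w where "w \<in> fin_supp (B 0) (\<lambda>_. M)" "bdry (Suc 0) M w = ?z"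
        using E z unfolding E_def by (auto simp: chains_def)
      then show "\<exists>w\<in>fin_supp (B 0) (\<lambda>_. M). aug M w = m"
        using fun_cong[of "bdry (Suc 0) M w" ?z "[]"] by (intro bexI[of _ w]) (simp_all add: bdry_def)
    qed
  next
    assume C: ?C0
    show "E 0"
      unfolding E_def
    proof (intro ballI impI)
      fix z assume z: "z \<in> chains (Suc 0) M"
      obtain w where w: "w \<in> fin_supp (B 0) (\<lambda>_. M)" "aug M w = z []"
        using C chains_closed[OF M z] by blast
      have "bdry (Suc 0) M w = z"
        unfolding b1[OF w(1)] w(2) using z by (auto simp: chains_def fin_supp_iff)
      then show "\<exists>w\<in>chains (Suc (Suc 0)) M. bdry (Suc 0) M w = z" using w(1) by (auto simp: chains_def)
    qed
  qed
  moreover have "E (Suc 0) \<longleftrightarrow> ?C1"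
  proof -
    have "bdry (Suc 0) M z = (\<lambda>_. \<zero>\<^bsub>M\<^esub>) \<longleftrightarrow> aug M z = \<zero>\<^bsub>M\<^esub>" if "z \<in> fin_supp (B 0) (\<lambda>_. M)" for z
      unfolding b1[OF that] by (auto simp: fun_eq_iff)
    then show ?thesis unfolding E_def by (simp add: chains_def bdry_def)
  qed
  moreover have "(\<forall>n. E (Suc (Suc n))) \<longleftrightarrow> ?C2"
    unfolding E_def by (simp add: chains_def bdry_def)
  ultimately show ?thesis using ex by blast
qed

text \<open>\<open>homology_trivial_iff\<close> gives a statement on representatives, in which only
  coordinates matter. As every family occurs as coordinates, the quantifiers can range over
  families.\<close>

lemma Tor_trivial_iff:
  assumes M: "left_module R M" and ch: "chosen_resolution R AR = (B, d, eps)"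
  shows "trivial_group (Tor R AR M (Suc n)) \<longleftrightarrow>
    (\<forall>z\<in>fin_supp (B (Suc n)) (\<lambda>_. M). mat_apply (cmat (Suc (Suc n))) M z = (\<lambda>_. \<zero>\<^bsub>M\<^esub>) \<longrightarrow>
       (\<exists>w\<in>fin_supp (B (Suc (Suc n))) (\<lambda>_. M). mat_apply (cmat (Suc (Suc (Suc n)))) M w = z))"
    (is "_ \<longleftrightarrow> ?rhs")
proof -
  interpret M: left_module R M by fact
  let ?K = "\<lambda>n. {x. Poly_Mapping.keys x \<subseteq> carrier (FR n) \<times> carrier M}"
  have kd: "Poly_Mapping.keys (frag_fst (d k) x) \<subseteq> carrier (FR k) \<times> carrier M"
    if "Poly_Mapping.keys x \<subseteq> carrier (FR (Suc k)) \<times> carrier M" for k x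
    by (rule frag_fst_keys[OF that]) (rule mod_homD(1)[OF d_hom])
  have cd: "tensor_coords M (frag_fst (d k) x) = mat_apply (cmat (Suc (Suc k))) M (tensor_coords M x)"
    if "Poly_Mapping.keys x \<subseteq> carrier (FR (Suc k)) \<times> carrier M" for k x
    by (rule M.tensor_coords_frag_fst[OF d_hom cmat_closed d_expand that])
  have ch': "tensor_coords M x \<in> fin_supp (B k) (\<lambda>_. M)"
    if "Poly_Mapping.keys x \<subseteq> carrier (FR k) \<times> carrier M" for k x
    by (rule M.tensor_coords_props(1)[OF that])
  have dd: "frag_fst (d n) (frag_fst (d (Suc n)) x) \<in> tensor_rels R (FR n) M"
    if x: "Poly_Mapping.keys x \<subseteq> carrier (FR (Suc (Suc n))) \<times> carrier M" for x
  proof -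
    have "tensor_coords M (frag_fst (d n) (frag_fst (d (Suc n)) x)) = (\<lambda>_. \<zero>\<^bsub>M\<^esub>)"
      using bdry_bdry[OF M, of "tensor_coords M x" "Suc (Suc n)"] ch'[OF x]
      by (simp add: cd[OF kd[OF x]] cd[OF x] chains_def bdry_def)
    then show ?thesis using M.tensor_coords_zero_iff[OF kd[OF kd[OF x]]] by simp
  qed
  have 1: "frag_fst (d n) x \<in> tensor_rels R (FR n) M \<longleftrightarrow> mat_apply (cmat (Suc (Suc n))) M (tensor_coords M x) = (\<lambda>_. \<zero>\<^bsub>M\<^esub>)"
    if "Poly_Mapping.keys x \<subseteq> carrier (FR (Suc n)) \<times> carrier M" for x
    using M.tensor_coords_zero_iff[OF kd[OF that]] cd[OF that] by simp
  have 2: "x - frag_fst (d (Suc n)) y \<in> tensor_rels R (FR (Suc n)) M \<longleftrightarrow>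
      mat_apply (cmat (Suc (Suc (Suc n)))) M (tensor_coords M y) = tensor_coords M x"
    if "Poly_Mapping.keys x \<subseteq> carrier (FR (Suc n)) \<times> carrier M"
      "Poly_Mapping.keys y \<subseteq> carrier (FR (Suc (Suc n))) \<times> carrier M" for x y
    unfolding M.tensor_coords_diff_iff[OF that(1) kd[OF that(2)]] cd[OF that(2)] by auto
  have "trivial_group (Tor R AR M (Suc n)) \<longleftrightarrow>
    (\<forall>x. Poly_Mapping.keys x \<subseteq> carrier (FR (Suc n)) \<times> carrier M \<longrightarrow> frag_fst (d n) x \<in> tensor_rels R (FR n) M \<longrightarrow>
      (\<exists>y. Poly_Mapping.keys y \<subseteq> carrier (FR (Suc (Suc n))) \<times> carrier M \<and>
        x - frag_fst (d (Suc n)) y \<in> tensor_rels R (FR (Suc n)) M))"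
    unfolding Tor_def ch Let_def prod.case nat.case
    by (rule homology_trivial_iff[OF FR_module FR_module FR_module M d_hom d_hom dd])
  also have "\<dots> \<longleftrightarrow> (\<forall>x. Poly_Mapping.keys x \<subseteq> carrier (FR (Suc n)) \<times> carrier M \<longrightarrow>
      mat_apply (cmat (Suc (Suc n))) M (tensor_coords M x) = (\<lambda>_. \<zero>\<^bsub>M\<^esub>) \<longrightarrow>
      (\<exists>y. Poly_Mapping.keys y \<subseteq> carrier (FR (Suc (Suc n))) \<times> carrier M \<and>
        mat_apply (cmat (Suc (Suc (Suc n)))) M (tensor_coords M y) = tensor_coords M x))"
    by (simp add: 1 2 cong: conj_cong imp_cong)
  also have "\<dots> \<longleftrightarrow> ?rhs"
  proof
    assume L: "\<forall>x. Poly_Mapping.keys x \<subseteq> carrier (FR (Suc n)) \<times> carrier M \<longrightarrow>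
      mat_apply (cmat (Suc (Suc n))) M (tensor_coords M x) = (\<lambda>_. \<zero>\<^bsub>M\<^esub>) \<longrightarrow>
      (\<exists>y. Poly_Mapping.keys y \<subseteq> carrier (FR (Suc (Suc n))) \<times> carrier M \<and>
        mat_apply (cmat (Suc (Suc (Suc n)))) M (tensor_coords M y) = tensor_coords M x)"
    show ?rhs
    proof (intro ballI impI)
      fix z assume z: "z \<in> fin_supp (B (Suc n)) (\<lambda>_. M)" "mat_apply (cmat (Suc (Suc n))) M z = (\<lambda>_. \<zero>\<^bsub>M\<^esub>)"
      obtain x where x: "Poly_Mapping.keys x \<subseteq> carrier (FR (Suc n)) \<times> carrier M" "tensor_coords M x = z"
        using M.tensor_coords_surj[OF z(1)] by blast
      then obtain y where "Poly_Mapping.keys y \<subseteq> carrier (FR (Suc (Suc n))) \<times> carrier M"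
          "mat_apply (cmat (Suc (Suc (Suc n)))) M (tensor_coords M y) = z"
        using L z(2) by blast
      then show "\<exists>w\<in>fin_supp (B (Suc (Suc n))) (\<lambda>_. M). mat_apply (cmat (Suc (Suc (Suc n)))) M w = z"
        using ch' by blast
    qed
  next
    assume Rh: ?rhs
    show "\<forall>x. Poly_Mapping.keys x \<subseteq> carrier (FR (Suc n)) \<times> carrier M \<longrightarrow>
      mat_apply (cmat (Suc (Suc n))) M (tensor_coords M x) = (\<lambda>_. \<zero>\<^bsub>M\<^esub>) \<longrightarrow>
      (\<exists>y. Poly_Mapping.keys y \<subseteq> carrier (FR (Suc (Suc n))) \<times> carrier M \<and>
        mat_apply (cmat (Suc (Suc (Suc n)))) M (tensor_coords M y) = tensor_coords M x)"
    proof (intro allI impI)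
      fix x assume x: "Poly_Mapping.keys x \<subseteq> carrier (FR (Suc n)) \<times> carrier M"
        "mat_apply (cmat (Suc (Suc n))) M (tensor_coords M x) = (\<lambda>_. \<zero>\<^bsub>M\<^esub>)"
      then obtain w where w: "w \<in> fin_supp (B (Suc (Suc n))) (\<lambda>_. M)" "mat_apply (cmat (Suc (Suc (Suc n)))) M w = tensor_coords M x"
        using Rh ch'[OF x(1)] by blast
      obtain y where "Poly_Mapping.keys y \<subseteq> carrier (FR (Suc (Suc n))) \<times> carrier M" "tensor_coords M y = w"
        using M.tensor_coords_surj[OF w(1)] by blast
      then show "\<exists>y. Poly_Mapping.keys y \<subseteq> carrier (FR (Suc (Suc n))) \<times> carrier M \<and>
        mat_apply (cmat (Suc (Suc (Suc n)))) M (tensor_coords M y) = tensor_coords M x"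
        using w(2) by blast
    qed
  qed
  finally show ?thesis .
qed

end

section \<open>The multiplication map, right exactness and h-unitary modules\<close>

context ideal_resolution
begin

abbreviation "mul M \<equiv> eval_frag M (\<lambda>(a, m). a \<odot>\<^bsub>M\<^esub> m)"

lemma mul_props:
  assumes M: "left_module R M"
  shows "Poly_Mapping.keys x \<subseteq> A \<times> carrier M \<Longrightarrow> mul M x \<in> carrier M"
    and "Poly_Mapping.keys x \<subseteq> A \<times> carrier M \<Longrightarrow> Poly_Mapping.keys y \<subseteq> A \<times> carrier M \<Longrightarrow>
      mul M (x + y) = mul M x \<oplus>\<^bsub>M\<^esub> mul M y"
    and "Poly_Mapping.keys x \<subseteq> A \<times> carrier M \<Longrightarrow> Poly_Mapping.keys y \<subseteq> A \<times> carrier M \<Longrightarrow>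
      mul M (x - y) = mul M x \<ominus>\<^bsub>M\<^esub> mul M y"
    and "mul M 0 = \<zero>\<^bsub>M\<^esub>"
    and "a \<in> A \<Longrightarrow> m \<in> carrier M \<Longrightarrow> mul M (frag_of (a, m)) = a \<odot>\<^bsub>M\<^esub> m"
    and "x \<in> tensor_rels R AR M \<Longrightarrow> mul M x = \<zero>\<^bsub>M\<^esub>"
proof -
  interpret M: left_module R M by fact
  have f: "(\<lambda>(a, m). a \<odot>\<^bsub>M\<^esub> m) \<in> A \<times> carrier M \<rightarrow> carrier M"
    using A_subset by (auto simp: M.smult_closed)
  note ev = eval_frag[OF M.abelian_group_axioms f]
  show "Poly_Mapping.keys x \<subseteq> A \<times> carrier M \<Longrightarrow> mul M x \<in> carrier M" by (rule ev(1))
  show "Poly_Mapping.keys x \<subseteq> A \<times> carrier M \<Longrightarrow> Poly_Mapping.keys y \<subseteq> A \<times> carrier M \<Longrightarrow>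
      mul M (x + y) = mul M x \<oplus>\<^bsub>M\<^esub> mul M y" by (rule ev(2))
  show "Poly_Mapping.keys x \<subseteq> A \<times> carrier M \<Longrightarrow> Poly_Mapping.keys y \<subseteq> A \<times> carrier M \<Longrightarrow>
      mul M (x - y) = mul M x \<ominus>\<^bsub>M\<^esub> mul M y" by (rule ev(3))
  show "mul M 0 = \<zero>\<^bsub>M\<^esub>" by (rule ev(4))
  show "a \<in> A \<Longrightarrow> m \<in> carrier M \<Longrightarrow> mul M (frag_of (a, m)) = a \<odot>\<^bsub>M\<^esub> m"
    using ev(5)[of "(a, m)"] by simp
  show "x \<in> tensor_rels R AR M \<Longrightarrow> mul M x = \<zero>\<^bsub>M\<^esub>"
    by (rule M.eval_frag_rels[OF AR_module, where h = "\<lambda>a. a"]) (auto simp: AR_sel A_subset)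
qed

lemma tensor_mult_iso_iff:
  assumes M: "left_module R M"
  shows "tensor_mult M \<in> iso (tensor R AR M) (add_monoid M) \<longleftrightarrow>
    (\<forall>m\<in>carrier M. \<exists>x. Poly_Mapping.keys x \<subseteq> A \<times> carrier M \<and> mul M x = m) \<and>
    (\<forall>x. Poly_Mapping.keys x \<subseteq> A \<times> carrier M \<longrightarrow> mul M x = \<zero>\<^bsub>M\<^esub> \<longrightarrow> x \<in> tensor_rels R AR M)"
    (is "_ \<longleftrightarrow> ?surj \<and> ?inj")
proof -
  interpret M: left_module R M by fact
  note T = tensor_rels_closed[OF AR_module M, unfolded AR_sel] and s = tensor_sel[OF AR_module M, unfolded AR_sel]
    and mp = mul_props[OF M]
  \<comment> \<open>\<open>mul\<close> kills relations, so it is constant on a coset and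
    \<open>the_elem\<close> returns its value there.\<close>
  have cls: "tensor_mult M (tensor_class R AR M x) = mul M x" if x: "Poly_Mapping.keys x \<subseteq> A \<times> carrier M" for x
  proof -
    have "(\<lambda>(a, m). a \<odot>\<^bsub>M\<^esub> m) = (\<lambda>p. fst p \<odot>\<^bsub>M\<^esub> snd p)" by auto
    then have "tensor_mult M (tensor_class R AR M x) = the_elem (mul M ` tensor_class R AR M x)"
      by (simp add: tensor_mult_def eval_frag_def)
    also have "mul M ` tensor_class R AR M x = (\<lambda>t. mul M x) ` tensor_rels R AR M"
      unfolding tensor_class_def image_image
    proof (rule image_cong[OF refl])
      fix t assume t: "t \<in> tensor_rels R AR M"
      show "mul M (t + x) = mul M x" using mp(2)[OF T(1)[OF t] x] mp(6)[OF t] mp(1)[OF x] by simp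
    qed
    also have "\<dots> = {mul M x}" using T(2) by blast
    finally show ?thesis by simp
  qed
  have "tensor_mult M \<in> hom (tensor R AR M) (add_monoid M)"
  proof (rule homI)
    show "tensor_mult M X \<in> carrier (add_monoid M)" if "X \<in> carrier (tensor R AR M)" for X
      using that mp(1) by (auto simp: s(1) cls)
    show "tensor_mult M (X \<otimes>\<^bsub>tensor R AR M\<^esub> Y) = tensor_mult M X \<otimes>\<^bsub>add_monoid M\<^esub> tensor_mult M Y"
      if XY: "X \<in> carrier (tensor R AR M)" "Y \<in> carrier (tensor R AR M)" for X Y
    proof -
      obtain x y where x: "X = tensor_class R AR M x" "Poly_Mapping.keys x \<subseteq> A \<times> carrier M"
        and y: "Y = tensor_class R AR M y" "Poly_Mapping.keys y \<subseteq> A \<times> carrier M"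
        using XY by (auto simp: s(1))
      have "Poly_Mapping.keys (x + y) \<subseteq> A \<times> carrier M" using keys_add[of x y] x(2) y(2) by blast
      then show ?thesis using x y by (simp add: s(3) cls mp(2))
    qed
  qed
  then have "tensor_mult M \<in> iso (tensor R AR M) (add_monoid M) \<longleftrightarrow>
      inj_on (tensor_mult M) (carrier (tensor R AR M)) \<and> tensor_mult M ` carrier (tensor R AR M) = carrier M"
    by (simp add: iso_def bij_betw_def)
  also have "tensor_mult M ` carrier (tensor R AR M) = mul M ` {x. Poly_Mapping.keys x \<subseteq> A \<times> carrier M}"
    unfolding s(1) image_image by (rule image_cong[OF refl]) (simp add: cls)
  also have "(mul M ` {x. Poly_Mapping.keys x \<subseteq> A \<times> carrier M} = carrier M) \<longleftrightarrow> ?surj"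
  proof
    assume eq: "mul M ` {x. Poly_Mapping.keys x \<subseteq> A \<times> carrier M} = carrier M"
    show ?surj
    proof
      fix m assume "m \<in> carrier M"
      then have "m \<in> mul M ` {x. Poly_Mapping.keys x \<subseteq> A \<times> carrier M}" using eq by simp
      then show "\<exists>x. Poly_Mapping.keys x \<subseteq> A \<times> carrier M \<and> mul M x = m" by blast
    qed
  next
    assume surj: ?surj
    show "mul M ` {x. Poly_Mapping.keys x \<subseteq> A \<times> carrier M} = carrier M"
    proof (intro equalityI subsetI)
      fix m assume "m \<in> mul M ` {x. Poly_Mapping.keys x \<subseteq> A \<times> carrier M}"
      then obtain x where "Poly_Mapping.keys x \<subseteq> A \<times> carrier M" "m = mul M x" by blast
      then show "m \<in> carrier M" using mp(1) by simp
    next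
      fix m assume "m \<in> carrier M"
      then obtain x where "Poly_Mapping.keys x \<subseteq> A \<times> carrier M" "mul M x = m" using surj by blast
      then show "m \<in> mul M ` {x. Poly_Mapping.keys x \<subseteq> A \<times> carrier M}" by blast
    qed
  qed
  also have "inj_on (tensor_mult M) (carrier (tensor R AR M)) \<longleftrightarrow> ?inj"
  proof
    assume inj: "inj_on (tensor_mult M) (carrier (tensor R AR M))"
    show ?inj
    proof (intro allI impI)
      fix x assume x: "Poly_Mapping.keys x \<subseteq> A \<times> carrier M" "mul M x = \<zero>\<^bsub>M\<^esub>"
      then have "tensor_mult M (tensor_class R AR M x) = tensor_mult M (tensor_class R AR M 0)"
        by (simp add: cls mp(4))
      then have "tensor_class R AR M x = tensor_class R AR M 0"
        using x(1) by (intro inj_onD[OF inj]) (auto simp: s(1))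
      then show "x \<in> tensor_rels R AR M" using tensor_class_eq_iff[OF AR_module M, of x 0] by simp
    qed
  next
    assume inj: ?inj
    show "inj_on (tensor_mult M) (carrier (tensor R AR M))"
    proof (rule inj_onI)
      fix X Y assume XY: "X \<in> carrier (tensor R AR M)" "Y \<in> carrier (tensor R AR M)"
        and eq: "tensor_mult M X = tensor_mult M Y"
      obtain x y where x: "X = tensor_class R AR M x" "Poly_Mapping.keys x \<subseteq> A \<times> carrier M"
        and y: "Y = tensor_class R AR M y" "Poly_Mapping.keys y \<subseteq> A \<times> carrier M"
        using XY by (auto simp: s(1))
      have "mul M (x - y) = \<zero>\<^bsub>M\<^esub>"
        using eq mp(1)[OF x(2)] mp(1)[OF y(2)] by (simp add: x(1) y(1) cls x(2) y(2) mp(3) M.minus_eq_zero_iff)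
      moreover have "Poly_Mapping.keys (x - y) \<subseteq> A \<times> carrier M" using keys_diff[of x y] x(2) y(2) by blast
      ultimately have "x - y \<in> tensor_rels R AR M" using inj by blast
      then show "X = Y" using tensor_class_eq_iff[OF AR_module M] x(1) y(1) by simp
    qed
  qed
  finally show ?thesis by blast
qed

lemma eps_fst_keys:
  "Poly_Mapping.keys y \<subseteq> carrier (FR 0) \<times> carrier M \<Longrightarrow> Poly_Mapping.keys (frag_fst eps y) \<subseteq> A \<times> carrier M"
  by (rule frag_fst_keys) (use mod_homD(1)[OF eps_hom] in \<open>auto simp: AR_sel\<close>)

text \<open>Both sides send \<open>p \<otimes> m\<close> to the product of \<open>eps p\<close> with
  \<open>m\<close>: in coordinates, the augmentation is multiplication after
  \<open>eps\<close>.\<close>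

lemma mul_eps:
  assumes M: "left_module R M" and y: "Poly_Mapping.keys y \<subseteq> carrier (FR 0) \<times> carrier M"
  shows "mul M (frag_fst eps y) = aug M (tensor_coords M y)"
proof -
  interpret M: left_module R M by fact
  note mp = mul_props[OF M]
  show ?thesis
    using y
  proof (induction rule: free_Abelian_group_induct[consumes 1, case_names 1 2 3])
    case 1
    show ?case by (simp add: mp(4) M.tensor_coords_props(4) M.mat_apply_zero cmat_closed)
  next
    case (2 x y)
    then show ?case
      using mp(3)[OF eps_fst_keys eps_fst_keys, OF 2(1,2)] M.tensor_coords_props(3)[OF 2(1,2)]
        M.mat_apply_minus[where P = "cmat (Suc 0)", OF cmat_closed M.tensor_coords_props(1) M.tensor_coords_props(1), OF 2(1,2)]
      by (simp add: frag_extend_diff)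
  next
    case (3 a)
    then obtain p m where a: "a = (p, m)" "p \<in> carrier (FR 0)" "m \<in> carrier M" by auto
    have "eps p \<in> A" using mod_homD(1)[OF eps_hom a(2)] by (simp add: AR_sel)
    then show ?case
      using M.mat_apply_coords[where Q = "cmat (Suc 0)", OF cmat_closed a(2,3)] eps_expand[OF a(2)]
      by (simp add: a(1) mp(5) a(3) M.tensor_coords_props(5)[OF a(2,3)])
  qed
qed

text \<open>Right exactness of \<open>- \<otimes> M\<close> at \<open>FR 0\<close>: a set-theoretic section of \<open>eps\<close> respects the relations
  modulo the image of \<open>d 0\<close>.\<close>

lemma right_exact:
  assumes M: "left_module R M" and y: "Poly_Mapping.keys y \<subseteq> carrier (FR 0) \<times> carrier M"
    and e: "frag_fst eps y \<in> tensor_rels R AR M"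
  shows "\<exists>w\<in>fin_supp (B (Suc 0)) (\<lambda>_. M). mat_apply (cmat (Suc (Suc 0))) M w = tensor_coords M y"
proof -
  interpret M: left_module R M by fact
  interpret F: left_module "opposite_ring R" "FR 0" by (rule FR_module)
  let ?S = "carrier (FR 0) \<times> carrier M"
  \<comment> \<open>The image of \<open>d 0\<close> tensored with \<open>M\<close>, enlarged by the
    relations and recognised by coordinates.\<close>
  define E where "E = {x. Poly_Mapping.keys x \<subseteq> ?S \<and>
    (\<exists>w\<in>fin_supp (B (Suc 0)) (\<lambda>_. M). mat_apply (cmat (Suc (Suc 0))) M w = tensor_coords M x)}"
  have Eminus: "x - y \<in> E" if xy: "x \<in> E" "y \<in> E" for x y
  proof -
    obtain u v where u: "u \<in> fin_supp (B (Suc 0)) (\<lambda>_. M)" "mat_apply (cmat (Suc (Suc 0))) M u = tensor_coords M x"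
      and v: "v \<in> fin_supp (B (Suc 0)) (\<lambda>_. M)" "mat_apply (cmat (Suc (Suc 0))) M v = tensor_coords M y"
      and k: "Poly_Mapping.keys x \<subseteq> ?S" "Poly_Mapping.keys y \<subseteq> ?S"
      using xy unfolding E_def by blast
    have "mat_apply (cmat (Suc (Suc 0))) M (\<lambda>c. u c \<ominus>\<^bsub>M\<^esub> v c) = tensor_coords M (x - y)"
      using M.mat_apply_minus[where P = "cmat (Suc (Suc 0))", OF cmat_closed u(1) v(1)] u(2) v(2) M.tensor_coords_props(3)[OF k] by simp
    moreover have "Poly_Mapping.keys (x - y) \<subseteq> ?S" using keys_diff[of x y] k by blast
    ultimately show ?thesis
      unfolding E_def using fin_supp_minus[OF M.abelian_group_axioms u(1) v(1)] by blast
  qed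
  have ET: "x \<in> E" if x: "x \<in> tensor_rels R (FR 0) M" for x
  proof -
    have "mat_apply (cmat (Suc (Suc 0))) M (\<lambda>_. \<zero>\<^bsub>M\<^esub>) = tensor_coords M x"
      using M.mat_apply_zero[where P = "cmat (Suc (Suc 0))", OF cmat_closed] M.tensor_coords_rels[OF x] by simp
    then show ?thesis
      unfolding E_def using tensor_rels_closed(1)[OF FR_module M x] fin_supp_zero[OF M.abelian_group_axioms] by blast
  qed
  have E0: "0 \<in> E" by (rule ET) (rule tensor_rels_closed(2)[OF FR_module M])
  have Eplus: "x + y \<in> E" if "x \<in> E" "y \<in> E" for x y
    using Eminus[OF that(1) Eminus[OF E0 that(2)]] by simp
  have Eker: "frag_of (f, m) \<in> E" if f: "f \<in> carrier (FR 0)" "eps f = \<zero>" and m: "m \<in> carrier M" for f m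
  proof -
    have "f \<in> d 0 ` carrier (FR (Suc 0))" using f unfolding d_image_0 by simp
    then obtain g where g: "g \<in> carrier (FR (Suc 0))" "f = d 0 g" by blast
    have k: "Poly_Mapping.keys (frag_of (g, m)) \<subseteq> carrier (FR (Suc 0)) \<times> carrier M"
      using g m by (simp add: keys_frag_of)
    have "mat_apply (cmat (Suc (Suc 0))) M (tensor_coords M (frag_of (g, m))) = tensor_coords M (frag_of (f, m))"
      using M.tensor_coords_frag_fst[OF d_hom cmat_closed d_expand k] g(2) by simp
    moreover have "Poly_Mapping.keys (frag_of (f, m)) \<subseteq> ?S" using f m by (simp add: keys_frag_of)
    ultimately show ?thesis
      unfolding E_def using M.tensor_coords_props(1)[OF k] by blast
  qed
  \<comment> \<open>Modulo relations the difference is a pure tensor with first factor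
    \<open>p - q\<close>, which lies in the kernel of \<open>eps\<close>, the image of
    \<open>d 0\<close>.\<close>
  have Ediff: "frag_of (p, m) - frag_of (q, m) \<in> E"
    if pq: "p \<in> carrier (FR 0)" "q \<in> carrier (FR 0)" "eps p = eps q" and m: "m \<in> carrier M" for p q m
  proof -
    let ?f = "p \<ominus>\<^bsub>FR 0\<^esub> q"
    interpret AM: left_module "opposite_ring R" AR by (rule AR_module)
    have f: "?f \<in> carrier (FR 0)" using pq by simp
    have "eps ?f = \<zero>"
      using mod_hom_minus(3)[OF FR_module AR_module, of eps 0 p q] eps_hom pq mod_homD(1)[OF eps_hom]
      by (simp add: mod_hom_opposite AM.minus_eq_zero_iff[unfolded AR_sel(2)])
    from Eker[OF f this m] have 1: "frag_of (?f, m) \<in> E" .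
    have "frag_of (?f \<oplus>\<^bsub>FR 0\<^esub> q, m) - frag_of (?f, m) - frag_of (q, m) \<in> E"
      by (rule ET) (rule tensor_rels_intros(1)[OF f pq(2) m])
    from Eplus[OF this 1] show ?thesis using F.minus_add_cancel[OF pq(1,2)] by simp
  qed
  \<comment> \<open>Not additive, but its defects lie in the kernel of \<open>eps\<close>; by
    \<open>Ediff\<close> they vanish modulo \<open>E\<close>, so \<open>sec\<close> carries
    relations for the ideal into \<open>E\<close>.\<close>
  define sec where "sec a = (SOME f. f \<in> carrier (FR 0) \<and> eps f = a)" for a
  have sec: "sec a \<in> carrier (FR 0)" "eps (sec a) = a" if "a \<in> A" for a
  proof -
    have "\<exists>f. f \<in> carrier (FR 0) \<and> eps f = a" using that unfolding eps_surj[symmetric] by blast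
    from someI_ex[OF this] show "sec a \<in> carrier (FR 0)" "eps (sec a) = a" unfolding sec_def by blast+
  qed
  note eh = mod_homD[OF eps_hom, unfolded AR_sel]
  have A_add: "a \<oplus> b \<in> A" "a \<otimes> r \<in> A" if "a \<in> A" "b \<in> A" "r \<in> carrier R" for a b r
    using abelian_groupE(1)[OF left_moduleE(2)[OF AR_module], of a b]
      left_module.smult_closed[OF AR_module, of r a] that by (simp_all add: AR_sel)
  have "frag_fst sec x \<in> E" if "x \<in> tensor_rels R AR M" for x
    using AR_module M that
  proof (induction rule: tensor_rels_induct)
    case (left a b m)
    then have ab: "a \<in> A" "b \<in> A" by (simp_all add: AR_sel)
    note sa = sec[OF ab(1)] and sb = sec[OF ab(2)] and sab = sec[OF A_add(1)[OF ab ring.ring_simprules(2)[OF ring_R]]]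
    have s: "sec a \<oplus>\<^bsub>FR 0\<^esub> sec b \<in> carrier (FR 0)" using sa sb by simp
    have "(frag_of (sec (a \<oplus> b), m) - frag_of (sec a \<oplus>\<^bsub>FR 0\<^esub> sec b, m)) +
        (frag_of (sec a \<oplus>\<^bsub>FR 0\<^esub> sec b, m) - frag_of (sec a, m) - frag_of (sec b, m)) \<in> E"
      by (rule Eplus[OF Ediff ET])
        (use sab s sa sb eh(2)[OF sa(1) sb(1)] left in \<open>auto intro: tensor_rels_intros(1)\<close>)
    then show ?case by (simp add: frag_extend_diff frag_extend_add AR_sel algebra_simps)
  next
    case (right a m n)
    then have "sec a \<in> carrier (FR 0)" using sec by (simp add: AR_sel)
    then show ?case using ET[OF tensor_rels_intros(2)] right by (simp add: frag_extend_diff)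
  next
    case (assoc a r m)
    then have a: "a \<in> A" by (simp add: AR_sel)
    note sa = sec[OF a] and sar = sec[OF A_add(2)[OF a a assoc(2)]]
    have s: "r \<odot>\<^bsub>FR 0\<^esub> sec a \<in> carrier (FR 0)" using F.smult_closed[of r "sec a"] sa(1) assoc(2) by simp
    have "(frag_of (sec (a \<otimes> r), m) - frag_of (r \<odot>\<^bsub>FR 0\<^esub> sec a, m)) +
        (frag_of (r \<odot>\<^bsub>FR 0\<^esub> sec a, m) - frag_of (sec a, r \<odot>\<^bsub>M\<^esub> m)) \<in> E"
      by (rule Eplus[OF Ediff ET])
        (use sar s sa eh(3)[OF assoc(2) sa(1)] assoc in \<open>auto intro: tensor_rels_intros(3)\<close>)
    then show ?case by (simp add: frag_extend_diff AR_sel)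
  next
    case zero
    show ?case using E0 by simp
  next
    case (diff x y)
    then show ?case using Eminus by (simp add: frag_extend_diff)
  qed
  from this[OF e] have 1: "frag_fst sec (frag_fst eps y) \<in> E" .
  \<comment> \<open>\<open>sec (eps p)\<close> and \<open>p\<close> have the same image under
    \<open>eps\<close>, so \<open>Ediff\<close> applies to each term.\<close>
  have "frag_fst sec (frag_fst eps y) - y \<in> E"
    using y
  proof (induction rule: free_Abelian_group_induct[consumes 1, case_names 1 2 3])
    case 1
    show ?case using E0 by simp
  next
    case (2 x y)
    then show ?case using Eminus[OF 2(3,4)] by (simp add: frag_extend_diff algebra_simps)
  next
    case (3 a)
    then obtain p m where a: "a = (p, m)" "p \<in> carrier (FR 0)" "m \<in> carrier M" by auto
    have "eps p \<in> A" using eh(1)[OF a(2)] .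
    then show ?case using Ediff[OF sec(1) a(2) sec(2) a(3)] by (simp add: a(1))
  qed
  from Eminus[OF 1 this] have "y \<in> E" by simp
  then show ?thesis unfolding E_def by blast
qed

text \<open>The composite of \<open>d 0\<close> and \<open>eps\<close> vanishes, and a pure tensor
  with first factor zero is a relation.\<close>

lemma eps_d_rels:
  assumes M: "left_module R M" and v: "Poly_Mapping.keys v \<subseteq> carrier (FR (Suc 0)) \<times> carrier M"
  shows "frag_fst eps (frag_fst (d 0) v) \<in> tensor_rels R AR M"
  using v
proof (induction rule: free_Abelian_group_induct[consumes 1, case_names 1 2 3])
  case 1
  show ?case using tensor_rels_closed(2)[OF AR_module M] by simp
next
  case (2 x y)
  then show ?case using tensor_rels_closed(5)[OF AR_module M] by (simp add: frag_extend_diff)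
next
  case (3 a)
  then obtain p m where a: "a = (p, m)" "p \<in> carrier (FR (Suc 0))" "m \<in> carrier M" by auto
  have "d 0 p \<in> {f \<in> carrier (FR 0). eps f = \<zero>}" unfolding d_image_0[symmetric] using a(2) by (rule imageI)
  then show ?case using tensor_rels_zero_left[OF AR_module M a(3)] by (simp add: a(1) AR_sel)
qed

text \<open>The tensor product with the ideal is the cokernel of \<open>d 0\<close> tensored with
  \<open>M\<close>. Hence surjectivity of the multiplication map is exactness at \<open>M\<close>,
  and its injectivity is exactness at degree 0 of the resolution.\<close>

lemma tensor_mult_iso_iff_exact:
  assumes M: "left_module R M"
  shows "tensor_mult M \<in> iso (tensor R AR M) (add_monoid M) \<longleftrightarrow>
    (\<forall>m\<in>carrier M. \<exists>w\<in>fin_supp (B 0) (\<lambda>_. M). aug M w = m) \<and>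
    (\<forall>z\<in>fin_supp (B 0) (\<lambda>_. M). aug M z = \<zero>\<^bsub>M\<^esub> \<longrightarrow>
       (\<exists>w\<in>fin_supp (B (Suc 0)) (\<lambda>_. M). mat_apply (cmat (Suc (Suc 0))) M w = z))"
    (is "_ \<longleftrightarrow> ?C0 \<and> ?C1")
proof -
  interpret M: left_module R M by fact
  have lift: "\<exists>y. Poly_Mapping.keys y \<subseteq> carrier (FR 0) \<times> carrier M \<and> frag_fst eps y = x"
    if "Poly_Mapping.keys x \<subseteq> A \<times> carrier M" for x
    by (rule frag_fst_surj[OF _ that]) (use eps_surj in blast)
  have "(\<forall>m\<in>carrier M. \<exists>x. Poly_Mapping.keys x \<subseteq> A \<times> carrier M \<and> mul M x = m) \<longleftrightarrow> ?C0"
  proof (intro ball_cong refl iffI)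
    fix m assume "\<exists>x. Poly_Mapping.keys x \<subseteq> A \<times> carrier M \<and> mul M x = m"
    then obtain x where x: "Poly_Mapping.keys x \<subseteq> A \<times> carrier M" "mul M x = m" by blast
    obtain y where y: "Poly_Mapping.keys y \<subseteq> carrier (FR 0) \<times> carrier M" "frag_fst eps y = x" using lift[OF x(1)] by blast
    show "\<exists>w\<in>fin_supp (B 0) (\<lambda>_. M). aug M w = m"
      using mul_eps[OF M y(1)] x(2) y(2) M.tensor_coords_props(1)[OF y(1)] by auto
  next
    fix m assume "\<exists>w\<in>fin_supp (B 0) (\<lambda>_. M). aug M w = m"
    then obtain w where w: "w \<in> fin_supp (B 0) (\<lambda>_. M)" "aug M w = m" by blast
    obtain y where y: "Poly_Mapping.keys y \<subseteq> carrier (FR 0) \<times> carrier M" "tensor_coords M y = w"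
      using M.tensor_coords_surj[OF w(1)] by blast
    show "\<exists>x. Poly_Mapping.keys x \<subseteq> A \<times> carrier M \<and> mul M x = m"
      using mul_eps[OF M y(1)] y(2) w(2) eps_fst_keys[OF y(1)] by auto
  qed
  moreover have "(\<forall>x. Poly_Mapping.keys x \<subseteq> A \<times> carrier M \<longrightarrow> mul M x = \<zero>\<^bsub>M\<^esub> \<longrightarrow> x \<in> tensor_rels R AR M) \<longleftrightarrow> ?C1"
  proof
    assume inj: "\<forall>x. Poly_Mapping.keys x \<subseteq> A \<times> carrier M \<longrightarrow> mul M x = \<zero>\<^bsub>M\<^esub> \<longrightarrow> x \<in> tensor_rels R AR M"
    show ?C1
    proof (intro ballI impI)
      fix z assume z: "z \<in> fin_supp (B 0) (\<lambda>_. M)" "aug M z = \<zero>\<^bsub>M\<^esub>"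
      obtain y where y: "Poly_Mapping.keys y \<subseteq> carrier (FR 0) \<times> carrier M" "tensor_coords M y = z"
        using M.tensor_coords_surj[OF z(1)] by blast
      have "frag_fst eps y \<in> tensor_rels R AR M"
        using inj eps_fst_keys[OF y(1)] mul_eps[OF M y(1)] y(2) z(2) by simp
      from right_exact[OF M y(1) this]
      show "\<exists>w\<in>fin_supp (B (Suc 0)) (\<lambda>_. M). mat_apply (cmat (Suc (Suc 0))) M w = z" unfolding y(2) .
    qed
  next
    assume C1: ?C1
    show "\<forall>x. Poly_Mapping.keys x \<subseteq> A \<times> carrier M \<longrightarrow> mul M x = \<zero>\<^bsub>M\<^esub> \<longrightarrow> x \<in> tensor_rels R AR M"
    proof (intro allI impI)
      fix x assume x: "Poly_Mapping.keys x \<subseteq> A \<times> carrier M" "mul M x = \<zero>\<^bsub>M\<^esub>"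
      obtain y where y: "Poly_Mapping.keys y \<subseteq> carrier (FR 0) \<times> carrier M" "frag_fst eps y = x" using lift[OF x(1)] by blast
      have "aug M (tensor_coords M y) = \<zero>\<^bsub>M\<^esub>" using mul_eps[OF M y(1)] x(2) y(2) by simp
      then obtain w where w: "w \<in> fin_supp (B (Suc 0)) (\<lambda>_. M)" "mat_apply (cmat (Suc (Suc 0))) M w = tensor_coords M y"
        using C1 M.tensor_coords_props(1)[OF y(1)] by blast
      obtain v where v: "Poly_Mapping.keys v \<subseteq> carrier (FR (Suc 0)) \<times> carrier M" "tensor_coords M v = w"
        using M.tensor_coords_surj[OF w(1)] by blast
      have dv: "Poly_Mapping.keys (frag_fst (d 0) v) \<subseteq> carrier (FR 0) \<times> carrier M"
        by (rule frag_fst_keys[OF v(1)]) (rule mod_homD(1)[OF d_hom])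
      have "tensor_coords M y = tensor_coords M (frag_fst (d 0) v)"
        using M.tensor_coords_frag_fst[OF d_hom cmat_closed d_expand v(1)] v(2) w(2) by simp
      \<comment> \<open>The lift \<open>y\<close> of \<open>x\<close> is congruent to a boundary;
        applying \<open>eps\<close> to both turns this into a relation for \<open>x\<close>.\<close>
      then have "y - frag_fst (d 0) v \<in> tensor_rels R (FR 0) M"
        using M.tensor_coords_diff_iff[OF y(1) dv] by simp
      from frag_fst_tensor_rels[OF FR_module AR_module M eps_hom this]
      have "x - frag_fst eps (frag_fst (d 0) v) \<in> tensor_rels R AR M" by (simp add: frag_extend_diff y(2))
      from tensor_rels_closed(3)[OF AR_module M this eps_d_rels[OF M v(1)]]
      show "x \<in> tensor_rels R AR M" by simp
    qed
  qed
  ultimately show ?thesis unfolding tensor_mult_iso_iff[OF M] by blast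
qed

text \<open>In the shifted complex the multiplication map accounts for degrees 1 and 2, and the i-th
  \<open>Tor\<close> for degree i + 2.\<close>

lemma h_unitary_iff_exact:
  assumes ch: "chosen_resolution R AR = (B, d, eps)"
  shows "h_unitary R A M \<longleftrightarrow> exact_module M"
proof (cases "left_module R M")
  case True
  have "(\<forall>i\<ge>1. trivial_group (Tor R AR M i)) \<longleftrightarrow> (\<forall>n. trivial_group (Tor R AR M (Suc n)))"
    by (metis One_nat_def Suc_le_D Suc_le_mono le0)
  then show ?thesis
    unfolding h_unitary_def exact_module_iff[OF True] tensor_mult_iso_iff_exact[OF True] Tor_trivial_iff[OF True ch]
    using True by blast
next
  case False
  then show ?thesis using exact_moduleD by (auto simp: h_unitary_def)
qed

text \<open>A test module of any type maps to \<open>sum_over M\<close>, and \<open>h\<close>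
  carries it on to \<open>C\<close>; so one \<open>C\<close> serves for every
  \<open>'n\<close>.\<close>

lemma cover_for_of_cover:
  fixes M :: "('r, 'm) module" and e :: "('r, ('r, 'r) basis, 'm) big_tree \<Rightarrow> 'u"
  assumes ch: "chosen_resolution R AR = (B, d, eps)" and M: "left_module R M" and e: "inj e"
    and C: "exact_module C" and \<phi>: "\<phi> \<in> mod_hom R C M"
    and h: "h \<in> mod_hom R (sum_over M :: ('r, ('r, 'u) module \<times> ('u \<Rightarrow> 'm) \<Rightarrow> 'u) module) C"
    and \<phi>h: "\<And>x. x \<in> carrier (sum_over M) \<Longrightarrow> \<phi> (h x) = map_over M x"
    and bij: "\<And>g. g \<in> end_over C \<phi> \<Longrightarrow> bij_betw g (carrier C) (carrier C)"
  shows "cover_for TYPE('n) R A M C \<phi>"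
  unfolding cover_for_def
proof (intro conjI ballI impI)
  show "h_unitary R A C" using C h_unitary_iff_exact[OF ch] by blast
  show "\<phi> \<in> mod_hom R C M" by (rule \<phi>)
  show "precover_for TYPE('n) R A M C \<phi>"
    unfolding precover_for_def
  proof (intro allI impI, elim conjE)
    fix N :: "('r, 'n) module" and \<psi> assume N: "h_unitary R A N" and \<psi>: "\<psi> \<in> mod_hom R N M"
    have "exact_module N" using N h_unitary_iff_exact[OF ch] by blast
    from map_over_weakly_terminal[OF M e this \<psi>]
    obtain k where k: "k \<in> mod_hom R N (sum_over M :: ('r, ('r, 'u) module \<times> ('u \<Rightarrow> 'm) \<Rightarrow> 'u) module)"
      "\<forall>x\<in>carrier N. map_over M (k x) = \<psi> x" by blast
    show "\<exists>f\<in>mod_hom R N C. \<forall>x\<in>carrier N. \<phi> (f x) = \<psi> x"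
    proof (rule bexI[OF _ mod_hom_comp[OF k(1) h]], rule ballI)
      show "\<phi> (h (k x)) = \<psi> x" if "x \<in> carrier N" for x
        using \<phi>h[OF mod_homD(1)[OF k(1) that]] k(2) that by simp
    qed
  qed
  show "g \<in> mod_iso R C C" if "g \<in> mod_hom R C C" "\<forall>x\<in>carrier C. \<phi> (g x) = \<phi> x" for g
    using bij[of g] that by (simp add: mod_iso_def end_over_def)
qed

end

text \<open>Each cover is tested against the element type of the other, which yields maps
  \<open>f\<close> and \<open>g\<close> over \<open>M\<close>. Both composites are automorphisms, so
  \<open>f\<close> is bijective.\<close>

lemma covers_isomorphic:
  assumes C: "cover_for TYPE('a) R A M (C :: ('r, 'a) module) \<phi>" "cover_for TYPE('b) R A M C \<phi>"
    and D: "cover_for TYPE('a) R A M (D :: ('r, 'b) module) \<phi>'" "cover_for TYPE('b) R A M D \<phi>'"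
  shows "\<exists>\<theta>\<in>mod_iso R C D. \<forall>x\<in>carrier C. \<phi>' (\<theta> x) = \<phi> x"
proof -
  obtain f where f: "f \<in> mod_hom R C D" "\<And>x. x \<in> carrier C \<Longrightarrow> \<phi>' (f x) = \<phi> x"
    using D(1) C(1) unfolding cover_for_def precover_for_def by blast
  obtain g where g: "g \<in> mod_hom R D C" "\<And>x. x \<in> carrier D \<Longrightarrow> \<phi> (g x) = \<phi>' x"
    using C(2) D(2) unfolding cover_for_def precover_for_def by blast
  note fc = mod_homD(1)[OF f(1)] and gc = mod_homD(1)[OF g(1)]
  have "(\<lambda>x. g (f x)) \<in> mod_iso R C C"
    using C(1) mod_hom_comp[OF f(1) g(1)] f(2) g(2) fc unfolding cover_for_def by simp
  then have gf: "bij_betw (\<lambda>x. g (f x)) (carrier C) (carrier C)" by (simp add: mod_iso_def)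
  have "(\<lambda>x. f (g x)) \<in> mod_iso R D D"
    using D(1) mod_hom_comp[OF g(1) f(1)] f(2) g(2) gc unfolding cover_for_def by simp
  then have fg: "bij_betw (\<lambda>x. f (g x)) (carrier D) (carrier D)" by (simp add: mod_iso_def)
  have "inj_on f (carrier C)" using gf by (auto simp: bij_betw_def inj_on_def)
  moreover have "f ` carrier C = carrier D"
  proof
    show "f ` carrier C \<subseteq> carrier D" using fc by auto
    have "carrier D = (\<lambda>x. f (g x)) ` carrier D" using fg by (simp add: bij_betw_def)
    also have "\<dots> \<subseteq> f ` carrier C" using gc by auto
    finally show "carrier D \<subseteq> f ` carrier C" .
  qed
  ultimately have "f \<in> mod_iso R C D" using f(1) by (simp add: mod_iso_def bij_betw_def)
  then show ?thesis using f(2) by blast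
qed

theorem theorem3p1:
  fixes R :: "'r ring" and A :: "'r set" and M :: "('r, 'm) module"
  assumes "ring R" and "ideal A R" and "left_module R M"
  shows "(\<exists>(M\<^sub>H :: ('r, ('r, 'm) cover_elem) module) \<phi>.
            cover_for TYPE(('r, 'm) cover_elem) R A M M\<^sub>H \<phi>) \<and>
         (\<forall>(M\<^sub>H :: ('r, ('r, 'm) cover_elem) module) \<phi>.
            cover_for TYPE(('r, 'm) cover_elem) R A M M\<^sub>H \<phi> \<longrightarrow>
            cover_for TYPE('n) R A M M\<^sub>H \<phi>) \<and>
         (\<forall>(C :: ('r, 'a) module) \<phi> (D :: ('r, 'b) module) \<phi>'.
            cover_for TYPE('a) R A M C \<phi> \<and> cover_for TYPE('b) R A M C \<phi> \<and>
            cover_for TYPE('a) R A M D \<phi>' \<and> cover_for TYPE('b) R A M D \<phi>' \<longrightarrow>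
            (\<exists>\<theta>\<in>mod_iso R C D. \<forall>x\<in>carrier C. \<phi>' (\<theta> x) = \<phi> x))"
proof -
  note M = assms(3)
  obtain B d eps where ch: "chosen_resolution R (ideal_right_module R A) = (B, d, eps)" by (rule prod_cases3)
  interpret ideal_resolution R A B d eps
    using chosen_resolution[OF assms(2)] assms(2) by (simp add: ideal_resolution_def ch)
  obtain e :: "('r, ('r, 'r) basis, 'm) big_tree \<Rightarrow> ('r, 'm) cover_elem" where e: "inj e"
    using inj_big_tree_cover_elem by blast
  obtain C :: "('r, ('r, 'm) cover_elem) module" and \<phi> h where C: "exact_module C" "\<phi> \<in> mod_hom R C M"
    "h \<in> mod_hom R (sum_over M :: ('r, ('r, ('r, 'm) cover_elem) module \<times> (('r, 'm) cover_elem \<Rightarrow> 'm) \<Rightarrow> ('r, 'm) cover_elem) module) C"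
    "\<And>x. x \<in> carrier (sum_over M) \<Longrightarrow> \<phi> (h x) = map_over M x"
    "\<And>g. g \<in> end_over C \<phi> \<Longrightarrow> bij_betw g (carrier C) (carrier C)"
    by (rule cover_exists[OF M e], rule that)
  \<comment> \<open>The type of the test modules remains schematic in this fact, which is used at
    \<open>cover_elem\<close> and at \<open>'n\<close>.\<close>
  note cover = cover_for_of_cover[OF ch M e C]
  \<comment> \<open>A cover \<open>D\<close> that is tested only within \<open>cover_elem\<close> is
    isomorphic over \<open>M\<close> to the constructed \<open>C\<close>, and the factorizations
    through \<open>C\<close> for modules of type \<open>'n\<close> are carried along the
    isomorphism.\<close>
  have any: "cover_for TYPE('n) R A M D \<phi>'"
    if D: "cover_for TYPE(('r, 'm) cover_elem) R A M D \<phi>'" for D :: "('r, ('r, 'm) cover_elem) module" and \<phi>'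
  proof -
    obtain \<theta> where \<theta>: "\<theta> \<in> mod_iso R C D" "\<And>x. x \<in> carrier C \<Longrightarrow> \<phi>' (\<theta> x) = \<phi> x"
      using covers_isomorphic[OF cover cover D D] by blast
    have \<theta>h: "\<theta> \<in> mod_hom R C D" using \<theta>(1) by (simp add: mod_iso_def)
    have "precover_for TYPE('n) R A M D \<phi>'"
      unfolding precover_for_def
    proof (intro allI impI)
      fix N :: "('r, 'n) module" and \<psi> assume "h_unitary R A N \<and> \<psi> \<in> mod_hom R N M"
      moreover have "cover_for TYPE('n) R A M C \<phi>" by (rule cover)
      then have "precover_for TYPE('n) R A M C \<phi>" by (simp add: cover_for_def)
      ultimately obtain f where f: "f \<in> mod_hom R N C" "\<And>x. x \<in> carrier N \<Longrightarrow> \<phi> (f x) = \<psi> x"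
        unfolding precover_for_def by blast
      show "\<exists>f\<in>mod_hom R N D. \<forall>x\<in>carrier N. \<phi>' (f x) = \<psi> x"
        by (rule bexI[OF _ mod_hom_comp[OF f(1) \<theta>h]]) (use f \<theta>(2) mod_homD(1)[OF f(1)] in auto)
    qed
    then show ?thesis using D by (simp add: cover_for_def)
  qed
  show ?thesis
  proof (intro conjI)
    show "\<exists>(M\<^sub>H :: ('r, ('r, 'm) cover_elem) module) \<phi>. cover_for TYPE(('r, 'm) cover_elem) R A M M\<^sub>H \<phi>"
      by (intro exI) (rule cover)
    show "\<forall>(M\<^sub>H :: ('r, ('r, 'm) cover_elem) module) \<phi>.
        cover_for TYPE(('r, 'm) cover_elem) R A M M\<^sub>H \<phi> \<longrightarrow> cover_for TYPE('n) R A M M\<^sub>H \<phi>"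
      using any by blast
    show "\<forall>(C :: ('r, 'a) module) \<phi> (D :: ('r, 'b) module) \<phi>'.
        cover_for TYPE('a) R A M C \<phi> \<and> cover_for TYPE('b) R A M C \<phi> \<and>
        cover_for TYPE('a) R A M D \<phi>' \<and> cover_for TYPE('b) R A M D \<phi>' \<longrightarrow>
        (\<exists>\<theta>\<in>mod_iso R C D. \<forall>x\<in>carrier C. \<phi>' (\<theta> x) = \<phi> x)"
      by (intro allI impI, elim conjE, rule covers_isomorphic)
  qed
qed

end
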